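(* Let $\mathcal{H}$ be a separable Hilbert space, let $P_1,\dots,P_K$ be non-atomic Borel probability distributions on $\mathcal{H}$, and let $\mathbf{X}_{ki}$ ($k=1,\dots,K$, $i=1,\dots,n_k$) be independent random elements with $\mathbf{X}_{ki}\sim P_k$, where $n=\sum_{k=1}^K n_k$. Assume that $n^{-1}n_k\to\lambda_k\in(0,1)$ for all $k$ as $n\to\infty$. For $i,j,k\in\{1,\dots,K\}$ let $\mathbf{X}_i,\mathbf{Y}_j,\mathbf{Z}_k$ be independent random elements with distributions $P_i,P_j,P_k$ respectively, and define $$\mathbf{C}(i,j,k)=\mathrm{Cov}\big(E[\mathbf{s}(\mathbf{X}_i-\mathbf{Z}_k)\mid\mathbf{Z}_k],\;E[\mathbf{s}(\mathbf{Y}_j-\mathbf{Z}_k)\mid\mathbf{Z}_k]\big).$$ Let $\boldsymbol{\Sigma}=(\boldsymbol{\sigma}_{k_1k_2})_{K\times K}$, where $$\boldsymbol{\sigma}_{k_1k_2}=\sqrt{\lambda_{k_1}\lambda_{k_2}}\sum_{l=1}^K\lambda_l\big[\mathbf{C}(k_1,k_2,l)-\mathbf{C}(l,k_2,k_1)-\mathbf{C}(k_1,l,k_2)\big]+\sum_{l_1=1}^K\sum_{l_2=1}^K\lambda_{l_1}\lambda_{l_2}\mathbf{C}(l_1,l_2,k_1)\,\mathbb{I}(k_1=k_2).$$ Then $\mathbf{U}_n-E[\mathbf{U}_n]$ converges weakly in $\mathcal{H}^K$, as $n\to\infty$, to $G(\mathbf{0},\boldsymbol{\Sigma})$, a Gaussian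 random element in $\mathcal{H}^K$ with mean $\mathbf{0}$ and covariance operator $\boldsymbol{\Sigma}$.
   Context: $\mathcal{H}$ is a real separable Hilbert space with its Borel $\sigma$-field; $K\ge 2$ is fixed and the group sizes $n_k$ depend on $n$. Non-atomic means that every singleton has probability zero. Define $\mathbf{s}(\mathbf{x})=\mathbf{x}/\|\mathbf{x}\|$ for $\mathbf{x}\ne\mathbf{0}$ and $\mathbf{s}(\mathbf{0})=\mathbf{0}$. Put $\mathbf{R}(\mathbf{x})=n^{-1}\sum_{k=1}^K\sum_{i=1}^{n_k}\mathbf{s}(\mathbf{x}-\mathbf{X}_{ki})$, $\bar{\mathbf{R}}_k=n_k^{-1}\sum_{i=1}^{n_k}\mathbf{R}(\mathbf{X}_{ki})$, and $\mathbf{U}_n=(\sqrt{n_1}\bar{\mathbf{R}}_1,\dots,\sqrt{n_K}\bar{\mathbf{R}}_K)\in\mathcal{H}^K$, where $\mathcal{H}^K$ is the product Hilbert space with $\|(\mathbf{u}_1,\dots,\mathbf{u}_K)\|^2=\sum_k\|\mathbf{u}_k\|^2$. For $\mathbf{x},\mathbf{y}\in\mathcal{H}$, $\mathbf{x}\otimes\mathbf{y}$ is the operator $(\mathbf{x}\otimes\mathbf{y})(\mathbf{w})=\langle\mathbf{w},\mathbf{x}\rangle\mathbf{y}$, and $\mathrm{Cov}(\mathbf{A},\mathbf{B})=E[\mathbf{A}\otimes\mathbf{B}]-E[\mathbf{A}]\otimes E[\mathbf{B}]$. A $K\times K$ matrix of operators $(\boldsymbol{\sigma}_{k_1k_2})$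 is regarded as an operator on $\mathcal{H}^K$ with bilinear form $(\mathbf{w},\mathbf{v})\mapsto\sum_{k_1,k_2}\langle\boldsymbol{\sigma}_{k_1k_2}\mathbf{w}_{k_1},\mathbf{v}_{k_2}\rangle$; that is, $\boldsymbol{\sigma}_{k_1k_2}$ is the covariance $\mathrm{Cov}(\cdot,\cdot)$ between the $k_1$-th and $k_2$-th components. $\mathbb{I}$ is the indicator. In $\mathbf{C}(i,j,k)$ the three random elements are independent even when some of the indices coincide. *)

theory Defs
  imports "HOL-Probability.Probability"
begin

text \<open>
  The product Hilbert space is the library type \<open>'h ^ 'k\<close>, whose norm is
  the square root of the sum of the squared norms of the components.  Its second countability,
  which the Bochner integral asks for, is missing from the library.
\<close>

instance vec :: ("{metric_space, second_countable_topology}", finite) second_countable_topology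
proof
  obtain B :: "'a set set" where B: "countable B" "topological_basis B"
    using ex_countable_basis by blast
  define box where "box = (\<lambda>f :: 'b \<Rightarrow> 'a set. {y :: 'a ^ 'b. \<forall>i. y $ i \<in> f i})"
  define C where "C = box ` (UNIV \<rightarrow>\<^sub>E B)"
  have "countable C"
    unfolding C_def using B(1) by (intro countable_image countable_PiE) auto
  moreover have "topological_basis C"
  proof (rule topological_basisI)
    fix U assume "U \<in> C"
    then obtain f where "f \<in> UNIV \<rightarrow>\<^sub>E B" and U: "U = box f"
      unfolding C_def by blast
    then have f: "f i \<in> B" for i
      using PiE_mem[of f UNIV "\<lambda>_. B" i] by simp
    show "open U"
      unfolding U box_def open_vec_def mem_Collect_eq
      using f topological_basis_open[OF B(2)] by (intro ballI exI[of _ f]) auto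
  next
    fix U :: "('a ^ 'b) set" and x assume "open U" "x \<in> U"
    then obtain A where A: "\<And>i. open (A i)" "\<And>i. x $ i \<in> A i"
        "\<And>y. (\<forall>i. y $ i \<in> A i) \<Longrightarrow> y \<in> U"
      unfolding open_vec_def by (auto dest!: bspec[of U _ x])
    have "\<exists>V. V \<in> B \<and> x $ i \<in> V \<and> V \<subseteq> A i" for i
      by (rule topological_basisE[OF B(2) A(1)[of i] A(2)[of i]]) blast
    then have "\<exists>f. \<forall>i. f i \<in> B \<and> x $ i \<in> f i \<and> f i \<subseteq> A i"
      by (intro choice allI)
    then obtain f where f: "\<And>i. f i \<in> B" "\<And>i. x $ i \<in> f i" "\<And>i. f i \<subseteq> A i"
      by blast
    have "box f \<in> C" unfolding C_def using f(1) by (intro imageI) auto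
    moreover have "x \<in> box f" using f(2) by (simp add: box_def)
    moreover have "box f \<subseteq> U" using f(3) A(3) unfolding box_def by blast
    ultimately show "\<exists>V\<in>C. x \<in> V \<and> V \<subseteq> U" by blast
  qed
  ultimately show "\<exists>C :: ('a ^ 'b) set set. countable C \<and> open = generate_topology C"
    using topological_basis_imp_subbasis by blast
qed


text \<open>The spatial sign is the library function \<^const>\<open>sgn\<close>.\<close>

lemma sgn_eq_spatial_sign:
  fixes x :: "'h :: real_normed_vector"
  shows "sgn x = (if x = 0 then 0 else (1 / norm x) *\<^sub>R x)"
  by (simp add: sgn_div_norm inverse_eq_divide)

text \<open>
  Below, \<open>x k i\<close> for \<open>1 \<le> i \<le> m k\<close> is the pooled sample with
  group sizes \<open>m\<close>.
\<close>

definition spatial_rank ::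
    "('k::finite \<Rightarrow> nat \<Rightarrow> 'h::real_inner) \<Rightarrow> ('k \<Rightarrow> nat) \<Rightarrow> 'h \<Rightarrow> 'h" where
  "spatial_rank x m z =
     (1 / real (\<Sum>k\<in>UNIV. m k)) *\<^sub>R (\<Sum>k\<in>UNIV. \<Sum>i=1..m k. sgn (z - x k i))"

definition mean_rank ::
    "('k::finite \<Rightarrow> nat \<Rightarrow> 'h::real_inner) \<Rightarrow> ('k \<Rightarrow> nat) \<Rightarrow> 'k \<Rightarrow> 'h" where
  "mean_rank x m k = (1 / real (m k)) *\<^sub>R (\<Sum>i=1..m k. spatial_rank x m (x k i))"

definition rank_vector ::
    "('k::finite \<Rightarrow> nat \<Rightarrow> 'h::real_inner) \<Rightarrow> ('k \<Rightarrow> nat) \<Rightarrow> 'h ^ 'k" where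
  "rank_vector x m = (\<chi> k. sqrt (real (m k)) *\<^sub>R mean_rank x m k)"


definition tensor :: "'h::real_inner \<Rightarrow> 'h \<Rightarrow> 'h \<Rightarrow> 'h" where
  "tensor x y = (\<lambda>w. (w \<bullet> x) *\<^sub>R y)"

text \<open>
  The expectation of the random operator \<open>A \<otimes> B\<close> is taken pointwise:
  it sends \<open>w\<close> to the Bochner integral of \<open>(A \<otimes> B) w\<close>.
\<close>

definition cov_op ::
    "'w measure \<Rightarrow> ('w \<Rightarrow> 'h) \<Rightarrow> ('w \<Rightarrow> 'h)
       \<Rightarrow> 'h \<Rightarrow> 'h::{real_inner, banach, second_countable_topology}" where
  "cov_op M A B = (\<lambda>w. (\<integral>\<omega>. tensor (A \<omega>) (B \<omega>) w \<partial>M) - tensor (\<integral>\<omega>. A \<omega> \<partial>M) (\<integral>\<omega>. B \<omega> \<partial>M) w)"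

text \<open>
  The library has conditional expectations of real functions only.  The Hilbert space valued one
  is determined almost surely, and \<open>cond_exp_given\<close> picks a version.
\<close>

definition is_cond_exp ::
    "'w measure \<Rightarrow> 'w measure \<Rightarrow> ('w \<Rightarrow> 'h) \<Rightarrow>
       ('w \<Rightarrow> 'h::{real_inner, banach, second_countable_topology}) \<Rightarrow> bool" where
  "is_cond_exp M F Y g \<longleftrightarrow>
     subalgebra M F \<and> g \<in> borel_measurable F \<and> integrable M g \<and>
     (\<forall>S\<in>sets F. set_lebesgue_integral M S g = set_lebesgue_integral M S Y)"

definition cond_exp_given ::
    "'w measure \<Rightarrow> ('w \<Rightarrow> 'h) \<Rightarrow> ('w \<Rightarrow> 'h)
       \<Rightarrow> 'w \<Rightarrow> 'h::{real_inner, banach, second_countable_topology}" where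
  "cond_exp_given M Z Y = (SOME g. is_cond_exp M (vimage_algebra (space M) Z borel) Y g)"

definition sign_cov ::
    "'w measure \<Rightarrow> ('w \<Rightarrow> 'h) \<Rightarrow> ('w \<Rightarrow> 'h) \<Rightarrow> ('w \<Rightarrow> 'h)
       \<Rightarrow> 'h \<Rightarrow> 'h::{real_inner, banach, second_countable_topology}" where
  "sign_cov M X Y Z =
     cov_op M (cond_exp_given M Z (\<lambda>\<omega>. sgn (X \<omega> - Z \<omega>))) (cond_exp_given M Z (\<lambda>\<omega>. sgn (Y \<omega> - Z \<omega>)))"

definition limit_cov_entry ::
    "('k::finite \<Rightarrow> real) \<Rightarrow> ('k \<Rightarrow> 'k \<Rightarrow> 'k \<Rightarrow> 'h \<Rightarrow> 'h) \<Rightarrow> 'k \<Rightarrow> 'k \<Rightarrow> 'h \<Rightarrow> 'h::real_inner" where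
  "limit_cov_entry lam C k1 k2 w =
     sqrt (lam k1 * lam k2) *\<^sub>R (\<Sum>l\<in>UNIV. lam l *\<^sub>R (C k1 k2 l w - C l k2 k1 w - C k1 l k2 w))
     + (if k1 = k2 then \<Sum>l1\<in>UNIV. \<Sum>l2\<in>UNIV. (lam l1 * lam l2) *\<^sub>R C l1 l2 k1 w else 0)"

text \<open>
  The entry \<open>\<sigma> k1 k2\<close> maps component \<open>k1\<close> of the argument into component \<open>k2\<close> of the value,
  so the indices are transposed with respect to the usual matrix-vector product.
\<close>

definition matrix_op ::
    "('k::finite \<Rightarrow> 'k \<Rightarrow> 'h \<Rightarrow> 'h) \<Rightarrow> 'h ^ 'k \<Rightarrow> ('h::real_inner) ^ 'k" where
  "matrix_op \<sigma> w = (\<chi> k2. \<Sum>k1\<in>UNIV. \<sigma> k1 k2 (w $ k1))"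

lemma matrix_op_bilinear_form:
  "matrix_op \<sigma> w \<bullet> v = (\<Sum>k1\<in>UNIV. \<Sum>k2\<in>UNIV. \<sigma> k1 k2 (w $ k1) \<bullet> (v $ k2))"
  unfolding matrix_op_def inner_vec_def
  by (simp add: inner_sum_left) (rule sum.swap)


text \<open>Point masses are included as degenerate normal distributions.\<close>

definition real_gaussian :: "real measure \<Rightarrow> bool" where
  "real_gaussian N \<longleftrightarrow>
     (\<exists>\<mu>. N = return borel \<mu> \<or>
        (\<exists>\<sigma>>0. N = density lborel (\<lambda>x. ennreal (normal_density \<mu> \<sigma> x))))"

text \<open>
  Square integrability holds for every Gaussian measure.  It is required here because mean and
  covariance operator are Bochner integrals, which are \<open>0\<close> for non-integrable functions.
\<close>

definition gaussian_measure ::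
    "'h::{real_inner, banach, second_countable_topology} \<Rightarrow> ('h \<Rightarrow> 'h) \<Rightarrow> 'h measure \<Rightarrow> bool" where
  "gaussian_measure m S \<nu> \<longleftrightarrow>
     prob_space \<nu> \<and> sets \<nu> = sets borel \<and>
     (\<forall>w. real_gaussian (distr \<nu> borel (\<lambda>x. x \<bullet> w))) \<and>
     integrable \<nu> (\<lambda>x. (norm x)\<^sup>2) \<and>
     (\<integral>x. x \<partial>\<nu>) = m \<and> cov_op \<nu> (\<lambda>x. x) (\<lambda>x. x) = S"

definition weakly_converges :: "(nat \<Rightarrow> 'a::metric_space measure) \<Rightarrow> 'a measure \<Rightarrow> bool" where
  "weakly_converges \<mu> \<nu> \<longleftrightarrow>
     (\<forall>f :: 'a \<Rightarrow> real. continuous_on UNIV f \<and> bounded (range f) \<longrightarrow>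
        (\<lambda>n. \<integral>x. f x \<partial>\<mu> n) \<longlonglongrightarrow> (\<integral>x. f x \<partial>\<nu>))"

end

theory Submission
  imports Defs
begin

text \<open>
  Write \<open>g\<^sub>l(x)\<close> for the mean of \<open>sgn (x - Y)\<close>, \<open>Y\<close> distributed as \<open>P l\<close>.  Subtracting the
  projection \<open>g\<^sub>l(x) - g\<^sub>k(y)\<close> (and a constant) from \<open>sgn (x - y)\<close> leaves a kernel that is degenerate
  in both arguments, so its double sums are orthogonal and contribute \<open>O(1 / sqrt n)\<close> in mean.  What remains
  of the rank vector is a normalized sum of independent bounded variables in the product Hilbert
  space.  Its characteristic functionals converge by the Lyapunov estimate in each direction, and
  it is tight because simple functions approximate the summands in mean square and keep
  the sum in finite-dimensional compact sets up to a small error.  Tightness and convergence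
  of characteristic functionals give weak convergence by Stone-Weierstrass.  The limit is
  built as a random series: Gram-Schmidt in the space of square integrable variables writes the
  covariance as a sum of rank-one operators \<open>v\<^sub>m \<otimes> v\<^sub>m\<close> with summable \<open>(norm v\<^sub>m)\<^sup>2\<close>, and standard normal
  coefficients are put in front of the \<open>v\<^sub>m\<close>.
\<close>

section \<open>Weak convergence from characteristic functionals and tightness\<close>

text \<open>Convergence of characteristic functionals alone does not keep mass from escaping into
  infinitely many directions, so tightness has to be proved on its own; this is why remainders are
  controlled in norm and not only direction by direction. Two facts about the sign kernel shape the
  projection. Since \<open>sgn\<close> is odd, the projections on both arguments use the same mean
  sign functions, with opposite signs. Since \<open>sgn 0 = 0\<close>, the kernel left over vanishes
  when an observation is compared with itself, so these pairs need no separate treatment. The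
  expectation of the rank vector is never computed: the linear part has mean zero, hence closeness
  in mean to any deterministic centre carries over to the actual mean. The groups of terms in the
  limit covariance come from squaring one difference, the effect of an observation as ranked point
  minus its effect as reference point; the two cross terms carry the minus signs.\<close>

inductive trig_poly :: "('b::real_inner \<Rightarrow> real) \<Rightarrow> bool" where
  cos: "trig_poly (\<lambda>x. c * cos (x \<bullet> w + b))"
| add: "trig_poly f \<Longrightarrow> trig_poly g \<Longrightarrow> trig_poly (\<lambda>x. f x + g x)"

lemma trig_poly_const: "trig_poly (\<lambda>x. c)"
  using trig_poly.cos[of c 0 0] by simp

text \<open>Product-to-sum formula. Closure under products makes the class an algebra, as
  Stone-Weierstrass asks; the free phase \<open>b\<close> lets cosines alone suffice.\<close>

lemma trig_poly_mult:
  assumes "trig_poly f" "trig_poly g"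
  shows "trig_poly (\<lambda>x. f x * g x)"
  using assms(1)
proof induction
  case (cos c w b)
  show ?case
    using assms(2)
  proof induction
    case (cos c' w' b')
    have "trig_poly (\<lambda>x. (c * c' / 2) * cos (x \<bullet> (w - w') + (b - b'))
        + (c * c' / 2) * cos (x \<bullet> (w + w') + (b + b')))"
      by (intro trig_poly.intros)
    moreover have "(c * c' / 2) * cos (x \<bullet> (w - w') + (b - b'))
        + (c * c' / 2) * cos (x \<bullet> (w + w') + (b + b'))
        = c * cos (x \<bullet> w + b) * (c' * cos (x \<bullet> w' + b'))" for x
    proof -
      have "cos (x \<bullet> (w - w') + (b - b')) + cos (x \<bullet> (w + w') + (b + b'))
          = 2 * (cos (x \<bullet> w + b) * cos (x \<bullet> w' + b'))"
        by (simp add: cos_add cos_diff sin_add sin_diff inner_diff_right inner_add_right algebra_simps)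
      then show ?thesis unfolding distrib_left[symmetric] by simp
    qed
    ultimately show ?case by simp
  qed (simp add: distrib_left trig_poly.add)
qed (simp add: distrib_right trig_poly.add)

lemma trig_poly_bounded:
  assumes "trig_poly f"
  obtains B where "\<And>x. \<bar>f x\<bar> \<le> B"
proof -
  from assms have "\<exists>B. \<forall>x. \<bar>f x\<bar> \<le> B"
  proof induction
    case (cos c w b)
    have "\<bar>c * cos (x \<bullet> w + b)\<bar> \<le> \<bar>c\<bar>" for x
      by (simp add: abs_mult mult_left_le)
    then show ?case by blast
  next
    case (add f g)
    then obtain B C where "\<forall>x. \<bar>f x\<bar> \<le> B" "\<forall>x. \<bar>g x\<bar> \<le> C" by blast
    then have "\<bar>f x + g x\<bar> \<le> B + C" for x
      using abs_triangle_ineq[of "f x" "g x"] by (smt (verit))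
    then show ?case by blast
  qed
  then show thesis using that by blast
qed

lemma trig_poly_continuous: "trig_poly f \<Longrightarrow> continuous_on A f"
  by (induction rule: trig_poly.induct) (auto intro!: continuous_intros)

text \<open>Allows an approximation to be composed with a polynomial on its range without leaving
  the class. A linear map of the reals is multiplication by its value at 1.\<close>

lemma trig_poly_polynomial:
  assumes "real_polynomial_function q" "trig_poly f"
  shows "trig_poly (\<lambda>x. q (f x :: real))"
  using assms(1)
proof induction
  case (linear h)
  then have "h t = h 1 * t" for t
    using linear_simps(5)[OF linear, of t 1] by (simp add: mult.commute)
  then have "(\<lambda>x. h (f x)) = (\<lambda>x. h 1 * f x)" by blast
  then show ?case
    using trig_poly_mult[OF trig_poly_const assms(2), of "h 1"] by simp
qed (auto intro: trig_poly_const trig_poly.add trig_poly_mult)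

lemma trig_poly_separates:
  assumes "x \<noteq> (y::'b::real_inner)"
  shows "\<exists>f. trig_poly f \<and> f x \<noteq> f y"
proof -
  \<comment> \<open>Scaled so that \<open>x\<close> and \<open>y\<close> differ by a quarter period;
    the phase then puts \<open>y\<close> at a maximum of the cosine and \<open>x\<close> at a
    zero.\<close>
  define w where "w = (pi / 2 / (norm (x - y))\<^sup>2) *\<^sub>R (x - y)"
  have "(x - y) \<bullet> w = pi / 2"
    using assms by (simp add: w_def power2_norm_eq_inner)
  then have "x \<bullet> w + - (y \<bullet> w) = pi / 2" by (simp add: inner_diff_left)
  then have "1 * cos (x \<bullet> w + - (y \<bullet> w)) \<noteq> 1 * cos (y \<bullet> w + - (y \<bullet> w))"
    by (simp only:) simp
  then show ?thesis using trig_poly.cos[of 1 w "- (y \<bullet> w)"] by metis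
qed

text \<open>
  Stone-Weierstrass alone says nothing about the approximation off \<open>K\<close>.  The global bound comes
  from composing with a polynomial that is close to the truncation at \<open>B\<close> on the range of the
  first approximation; the result is again a trigonometric polynomial.
\<close>

lemma bounded_trig_poly_approx:
  fixes f :: "'b::real_inner \<Rightarrow> real"
  assumes "compact K" "continuous_on K f" "\<And>x. \<bar>f x\<bar> \<le> B" "e > 0"
  obtains g where "trig_poly g" "\<And>x. x \<in> K \<Longrightarrow> \<bar>f x - g x\<bar> < e" "\<And>x. \<bar>g x\<bar> \<le> B + e"
proof -
  interpret function_ring_on "Collect trig_poly" K
    using assms(1) trig_poly_separates
    by unfold_locales
      (auto intro: trig_poly_const trig_poly.add trig_poly_mult trig_poly_continuous)
  obtain p where p: "trig_poly p" "\<And>x. x \<in> K \<Longrightarrow> \<bar>f x - p x\<bar> < e / 2"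
    using Stone_Weierstrass_basic[OF assms(2), of "e/2"] assms(4) by auto
  obtain D where D: "\<And>x. \<bar>p x\<bar> \<le> D" using trig_poly_bounded[OF p(1)] by blast
  define clip where "clip t = max (-B) (min B t)" for t :: real
  have B: "B \<ge> 0" using assms(3)[of 0] by linarith
  have "continuous_on {-D..D} clip"
    unfolding clip_def by (intro continuous_intros)
  then obtain q where q: "real_polynomial_function q" "\<And>t. t \<in> {-D..D} \<Longrightarrow> \<bar>clip t - q t\<bar> < e / 2"
    using Stone_Weierstrass_real_polynomial_function[of "{-D..D}" clip "e/2"] assms(4) by auto
  have q': "\<bar>clip (p x) - q (p x)\<bar> < e / 2" for x
    using q(2)[of "p x"] D[of x] by (auto simp: abs_le_iff)
  show thesis
  proof (rule that)
    show "trig_poly (\<lambda>x. q (p x))" by (rule trig_poly_polynomial[OF q(1) p(1)])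
    fix x
    have "\<bar>clip (p x)\<bar> \<le> B" using B by (auto simp: clip_def)
    then show "\<bar>q (p x)\<bar> \<le> B + e" using q'[of x] assms(4) by linarith
    assume "x \<in> K"
    \<comment> \<open>\<open>clip\<close> does not increase distances and fixes \<open>f x\<close>,
      because \<open>f x\<close> lies between \<open>-B\<close> and \<open>B\<close>.\<close>
    have "\<bar>clip (p x) - f x\<bar> \<le> \<bar>p x - f x\<bar>"
      using assms(3)[of x] by (auto simp: clip_def)
    then show "\<bar>f x - q (p x)\<bar> < e"
      using p(2)[OF \<open>x \<in> K\<close>] q'[of x] by linarith
  qed
qed

lemma borel_measurable_trig_poly: "trig_poly f \<Longrightarrow> f \<in> borel_measurable borel"
  by (rule borel_measurable_continuous_onI) (rule trig_poly_continuous)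

lemma integrable_bounded_borel:
  fixes f :: "'a \<Rightarrow> 'b::{banach, second_countable_topology}"
  assumes "finite_measure M" "f \<in> borel_measurable M" "\<And>x. x \<in> space M \<Longrightarrow> norm (f x) \<le> B"
  shows "integrable M f"
proof -
  interpret finite_measure M by fact
  show ?thesis
    by (rule integrable_const_bound[of _ B]) (use assms in auto)
qed

lemmas (in finite_measure) integrable_bounded = integrable_bounded_borel[OF finite_measure_axioms]

text \<open>A cosine is the real part of a unimodular constant times a character. The argument 1 is
  enough, because \<open>w\<close> runs through all vectors and absorbs the scaling.\<close>

lemma integral_cos_char:
  fixes \<mu> :: "'b::{real_inner, second_countable_topology} measure"
  assumes "prob_space \<mu>" and [measurable_cong]: "sets \<mu> = sets borel"
  shows "(\<integral>x. c * cos (x \<bullet> w + b) \<partial>\<mu>) = c * Re (cis b * char (distr \<mu> borel (\<lambda>x. x \<bullet> w)) 1)"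
proof -
  interpret prob_space \<mu> by fact
  have i: "integrable \<mu> (\<lambda>x. iexp (x \<bullet> w))"
    by (intro integrable_bounded_borel[where B=1]) (auto intro: finite_measure_axioms)
  have c: "char (distr \<mu> borel (\<lambda>x. x \<bullet> w)) 1 = (\<integral>x. iexp (x \<bullet> w) \<partial>\<mu>)"
    unfolding char_def by (subst integral_distr) auto
  have "(\<integral>x. c * cos (x \<bullet> w + b) \<partial>\<mu>) = (\<integral>x. Re (c * cis b * iexp (x \<bullet> w)) \<partial>\<mu>)"
    by (simp add: cis.ctr cis_mult complex_eq_iff exp_Euler cos_of_real sin_of_real cos_add algebra_simps)
  also have "\<dots> = Re (\<integral>x. c * cis b * iexp (x \<bullet> w) \<partial>\<mu>)"
    using i by (intro integral_Re) auto
  also have "\<dots> = Re (c * cis b * (\<integral>x. iexp (x \<bullet> w) \<partial>\<mu>))" by simp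
  finally show ?thesis by (simp add: c algebra_simps)
qed

lemma trig_poly_integral_tendsto:
  fixes \<nu> :: "'b::{real_inner, second_countable_topology} measure"
  assumes \<mu>: "\<And>n. prob_space (\<mu> n)" "\<And>n. sets (\<mu> n) = sets borel"
    and \<nu>: "prob_space \<nu>" "sets \<nu> = sets borel"
    and char: "\<And>w. (\<lambda>n. char (distr (\<mu> n) borel (\<lambda>x. x \<bullet> w)) 1)
        \<longlonglongrightarrow> char (distr \<nu> borel (\<lambda>x. x \<bullet> w)) 1"
    and "trig_poly f"
  shows "(\<lambda>n. \<integral>x. f x \<partial>\<mu> n) \<longlonglongrightarrow> (\<integral>x. f x \<partial>\<nu>)"
  using \<open>trig_poly f\<close>
proof induction
  case (cos c w b)
  show ?case
    unfolding integral_cos_char[OF \<mu>] integral_cos_char[OF \<nu>]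
    by (intro tendsto_intros char)
next
  case (add f g)
  have int: "integrable \<mu>' h" if h: "trig_poly h" and \<mu>': "prob_space \<mu>'" "sets \<mu>' = sets borel"
    for h and \<mu>' :: "'b measure"
  proof -
    obtain B where "\<And>x. \<bar>h x\<bar> \<le> B" using trig_poly_bounded[OF h] by blast
    then show ?thesis
      using borel_measurable_trig_poly[OF h] \<mu>'
      by (intro integrable_bounded_borel[where B=B])
        (auto simp: prob_space.finite_measure cong: measurable_cong_sets)
  qed
  show ?case
    using add.hyps add.IH by (simp add: int \<mu> \<nu> tendsto_add)
qed

text \<open>Error \<open>e\<close> on \<open>K\<close>, and the crude bound \<open>B + C\<close> on
  the rest, which has mass at most \<open>d\<close>.\<close>

lemma integral_diff_le_off_set:
  fixes f g :: "'b::topological_space \<Rightarrow> real"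
  assumes "prob_space \<mu>" and [measurable_cong]: "sets \<mu> = sets borel"
    and [measurable]: "f \<in> borel_measurable borel" "g \<in> borel_measurable borel" "K \<in> sets borel"
    and fB: "\<And>x. \<bar>f x\<bar> \<le> B" and gC: "\<And>x. \<bar>g x\<bar> \<le> C"
    and e: "\<And>x. x \<in> K \<Longrightarrow> \<bar>f x - g x\<bar> \<le> e" "0 \<le> e"
    and K: "measure \<mu> K \<ge> 1 - d"
  shows "\<bar>(\<integral>x. f x \<partial>\<mu>) - (\<integral>x. g x \<partial>\<mu>)\<bar> \<le> e + (B + C) * d"
proof -
  interpret prob_space \<mu> by fact
  have "0 \<le> B" "0 \<le> C" using fB[of undefined] gC[of undefined] by linarith+
  have i: "integrable \<mu> f" "integrable \<mu> g"
    using fB gC by (auto intro!: integrable_bounded_borel simp: finite_measure_axioms)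
  have "\<bar>(\<integral>x. f x \<partial>\<mu>) - (\<integral>x. g x \<partial>\<mu>)\<bar> = \<bar>\<integral>x. f x - g x \<partial>\<mu>\<bar>"
    using i by simp
  also have "\<dots> \<le> (\<integral>x. \<bar>f x - g x\<bar> \<partial>\<mu>)"
    by (rule integral_abs_bound)
  also have "\<dots> \<le> (\<integral>x. e + (B + C) * indicator (space \<mu> - K) x \<partial>\<mu>)"
  proof (rule integral_mono)
    have "space \<mu> - K \<in> sets \<mu>" by measurable
    then show "integrable \<mu> (\<lambda>x. e + (B + C) * indicator (space \<mu> - K) x)"
      by (intro Bochner_Integration.integrable_add integrable_mult_right integrable_real_indicator)
        (auto simp: less_top[symmetric])
    fix x assume "x \<in> space \<mu>"
    then show "\<bar>f x - g x\<bar> \<le> e + (B + C) * indicator (space \<mu> - K) x"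
      using e(1)[of x] e(2) fB[of x] gC[of x]
      by (cases "x \<in> K") (auto simp: indicator_def)
  qed (use i in auto)
  also have "\<dots> = e + (B + C) * measure \<mu> (space \<mu> - K)"
  proof -
    have "space \<mu> - K \<in> sets \<mu>" by measurable
    then have "integrable \<mu> (indicator (space \<mu> - K) :: _ \<Rightarrow> real)"
      by (intro integrable_real_indicator) (auto simp: less_top[symmetric])
    then show ?thesis by (simp add: prob_space Int_absorb2 Diff_subset)
  qed
  also have "measure \<mu> (space \<mu> - K) \<le> d"
    using K by (subst prob_compl) auto
  finally show ?thesis using \<open>0 \<le> B\<close> \<open>0 \<le> C\<close> by (simp add: mult_left_mono)
qed

text \<open>Ulam's theorem, from inner regularity on a complete separable space applied to the whole
  space. It covers the limit measure, about which \<open>tight_seq\<close> says nothing.\<close>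

lemma tight_prob_measure:
  fixes \<nu> :: "'b::{second_countable_topology, complete_space} measure"
  assumes "prob_space \<nu>" "sets \<nu> = sets borel" "d > 0"
  obtains K where "compact K" "measure \<nu> K \<ge> 1 - d"
proof -
  interpret prob_space \<nu> by fact
  have sp: "space \<nu> = UNIV" using sets_eq_imp_space_eq[OF assms(2)] by simp
  have "emeasure \<nu> UNIV = (SUP K \<in> {K. K \<subseteq> UNIV \<and> compact K}. emeasure \<nu> K)"
    using assms(2) emeasure_finite by (intro inner_regular) (auto simp: sp)
  moreover have "emeasure \<nu> UNIV = 1" using emeasure_space_1 by (simp add: sp)
  ultimately have "ennreal (1 - d) < (SUP K \<in> {K. K \<subseteq> UNIV \<and> compact K}. emeasure \<nu> K)"
    using \<open>d > 0\<close> by (simp flip: ennreal_1 add: ennreal_less_iff) (simp add: ennreal_lessI)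
  then obtain K where "compact K" "ennreal (1 - d) < emeasure \<nu> K"
    unfolding less_SUP_iff by auto
  moreover from this have "1 - d \<le> measure \<nu> K"
    by (cases "1 - d \<ge> 0") (auto simp: emeasure_eq_measure ennreal_less_iff intro: order_trans[OF _ measure_nonneg])
  ultimately show thesis using that by blast
qed

section \<open>Tight sequences and the continuity theorem for characteristic functionals\<close>

definition tight_seq :: "(nat \<Rightarrow> 'b::topological_space measure) \<Rightarrow> bool" where
  "tight_seq \<mu> \<longleftrightarrow> (\<forall>d>0. \<exists>K. compact K \<and> (\<forall>n. measure (\<mu> n) K \<ge> 1 - d))"

text \<open>No subsequences are extracted: on one compact set, good for all \<open>\<mu> n\<close>
  and for \<open>\<nu>\<close>, the function \<open>f\<close> is compared with a trigonometric
  polynomial, whose integrals converge. Tightness bounds the error off that set, where the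
  polynomial is still bounded by \<open>B + e\<close>.\<close>

proposition weakly_converges_char:
  fixes \<nu> :: "'b::{real_inner, second_countable_topology, complete_space} measure"
  assumes \<mu>: "\<And>n. prob_space (\<mu> n)" "\<And>n. sets (\<mu> n) = sets borel"
    and \<nu>: "prob_space \<nu>" "sets \<nu> = sets borel"
    and char: "\<And>w. (\<lambda>n. char (distr (\<mu> n) borel (\<lambda>x. x \<bullet> w)) 1)
        \<longlonglongrightarrow> char (distr \<nu> borel (\<lambda>x. x \<bullet> w)) 1"
    and tight: "tight_seq \<mu>"
  shows "weakly_converges \<mu> \<nu>"
  unfolding weakly_converges_def
proof safe
  fix f :: "'b \<Rightarrow> real"
  assume cont: "continuous_on UNIV f" and "bounded (range f)"
  then obtain B where B: "B > 0" "\<And>x. \<bar>f x\<bar> \<le> B"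
    unfolding bounded_pos by auto
  have fm[measurable]: "f \<in> borel_measurable borel"
    using cont by (rule borel_measurable_continuous_onI)
  show "(\<lambda>n. \<integral>x. f x \<partial>\<mu> n) \<longlonglongrightarrow> (\<integral>x. f x \<partial>\<nu>)"
  proof (rule LIMSEQ_I)
    fix r :: real assume "r > 0"
    \<comment> \<open>Each replacement of \<open>f\<close> by \<open>g\<close> costs at most
      \<open>e + (2 * B + e) * d\<close>, that is \<open>r / 8 + r / 8\<close>; with an error below
      \<open>r / 4\<close> for the integrals of \<open>g\<close> the total stays below
      \<open>r\<close>. Since \<open>e \<le> 1\<close>, the factor \<open>2 * B + e\<close> is at
      most \<open>2 * B + 2\<close>.\<close>
    define d where "d = min 1 (r / (16 * B + 16))"
    define e where "e = min 1 (r / 8)"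
    have d: "0 < d" and e: "0 < e" "e \<le> 1" "e \<le> r / 8"
      using B(1) \<open>r > 0\<close> by (auto simp: d_def e_def)
    have dB: "(B + (B + e)) * d \<le> r / 8"
    proof -
      have "(B + (B + e)) * d \<le> (2 * B + 2) * (r / (16 * B + 16))"
        using B(1) e d \<open>r > 0\<close> by (intro mult_mono) (auto simp: d_def)
      also have "\<dots> = r / 8" using B(1) by (simp add: field_simps)
      finally show ?thesis .
    qed
    obtain K1 where K1: "compact K1" "\<And>n. measure (\<mu> n) K1 \<ge> 1 - d"
      using tight d unfolding tight_seq_def by blast
    obtain K2 where K2: "compact K2" "measure \<nu> K2 \<ge> 1 - d"
      using tight_prob_measure[OF \<nu> d] by blast
    define K where "K = K1 \<union> K2"
    have K: "compact K" unfolding K_def using K1 K2 by auto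
    then have [measurable]: "K \<in> sets borel" by (simp add: compact_imp_closed)
    have sub: "K1 \<in> sets borel" "K2 \<in> sets borel" using K1 K2 by (auto simp: compact_imp_closed)
    have mK: "measure (\<mu> n) K \<ge> 1 - d" for n
    proof -
      interpret prob_space "\<mu> n" by (rule \<mu>)
      have "measure (\<mu> n) K1 \<le> measure (\<mu> n) K"
        using sub by (intro finite_measure_mono) (auto simp: \<mu> K_def)
      then show ?thesis using K1(2)[of n] by linarith
    qed
    have nK: "measure \<nu> K \<ge> 1 - d"
    proof -
      interpret prob_space \<nu> by (rule \<nu>)
      have "measure \<nu> K2 \<le> measure \<nu> K"
        using sub by (intro finite_measure_mono) (auto simp: \<nu> K_def)
      then show ?thesis using K2(2) by linarith
    qed
    obtain g where g: "trig_poly g" "\<And>x. x \<in> K \<Longrightarrow> \<bar>f x - g x\<bar> < e" "\<And>x. \<bar>g x\<bar> \<le> B + e"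
      using bounded_trig_poly_approx[OF K continuous_on_subset[OF cont] B(2) e(1)] by blast
    have gm: "g \<in> borel_measurable borel" by (rule borel_measurable_trig_poly[OF g(1)])
    have 1: "\<bar>(\<integral>x. f x \<partial>\<mu> n) - (\<integral>x. g x \<partial>\<mu> n)\<bar> \<le> e + (B + (B + e)) * d" for n
      using g(2) e by (intro integral_diff_le_off_set[OF \<mu> fm gm _ B(2) g(3) _ _ mK])
        (auto intro: less_imp_le)
    have 2: "\<bar>(\<integral>x. f x \<partial>\<nu>) - (\<integral>x. g x \<partial>\<nu>)\<bar> \<le> e + (B + (B + e)) * d"
      using g(2) e by (intro integral_diff_le_off_set[OF \<nu> fm gm _ B(2) g(3) _ _ nK])
        (auto intro: less_imp_le)
    obtain n0 where n0: "\<And>n. n \<ge> n0 \<Longrightarrow> \<bar>(\<integral>x. g x \<partial>\<mu> n) - (\<integral>x. g x \<partial>\<nu>)\<bar> < r / 4"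
      using LIMSEQ_D[OF trig_poly_integral_tendsto[OF \<mu> \<nu> char g(1)], of "r/4"] \<open>r > 0\<close> by auto
    show "\<exists>no. \<forall>n\<ge>no. norm ((\<integral>x. f x \<partial>\<mu> n) - (\<integral>x. f x \<partial>\<nu>)) < r"
    proof (intro exI[of _ n0] allI impI)
      fix n assume "n \<ge> n0"
      then show "norm ((\<integral>x. f x \<partial>\<mu> n) - (\<integral>x. f x \<partial>\<nu>)) < r"
        using n0[of n] 1[of n] 2 e dB \<open>r > 0\<close> unfolding real_norm_def by linarith
    qed
  qed
qed

text \<open>The sets of mass near 1 need only be neighbourhoods of compact sets. Intersecting them
  over the radii \<open>(1/2)^m\<close>, with losses \<open>d * (1/2)^Suc m\<close> that add up to
  \<open>d\<close>, gives a closed totally bounded set, which is compact by completeness.\<close>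

lemma tight_seqI_approx:
  fixes \<mu> :: "nat \<Rightarrow> 'b::{real_normed_vector, complete_space} measure"
  assumes \<mu>: "\<And>n. prob_space (\<mu> n)" "\<And>n. sets (\<mu> n) = sets borel"
    and approx: "\<And>r d. r > 0 \<Longrightarrow> d > 0 \<Longrightarrow>
      \<exists>K. compact K \<and> (\<forall>n. measure (\<mu> n) (\<Union>x\<in>K. \<Union>y\<in>cball 0 r. {x + y}) \<ge> 1 - d)"
  shows "tight_seq \<mu>"
  unfolding tight_seq_def
proof (intro allI impI)
  fix d :: real assume "d > 0"
  \<comment> \<open>As the sum of a compact and a closed set this neighbourhood is closed.\<close>
  define nb where "nb K r = (\<Union>x\<in>K. \<Union>y\<in>cball 0 r. {x + y})" for K :: "'b set" and r
  have "\<exists>K. compact K \<and> (\<forall>n. measure (\<mu> n) (nb K ((1/2)^m)) \<ge> 1 - d * (1/2)^Suc m)" for m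
    unfolding nb_def using \<open>d > 0\<close> by (intro approx) auto
  then obtain K where K: "\<And>m. compact (K m)"
    and mK: "\<And>m n. measure (\<mu> n) (nb (K m) ((1/2)^m)) \<ge> 1 - d * (1/2)^Suc m"
    by metis
  have cl: "closed (nb (K m) r)" for m r
    unfolding nb_def by (intro compact_closed_sums K closed_cball)
  define L where "L = (\<Inter>m. nb (K m) ((1/2)^m))"
  have clL: "closed L" unfolding L_def using cl by blast
  have "\<exists>k. finite k \<and> L \<subseteq> (\<Union>x\<in>k. ball x \<epsilon>)" if \<epsilon>: "\<epsilon> > 0" for \<epsilon>
  proof -
    obtain m where m: "(1/2)^m < \<epsilon>/2"
      using real_arch_pow_inv[OF half_gt_zero[OF \<epsilon>], of "1/2"] by auto
    obtain k where k: "finite k" "K m \<subseteq> (\<Union>x\<in>k. ball x (\<epsilon>/2))"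
      using K[of m] half_gt_zero[OF \<epsilon>] unfolding compact_eq_totally_bounded by metis
    have "L \<subseteq> (\<Union>x\<in>k. ball x \<epsilon>)"
    proof
      fix z assume "z \<in> L"
      then obtain x y where xy: "x \<in> K m" "norm y \<le> (1/2)^m" "z = x + y"
        unfolding L_def nb_def by (auto dest!: spec[of _ m])
      then obtain c where c: "c \<in> k" "dist c x < \<epsilon>/2" using k(2) by auto
      have "dist c z \<le> dist c x + norm y"
        using dist_triangle[of c z x] xy(3) by (simp add: dist_norm)
      then show "z \<in> (\<Union>x\<in>k. ball x \<epsilon>)" using c xy(2) m by (intro UN_I[of c]) auto
    qed
    then show ?thesis using k(1) by blast
  qed
  then have "compact L"
    unfolding compact_eq_totally_bounded using clL by (simp add: complete_eq_closed)
  moreover have "measure (\<mu> n) L \<ge> 1 - d" for n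
  proof -
    interpret prob_space "\<mu> n" by (rule \<mu>)
    have sp: "space (\<mu> n) = UNIV" using sets_eq_imp_space_eq[OF \<mu>(2)[of n]] by simp
    have ms: "nb (K m) r \<in> sets (\<mu> n)" for m r using cl by (simp add: \<mu>(2))
    have s: "summable (\<lambda>m. d * (1/2)^Suc m :: real)" 
      by (intro summable_mult) (simp add: summable_geometric)
    have c: "measure (\<mu> n) (UNIV - nb (K m) ((1/2)^m)) \<le> d * (1/2)^Suc m" for m
      using mK[of m n] prob_compl[OF ms] by (simp add: sp)
    have s': "summable (\<lambda>m. measure (\<mu> n) (UNIV - nb (K m) ((1/2)^m)))"
      by (rule summable_comparison_test_ev[OF _ s]) (use c in auto)
    have "measure (\<mu> n) (UNIV - L) = measure (\<mu> n) (\<Union>m. UNIV - nb (K m) ((1/2)^m))"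
      unfolding L_def by (rule arg_cong[where f="measure (\<mu> n)"]) auto
    also have "\<dots> \<le> (\<Sum>m. measure (\<mu> n) (UNIV - nb (K m) ((1/2)^m)))"
      using ms sets.top[of "\<mu> n"] by (intro finite_measure_subadditive_countably s') (auto simp: sp)
    also have "\<dots> \<le> (\<Sum>m. d * (1/2)^Suc m)"
      by (intro suminf_le s s' c)
    also have "\<dots> = d"
      using sums_unique[OF sums_mult[OF power_half_series], of d] by simp
    finally show ?thesis
      using prob_compl[of L] clL by (simp add: sp \<mu>(2))
  qed
  ultimately show "\<exists>K. compact K \<and> (\<forall>n. 1 - d \<le> measure (\<mu> n) K)" by blast
qed

text \<open>Only \<open>x\<close> has to lie in \<open>K\<close>; in the application the second
  point is random and may leave \<open>K\<close>. The bound \<open>d\<close> is a Lebesgue number of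
  the cover of \<open>K\<close> by preimages of balls of radius \<open>e / 2\<close>.\<close>

lemma uniformly_continuous_near_compact:
  fixes f :: "'a::metric_space \<Rightarrow> 'b::metric_space"
  assumes K: "compact K" and cont: "continuous_on UNIV f" and "e > 0"
  obtains d where "d > 0" "\<And>x y. x \<in> K \<Longrightarrow> dist x y < d \<Longrightarrow> dist (f x) (f y) < e"
proof -
  define G where "G z = f -` ball (f z) (e / 2)" for z
  have G: "open (G z)" for z unfolding G_def using cont by (intro open_vimage) auto
  have "x \<in> G x" for x using \<open>e > 0\<close> by (simp add: G_def)
  then have cover: "K \<subseteq> \<Union> (range G)" by blast
  obtain d where d: "d > 0" "\<And>x. x \<in> K \<Longrightarrow> \<exists>H\<in>range G. ball x d \<subseteq> H"
    by (rule Heine_Borel_lemma[OF K cover]) (use G in auto)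
  have "dist (f x) (f y) < e" if x: "x \<in> K" and y: "dist x y < d" for x y
  proof -
    obtain z where "ball x d \<subseteq> G z" using d(2)[OF x] by blast
    then have "x \<in> G z" "y \<in> G z" using d(1) y by auto
    then show ?thesis unfolding G_def by (simp add: dist_triangle_half_r)
  qed
  then show thesis using that d(1) by blast
qed

text \<open>The test function is only continuous, so a small distance between \<open>S n\<close> and
  \<open>L n\<close> is of use only where \<open>L n\<close> lies in a compact set; tightness makes
  this the typical case.\<close>

proposition weakly_converges_Slutsky:
  fixes L S :: "nat \<Rightarrow> 'w \<Rightarrow> 'b::{real_normed_vector, second_countable_topology}"
  assumes "prob_space M"
    and L[measurable]: "\<And>n. L n \<in> borel_measurable M"
    and S[measurable]: "\<And>n. S n \<in> borel_measurable M"
    and tight: "tight_seq (\<lambda>n. distr M borel (L n))"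
    and conv: "weakly_converges (\<lambda>n. distr M borel (L n)) \<nu>"
    and int: "\<And>n. integrable M (\<lambda>\<omega>. norm (S n \<omega> - L n \<omega>))"
    and diff: "(\<lambda>n. \<integral>\<omega>. norm (S n \<omega> - L n \<omega>) \<partial>M) \<longlonglongrightarrow> 0"
  shows "weakly_converges (\<lambda>n. distr M borel (S n)) \<nu>"
  unfolding weakly_converges_def
proof safe
  interpret prob_space M by fact
  fix f :: "'b \<Rightarrow> real"
  assume cont: "continuous_on UNIV f" and bdd: "bounded (range f)"
  then obtain B where B: "B > 0" "\<And>x. \<bar>f x\<bar> \<le> B"
    unfolding bounded_pos by auto
  have fm[measurable]: "f \<in> borel_measurable borel"
    using cont by (rule borel_measurable_continuous_onI)
  have lim: "(\<lambda>n. \<integral>\<omega>. f (L n \<omega>) \<partial>M) \<longlonglongrightarrow> (\<integral>x. f x \<partial>\<nu>)"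
    using conv cont bdd unfolding weakly_converges_def by (auto simp: integral_distr)
  have "(\<lambda>n. (\<integral>\<omega>. f (S n \<omega>) \<partial>M) - (\<integral>\<omega>. f (L n \<omega>) \<partial>M)) \<longlonglongrightarrow> 0"
  proof (rule LIMSEQ_I)
    fix r :: real assume "r > 0"
    \<comment> \<open>The terms \<open>2 * B * d\<close> for leaving \<open>K\<close> and
      \<open>2 * B * d\<close> for a distance of at least \<open>\<delta>\<close> then add up to
      \<open>r / 2\<close>, besides the \<open>r / 4\<close> from uniform continuity.\<close>
    define d where "d = r / (8 * B)"
    have d: "d > 0" using \<open>r > 0\<close> B(1) by (simp add: d_def)
    obtain K where K: "compact K" "\<And>n. measure (distr M borel (L n)) K \<ge> 1 - d"
      using tight d unfolding tight_seq_def by blast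
    have [measurable]: "K \<in> sets borel" using K(1) by (simp add: compact_imp_closed)
    obtain \<delta> where \<delta>: "\<delta> > 0" "\<And>x y. x \<in> K \<Longrightarrow> dist x y < \<delta> \<Longrightarrow> dist (f x) (f y) < r / 4"
      using uniformly_continuous_near_compact[OF K(1) cont, of "r/4"] \<open>r > 0\<close> by auto
    obtain n0 where n0: "\<And>n. n \<ge> n0 \<Longrightarrow> (\<integral>\<omega>. norm (S n \<omega> - L n \<omega>) \<partial>M) < d * \<delta>"
      using LIMSEQ_D[OF diff, of "d * \<delta>"] d \<delta>(1) by force
    show "\<exists>no. \<forall>n\<ge>no. norm ((\<integral>\<omega>. f (S n \<omega>) \<partial>M) - (\<integral>\<omega>. f (L n \<omega>) \<partial>M) - 0) < r"
    proof (intro exI[of _ n0] allI impI)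
      fix n assume n: "n \<ge> n0"
      have i: "integrable M (\<lambda>\<omega>. f (S n \<omega>))" "integrable M (\<lambda>\<omega>. f (L n \<omega>))"
        using B(2) by (auto intro!: integrable_bounded_borel simp: finite_measure_axioms)
      define A where "A = {\<omega>\<in>space M. L n \<omega> \<notin> K}"
      have [measurable]: "A \<in> sets M" unfolding A_def by measurable
      have "measure M {\<omega>\<in>space M. L n \<omega> \<in> K} \<ge> 1 - d"
        using K(2)[of n] by (simp add: measure_distr vimage_def Int_def conj_commute)
      then have A: "measure M A \<le> d"
        unfolding A_def using prob_neg[of "\<lambda>\<omega>. L n \<omega> \<in> K"] by simp
      \<comment> \<open>A pointwise form of Markov's inequality: where the distance is at least
        \<open>\<delta>\<close>, the last term alone reaches the trivial bound
        \<open>2 * B\<close>.\<close>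
      have p: "\<bar>f (S n \<omega>) - f (L n \<omega>)\<bar> \<le> r / 4 + 2 * B * indicator A \<omega>
          + 2 * B * (norm (S n \<omega> - L n \<omega>) / \<delta>)" if "\<omega> \<in> space M" for \<omega>
      proof -
        have b: "\<bar>f (S n \<omega>) - f (L n \<omega>)\<bar> \<le> 2 * B"
          using B(2)[of "S n \<omega>"] B(2)[of "L n \<omega>"] by linarith
        have nn: "0 \<le> 2 * B * (norm (S n \<omega> - L n \<omega>) / \<delta>)"
          using B(1) \<delta>(1) by simp
        consider "\<omega> \<in> A" | "L n \<omega> \<in> K" "dist (L n \<omega>) (S n \<omega>) < \<delta>" | "dist (L n \<omega>) (S n \<omega>) \<ge> \<delta>"
          using \<open>\<omega> \<in> space M\<close> unfolding A_def by force
        then show ?thesis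
        proof cases
          case 1 then show ?thesis using b nn \<open>r > 0\<close> by simp
        next
          case 2
          have "0 \<le> 2 * B * indicator A \<omega>" using B(1) by simp
          then show ?thesis
            using \<delta>(2)[OF 2] nn unfolding dist_real_def by linarith
        next
          case 3
          then have "1 \<le> norm (S n \<omega> - L n \<omega>) / \<delta>"
            using \<delta>(1) by (simp add: dist_norm norm_minus_commute)
          then have "2 * B * 1 \<le> 2 * B * (norm (S n \<omega> - L n \<omega>) / \<delta>)"
            using B(1) by (intro mult_left_mono) auto
          then show ?thesis using b \<open>r > 0\<close> B(1) by (simp add: indicator_def)
        qed
      qed
      have "\<bar>(\<integral>\<omega>. f (S n \<omega>) \<partial>M) - (\<integral>\<omega>. f (L n \<omega>) \<partial>M)\<bar> = \<bar>\<integral>\<omega>. f (S n \<omega>) - f (L n \<omega>) \<partial>M\<bar>"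
        using i by simp
      also have "\<dots> \<le> (\<integral>\<omega>. \<bar>f (S n \<omega>) - f (L n \<omega>)\<bar> \<partial>M)"
        by (rule integral_abs_bound)
      also have "\<dots> \<le> (\<integral>\<omega>. r / 4 + 2 * B * indicator A \<omega> + 2 * B * (norm (S n \<omega> - L n \<omega>) / \<delta>) \<partial>M)"
      proof (rule integral_mono)
        show "integrable M (\<lambda>\<omega>. r / 4 + 2 * B * indicator A \<omega> + 2 * B * (norm (S n \<omega> - L n \<omega>) / \<delta>))"
          using int[of n] by (intro Bochner_Integration.integrable_add integrable_mult_right
              integrable_real_indicator integrable_divide) (auto simp: less_top[symmetric])
      qed (use p i in auto)
      also have "\<dots> = r / 4 + 2 * B * measure M A + 2 * B * ((\<integral>\<omega>. norm (S n \<omega> - L n \<omega>) \<partial>M) / \<delta>)"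
      proof -
        have "integrable M (indicator A :: _ \<Rightarrow> real)"
          by (intro integrable_real_indicator) (auto simp: less_top[symmetric])
        then show ?thesis
          using int[of n] sets.sets_into_space[of A M] by (simp add: prob_space Int_absorb2)
      qed
      also have "\<dots> \<le> r / 4 + 2 * B * d + 2 * B * d"
      proof -
        have "(\<integral>\<omega>. norm (S n \<omega> - L n \<omega>) \<partial>M) / \<delta> \<le> d"
          using n0[OF n] \<delta>(1) by (simp add: divide_le_eq)
        then show ?thesis using A B(1) by (intro add_mono mult_left_mono) auto
      qed
      also have "\<dots> < r" using \<open>r > 0\<close> B(1) by (simp add: d_def)
      finally show "norm ((\<integral>\<omega>. f (S n \<omega>) \<partial>M) - (\<integral>\<omega>. f (L n \<omega>) \<partial>M) - 0) < r" by simp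
    qed
  qed
  from tendsto_add[OF this lim] show "(\<lambda>n. \<integral>x. f x \<partial>distr M borel (S n)) \<longlonglongrightarrow> (\<integral>x. f x \<partial>\<nu>)"
    by (simp add: integral_distr)
qed

section \<open>Gaussian measures with a given covariance\<close>

text \<open>
  One Gram-Schmidt step in mean square: the part of \<open>Z\<close> explained by the scalar variable \<open>Z \<bullet> u\<close> is
  removed, which takes the rank-one operator of \<open>schur_vector\<close> off the covariance.  If \<open>Z \<bullet> u\<close> vanishes
  almost surely, division by zero gives \<open>0\<close> and the step does nothing.
\<close>

definition schur_residual :: "'w measure \<Rightarrow> 'b \<Rightarrow> ('w \<Rightarrow> 'b) \<Rightarrow> 'w \<Rightarrow> 'b::{real_inner, banach, second_countable_topology}" where
  "schur_residual M u Z = (\<lambda>\<omega>. Z \<omega> - ((Z \<omega> \<bullet> u) / (\<integral>\<omega>. (Z \<omega> \<bullet> u)\<^sup>2 \<partial>M)) *\<^sub>R (\<integral>\<omega>. (Z \<omega> \<bullet> u) *\<^sub>R Z \<omega> \<partial>M))"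

definition schur_vector :: "'w measure \<Rightarrow> 'b \<Rightarrow> ('w \<Rightarrow> 'b) \<Rightarrow> 'b::{real_inner, banach, second_countable_topology}" where
  "schur_vector M u Z = (1 / sqrt (\<integral>\<omega>. (Z \<omega> \<bullet> u)\<^sup>2 \<partial>M)) *\<^sub>R (\<integral>\<omega>. (Z \<omega> \<bullet> u) *\<^sub>R Z \<omega> \<partial>M)"

lemma norm_inner_le: 
  fixes x y :: "'b::real_inner"
  shows "norm x \<le> B \<Longrightarrow> norm y \<le> C \<Longrightarrow> \<bar>x \<bullet> y\<bar> \<le> B * C"
  using Cauchy_Schwarz_ineq2[of x y] mult_mono[of "norm x" B "norm y" C] norm_ge_zero[of x] norm_ge_zero[of y]
  by linarith

context
  fixes M :: "'w measure" and Z :: "'w \<Rightarrow> 'b::{real_inner, banach, second_countable_topology}" and B :: real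
  assumes M: "prob_space M" and Z[measurable]: "Z \<in> borel_measurable M" and B: "\<And>\<omega>. norm (Z \<omega>) \<le> B"
begin

interpretation prob_space M by (rule M)

lemma integrable_inner_inner: "integrable M (\<lambda>\<omega>. (Z \<omega> \<bullet> x) * (Z \<omega> \<bullet> y))"
proof (rule integrable_bounded[of _ "(B * norm x) * (B * norm y)"])
  fix \<omega>
  have "0 \<le> B" using B[of \<omega>] norm_ge_zero order_trans by blast
  then show "norm ((Z \<omega> \<bullet> x) * (Z \<omega> \<bullet> y)) \<le> (B * norm x) * (B * norm y)"
    unfolding real_norm_def abs_mult by (intro mult_mono norm_inner_le B) auto
qed measurable

lemma integrable_norm_power2: "integrable M (\<lambda>\<omega>. (norm (Z \<omega>))\<^sup>2)"
proof (rule integrable_bounded[of _ "B\<^sup>2"])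
  fix \<omega> show "norm ((norm (Z \<omega>))\<^sup>2) \<le> B\<^sup>2" using B[of \<omega>] by (simp add: power_mono)
qed measurable

lemma integrable_inner_scaleR: "integrable M (\<lambda>\<omega>. (Z \<omega> \<bullet> u) *\<^sub>R Z \<omega>)"
proof (rule integrable_bounded[of _ "(B * norm u) * B"])
  fix \<omega>
  have "0 \<le> B" using B[of \<omega>] norm_ge_zero order_trans by blast
  then show "norm ((Z \<omega> \<bullet> u) *\<^sub>R Z \<omega>) \<le> (B * norm u) * B"
    unfolding norm_scaleR by (intro mult_mono norm_inner_le B) auto
qed measurable

lemma integral_inner_scaleR: "(\<integral>\<omega>. (Z \<omega> \<bullet> u) *\<^sub>R Z \<omega> \<partial>M) \<bullet> x = (\<integral>\<omega>. (Z \<omega> \<bullet> u) * (Z \<omega> \<bullet> x) \<partial>M)"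
  using integrable_inner_scaleR[of u] by (subst integral_inner_left[symmetric]) auto

lemma borel_measurable_schur_residual: "schur_residual M u Z \<in> borel_measurable M"
  unfolding schur_residual_def by measurable

lemma bounded_schur_residual: "\<exists>C. \<forall>\<omega>. norm (schur_residual M u Z \<omega>) \<le> C"
proof -
  define q c where "q = (\<integral>\<omega>. (Z \<omega> \<bullet> u)\<^sup>2 \<partial>M)" and "c = (\<integral>\<omega>. (Z \<omega> \<bullet> u) *\<^sub>R Z \<omega> \<partial>M)"
  have "norm (schur_residual M u Z \<omega>) \<le> B + (B * norm u / \<bar>q\<bar>) * norm c" for \<omega>
  proof -
    have "norm (schur_residual M u Z \<omega>) \<le> norm (Z \<omega>) + \<bar>Z \<omega> \<bullet> u\<bar> / \<bar>q\<bar> * norm c"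
      unfolding schur_residual_def q_def[symmetric] c_def[symmetric]
      by (rule order_trans[OF norm_triangle_ineq4]) simp
    also have "\<dots> \<le> B + (B * norm u / \<bar>q\<bar>) * norm c"
      by (intro add_mono mult_right_mono divide_right_mono norm_inner_le B) auto
    finally show ?thesis .
  qed
  then show ?thesis by blast
qed

text \<open>Regression of \<open>Z \<bullet> x\<close> on \<open>Z \<bullet> u\<close>: the cross
  term and the square of the subtracted part combine to one multiple of
  \<open>(c \<bullet> x)\<^sup>2 / q\<close>. If \<open>q = 0\<close>, all these quotients are 0 and
  the identity still holds.\<close>

lemma variance_schur_residual:
  "(\<integral>\<omega>. (schur_residual M u Z \<omega> \<bullet> x)\<^sup>2 \<partial>M)
    = (\<integral>\<omega>. (Z \<omega> \<bullet> x)\<^sup>2 \<partial>M) - (schur_vector M u Z \<bullet> x)\<^sup>2"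
proof -
  define q c where "q = (\<integral>\<omega>. (Z \<omega> \<bullet> u)\<^sup>2 \<partial>M)" and "c = (\<integral>\<omega>. (Z \<omega> \<bullet> u) *\<^sub>R Z \<omega> \<partial>M)"
  have q: "q \<ge> 0" unfolding q_def by simp
  have cx: "c \<bullet> x = (\<integral>\<omega>. (Z \<omega> \<bullet> u) * (Z \<omega> \<bullet> x) \<partial>M)"
    unfolding c_def by (rule integral_inner_scaleR)
  have i: "integrable M (\<lambda>\<omega>. (Z \<omega> \<bullet> x)\<^sup>2)" "integrable M (\<lambda>\<omega>. (Z \<omega> \<bullet> u) * (Z \<omega> \<bullet> x))"
    "integrable M (\<lambda>\<omega>. (Z \<omega> \<bullet> u)\<^sup>2)"
    unfolding power2_eq_square by (rule integrable_inner_inner)+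
  have "(\<integral>\<omega>. (schur_residual M u Z \<omega> \<bullet> x)\<^sup>2 \<partial>M)
      = (\<integral>\<omega>. (Z \<omega> \<bullet> x)\<^sup>2 - (2 * (c \<bullet> x) / q) * ((Z \<omega> \<bullet> u) * (Z \<omega> \<bullet> x))
          + ((c \<bullet> x)\<^sup>2 / q\<^sup>2) * (Z \<omega> \<bullet> u)\<^sup>2 \<partial>M)"
    unfolding schur_residual_def q_def[symmetric] c_def[symmetric]
    by (intro Bochner_Integration.integral_cong)
      (auto simp: inner_diff_left power2_eq_square power_divide algebra_simps)
  also have "\<dots> = (\<integral>\<omega>. (Z \<omega> \<bullet> x)\<^sup>2 \<partial>M) - (2 * (c \<bullet> x) / q) * (c \<bullet> x) + ((c \<bullet> x)\<^sup>2 / q\<^sup>2) * q"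
    using i by (simp add: cx q_def)
  also have "(2 * (c \<bullet> x) / q) * (c \<bullet> x) = 2 * ((c \<bullet> x)\<^sup>2 / q)" by (simp add: power2_eq_square)
  also have "((c \<bullet> x)\<^sup>2 / q\<^sup>2) * q = (c \<bullet> x)\<^sup>2 / q" by (simp add: power2_eq_square)
  also have "(c \<bullet> x)\<^sup>2 / q = (schur_vector M u Z \<bullet> x)\<^sup>2"
    unfolding schur_vector_def q_def[symmetric] c_def[symmetric] using q
    by (simp add: power_divide)
  finally show ?thesis by simp
qed

text \<open>The same computation for the full variance, which plays the part of the trace. It yields
  the summability of the squared norms of the vectors without an orthonormal basis.\<close>

lemma norm_schur_residual:
  "(\<integral>\<omega>. (norm (schur_residual M u Z \<omega>))\<^sup>2 \<partial>M)
    = (\<integral>\<omega>. (norm (Z \<omega>))\<^sup>2 \<partial>M) - (norm (schur_vector M u Z))\<^sup>2"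
proof -
  define q c where "q = (\<integral>\<omega>. (Z \<omega> \<bullet> u)\<^sup>2 \<partial>M)" and "c = (\<integral>\<omega>. (Z \<omega> \<bullet> u) *\<^sub>R Z \<omega> \<partial>M)"
  have q: "q \<ge> 0" unfolding q_def by simp
  have cx: "c \<bullet> c = (\<integral>\<omega>. (Z \<omega> \<bullet> u) * (Z \<omega> \<bullet> c) \<partial>M)"
    using integral_inner_scaleR[of u c] unfolding c_def .
  have i: "integrable M (\<lambda>\<omega>. (norm (Z \<omega>))\<^sup>2)" "integrable M (\<lambda>\<omega>. (Z \<omega> \<bullet> u) * (Z \<omega> \<bullet> c))"
    "integrable M (\<lambda>\<omega>. (Z \<omega> \<bullet> u)\<^sup>2)"
    using integrable_norm_power2 integrable_inner_inner unfolding power2_eq_square by blast+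
  have "(\<integral>\<omega>. (norm (schur_residual M u Z \<omega>))\<^sup>2 \<partial>M)
      = (\<integral>\<omega>. (norm (Z \<omega>))\<^sup>2 - (2 / q) * ((Z \<omega> \<bullet> u) * (Z \<omega> \<bullet> c))
          + ((c \<bullet> c) / q\<^sup>2) * (Z \<omega> \<bullet> u)\<^sup>2 \<partial>M)"
    unfolding schur_residual_def q_def[symmetric] c_def[symmetric] power2_norm_eq_inner
    by (intro Bochner_Integration.integral_cong)
      (auto simp: inner_diff_left inner_diff_right power2_eq_square power_divide inner_commute algebra_simps)
  also have "\<dots> = (\<integral>\<omega>. (norm (Z \<omega>))\<^sup>2 \<partial>M) - (2 / q) * (c \<bullet> c) + ((c \<bullet> c) / q\<^sup>2) * q"
    using i by (simp add: cx q_def)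
  also have "(2 / q) * (c \<bullet> c) = 2 * ((c \<bullet> c) / q)" by simp
  also have "((c \<bullet> c) / q\<^sup>2) * q = (c \<bullet> c) / q" by (simp add: power2_eq_square)
  also have "(c \<bullet> c) / q = (norm (schur_vector M u Z))\<^sup>2"
    unfolding schur_vector_def q_def[symmetric] c_def[symmetric] using q
    by (simp add: power_divide power_mult_distrib power2_norm_eq_inner[symmetric])
  finally show ?thesis by simp
qed

text \<open>The removed part is the whole variance in the direction \<open>u\<close>: the vector has
  inner product \<open>sqrt q\<close> with \<open>u\<close>, also when \<open>q = 0\<close>.\<close>

lemma variance_schur_residual_self: "(\<integral>\<omega>. (schur_residual M u Z \<omega> \<bullet> u)\<^sup>2 \<partial>M) = 0"
proof -
  define q where "q = (\<integral>\<omega>. (Z \<omega> \<bullet> u)\<^sup>2 \<partial>M)"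
  have q: "q \<ge> 0" unfolding q_def by simp
  have "schur_vector M u Z \<bullet> u = q / sqrt q"
    unfolding schur_vector_def q_def[symmetric]
    by (simp add: integral_inner_scaleR q_def power2_eq_square)
  then have "(schur_vector M u Z \<bullet> u)\<^sup>2 = q"
    using q by (simp add: power_divide power2_eq_square)
  then show ?thesis unfolding variance_schur_residual q_def by simp
qed

end

section \<open>Rank-one decomposition of a covariance along a dense sequence of directions\<close>

primrec schur_residuals where
  "schur_residuals M w Z 0 = Z"
| "schur_residuals M w Z (Suc m) = schur_residual M (w m) (schur_residuals M w Z m)"

text \<open>Later steps never increase a variance, so \<open>Q n (w m) = 0\<close> for all
  \<open>n > m\<close>, and the uniform bound \<open>Q n x \<le> T 0 * (norm x)\<^sup>2\<close>
  carries this from the dense set to every \<open>x\<close> in the limit. The vectors need not be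
  orthogonal; the decomposition takes the place of a spectral one.\<close>

proposition covariance_rank_one_decomposition:
  fixes Z :: "'w \<Rightarrow> 'b::{real_inner, banach, second_countable_topology}"
  assumes M: "prob_space M" and Z: "Z \<in> borel_measurable M" and B: "\<And>\<omega>. norm (Z \<omega>) \<le> B"
  obtains v :: "nat \<Rightarrow> 'b"
  where "\<And>x. (\<lambda>m. (v m \<bullet> x)\<^sup>2) sums (\<integral>\<omega>. (Z \<omega> \<bullet> x)\<^sup>2 \<partial>M)" "summable (\<lambda>m. (norm (v m))\<^sup>2)"
proof -
  interpret prob_space M by (rule M)
  obtain D :: "'b set" where D: "countable D" "\<And>X. open X \<Longrightarrow> X \<noteq> {} \<Longrightarrow> \<exists>d\<in>D. d \<in> X"
    by (erule countable_dense_setE)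
  define w where "w = from_nat_into D"
  have "D \<noteq> {}" using D(2)[of UNIV] by auto
  then have rw: "range w = D" unfolding w_def using D(1) by (simp add: range_from_nat_into)
  define R where "R = schur_residuals M w Z"
  define v where "v m = schur_vector M (w m) (R m)" for m
  define Q where "Q m x = (\<integral>\<omega>. (R m \<omega> \<bullet> x)\<^sup>2 \<partial>M)" for m x
  define T where "T m = (\<integral>\<omega>. (norm (R m \<omega>))\<^sup>2 \<partial>M)" for m
  have R0: "R 0 = Z" and RS: "R (Suc m) = schur_residual M (w m) (R m)" for m
    by (simp_all add: R_def)
  have R: "R m \<in> borel_measurable M \<and> (\<exists>C. \<forall>\<omega>. norm (R m \<omega>) \<le> C)" for m
  proof (induction m)
    case (Suc m)
    then obtain C where "R m \<in> borel_measurable M" "\<And>\<omega>. norm (R m \<omega>) \<le> C" by blast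
    from borel_measurable_schur_residual[OF M this] bounded_schur_residual[OF M this]
    show ?case unfolding RS by blast
  qed (use Z B in \<open>auto simp: R0\<close>)
  have QS: "Q (Suc m) x = Q m x - (v m \<bullet> x)\<^sup>2" and TS: "T (Suc m) = T m - (norm (v m))\<^sup>2"
    and QZ: "Q (Suc m) (w m) = 0" and TQ: "Q m x \<le> T m * (norm x)\<^sup>2" for m x
  proof -
    obtain C where C: "R m \<in> borel_measurable M" "\<And>\<omega>. norm (R m \<omega>) \<le> C" using R by blast
    show "Q (Suc m) x = Q m x - (v m \<bullet> x)\<^sup>2"
      unfolding Q_def v_def RS by (rule variance_schur_residual[OF M C])
    show "T (Suc m) = T m - (norm (v m))\<^sup>2"
      unfolding T_def v_def RS by (rule norm_schur_residual[OF M C])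
    show "Q (Suc m) (w m) = 0"
      unfolding Q_def RS by (rule variance_schur_residual_self[OF M C])
    have "Q m x \<le> (\<integral>\<omega>. (norm (R m \<omega>))\<^sup>2 * (norm x)\<^sup>2 \<partial>M)"
      unfolding Q_def
    proof (rule integral_mono)
      show "integrable M (\<lambda>\<omega>. (R m \<omega> \<bullet> x)\<^sup>2)"
        using integrable_inner_inner[OF M C] by (simp add: power2_eq_square)
      show "integrable M (\<lambda>\<omega>. (norm (R m \<omega>))\<^sup>2 * (norm x)\<^sup>2)"
        using integrable_norm_power2[OF M C] by simp
      show "(R m \<omega> \<bullet> x)\<^sup>2 \<le> (norm (R m \<omega>))\<^sup>2 * (norm x)\<^sup>2" for \<omega>
        using power_mono[OF Cauchy_Schwarz_ineq2[of "R m \<omega>" x], of 2] by (simp add: power_mult_distrib)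
    qed
    then show "Q m x \<le> T m * (norm x)\<^sup>2" by (simp add: T_def)
  qed
  have Qnn: "Q m x \<ge> 0" for m x unfolding Q_def by simp
  have Tnn: "T m \<ge> 0" for m unfolding T_def by simp
  have Qsum: "(\<Sum>m<n. (v m \<bullet> x)\<^sup>2) = Q 0 x - Q n x" for n x by (induction n) (auto simp: QS)
  have Tsum: "(\<Sum>m<n. (norm (v m))\<^sup>2) = T 0 - T n" for n by (induction n) (auto simp: TS)
  have T0: "T m \<le> T 0" for m using Tsum[of m] sum_nonneg[of "{..<m}" "\<lambda>m. (norm (v m))\<^sup>2"] by simp
  have Qw: "Q n (w m) = 0" if "n > m" for n m
  proof -
    from that have "Suc m \<le> n" by simp
    then show ?thesis
    proof (induction rule: dec_induct)
      case base show ?case by (rule QZ)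
    next
      \<comment> \<open>From \<open>Q n (w m) = 0\<close> the next value is minus a square, but it
        is also nonnegative.\<close>
      case (step n) then show ?case using QS[of n "w m"] Qnn[of "Suc n" "w m"] by auto
    qed
  qed
  have Qlim: "(\<lambda>n. Q n x) \<longlonglongrightarrow> 0" for x
  proof (rule LIMSEQ_I)
    fix r :: real assume "r > 0"
    \<comment> \<open>Chosen so that the bound \<open>2 * T 0 * e\<^sup>2\<close> on
      \<open>Q n x\<close> for \<open>n > m\<close> is below \<open>r\<close>; the summand 2 keeps
      the denominator positive when \<open>T 0 = 0\<close>.\<close>
    define e where "e = sqrt (r / (2 * T 0 + 2))"
    have e: "e > 0" "2 * T 0 * e\<^sup>2 < r" 
    proof -
      show "e > 0" unfolding e_def using \<open>r > 0\<close> Tnn[of 0] by simp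
      have "2 * T 0 * e\<^sup>2 = 2 * T 0 * r / (2 * T 0 + 2)"
        unfolding e_def using \<open>r > 0\<close> Tnn[of 0] by simp
      also have "\<dots> < r" using \<open>r > 0\<close> Tnn[of 0] by (simp add: field_simps)
      finally show "2 * T 0 * e\<^sup>2 < r" .
    qed
    obtain d where "d \<in> D" "d \<in> ball x e" using D(2)[of "ball x e"] e by auto
    then obtain m where m: "dist x (w m) < e" using rw by auto
    have "Q n x < r" if "n > m" for n
    proof -
      obtain C where C: "R n \<in> borel_measurable M" "\<And>\<omega>. norm (R n \<omega>) \<le> C" using R by blast
      have ii: "integrable M (\<lambda>\<omega>. (R n \<omega> \<bullet> y)\<^sup>2)" for y
        using integrable_inner_inner[OF M C] by (simp add: power2_eq_square)
      have "Q n x \<le> (\<integral>\<omega>. 2 * (R n \<omega> \<bullet> w m)\<^sup>2 + 2 * (R n \<omega> \<bullet> (x - w m))\<^sup>2 \<partial>M)"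
        unfolding Q_def
      proof (rule integral_mono)
        fix \<omega>
        have "(a + b)\<^sup>2 \<le> 2 * a\<^sup>2 + 2 * b\<^sup>2" for a b :: real
          using sum_squares_ge_zero[of "a - b" 0] by (simp add: power2_eq_square algebra_simps)
        from this[of "R n \<omega> \<bullet> w m" "R n \<omega> \<bullet> (x - w m)"]
        show "(R n \<omega> \<bullet> x)\<^sup>2 \<le> 2 * (R n \<omega> \<bullet> w m)\<^sup>2 + 2 * (R n \<omega> \<bullet> (x - w m))\<^sup>2"
          by (simp add: inner_diff_right)
      qed (use ii in auto)
      also have "\<dots> = 2 * Q n (w m) + 2 * Q n (x - w m)" using ii by (simp add: Q_def)
      also have "\<dots> \<le> 2 * (T 0 * e\<^sup>2)"
      proof -
        have "Q n (x - w m) \<le> T n * (norm (x - w m))\<^sup>2" by (rule TQ)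
        also have "\<dots> \<le> T 0 * e\<^sup>2"
          using m Tnn T0 by (intro mult_mono power_mono) (auto simp: dist_norm)
        finally show ?thesis using Qw[OF that] by simp
      qed
      also have "\<dots> < r" using e by simp
      finally show ?thesis .
    qed
    then show "\<exists>no. \<forall>n\<ge>no. norm (Q n x - 0) < r"
      using Qnn by (intro exI[of _ "Suc m"]) auto
  qed
  show thesis
  proof (rule that)
    show "(\<lambda>m. (v m \<bullet> x)\<^sup>2) sums (\<integral>\<omega>. (Z \<omega> \<bullet> x)\<^sup>2 \<partial>M)" for x
      unfolding sums_def Qsum using tendsto_diff[OF tendsto_const Qlim, of "Q 0 x" x] by (simp add: Q_def R0)
    show "summable (\<lambda>m. (norm (v m))\<^sup>2)"
      by (rule bounded_imp_summable[of _ "T 0"])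
        (use Tsum[of "Suc n" for n] Tnn in \<open>auto simp flip: lessThan_Suc_atMost simp del: sum.lessThan_Suc\<close>)
  qed
qed

section \<open>Centred normal laws on the line\<close>

lemma gaussian_char_scaled:
  "char (distr std_normal_distribution borel (\<lambda>z. s * z)) t = exp (- (s * t)\<^sup>2 / 2)"
proof -
  have "char (distr std_normal_distribution borel (\<lambda>z. s * z)) t = char std_normal_distribution (t * s)"
    unfolding char_def by (subst integral_distr) (auto simp: mult_ac)
  then show ?thesis by (simp add: char_std_normal_distribution mult_ac)
qed

lemma real_gaussian_scaled: "real_gaussian (distr std_normal_distribution borel (\<lambda>z. s * z))"
proof (cases "s = 0")
  interpret prob_space std_normal_distribution
    using real_dist_normal_dist by (simp add: real_distribution_def)
  case True
  then have "distr std_normal_distribution borel (\<lambda>z. s * z) = return borel 0"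
    by (intro measure_eqI) (auto simp: emeasure_distr emeasure_space_1[simplified] indicator_def vimage_def)
  then show ?thesis unfolding real_gaussian_def by blast
next
  interpret prob_space std_normal_distribution
    using real_dist_normal_dist by (simp add: real_distribution_def)
  case False
  have "distributed std_normal_distribution lborel (\<lambda>x. x) (normal_density 0 1)"
    unfolding distributed_def by (auto simp: distr_id2)
  from normal_density_affine[OF this, of s 0] False
  have "distributed std_normal_distribution lborel (\<lambda>x. s * x) (normal_density 0 \<bar>s\<bar>)" by simp
  then have "distr std_normal_distribution borel (\<lambda>z. s * z)
      = density lborel (\<lambda>x. ennreal (normal_density 0 \<bar>s\<bar> x))"
    unfolding distributed_def by (metis distr_cong sets_lborel)
  then show ?thesis unfolding real_gaussian_def using False by (metis zero_less_abs_iff)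
qed

lemma integral_scaled_normal:
  "(\<integral>x. x \<partial>distr std_normal_distribution borel (\<lambda>z. s * z)) = 0"
  "(\<integral>x. x\<^sup>2 \<partial>distr std_normal_distribution borel (\<lambda>z. s * z)) = s\<^sup>2"
  using integral_std_normal_distribution_moment_odd[of 1]
    std_normal_distribution_even_moments(1)[of 1]
  by (simp_all add: integral_distr power_mult_distrib)

section \<open>Independent standard normal coefficients and the Gaussian series\<close>

abbreviation white_noise :: "(nat \<Rightarrow> real) measure" where
  "white_noise \<equiv> \<Pi>\<^sub>M m\<in>UNIV. std_normal_distribution"

lemma prob_space_white_noise: "prob_space white_noise"
  using real_dist_normal_dist by (intro prob_space_PiM) (simp add: real_distribution_def)

lemma distr_white_noise: "distr white_noise borel (\<lambda>x. x m) = std_normal_distribution"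
proof -
  have "distr white_noise std_normal_distribution (\<lambda>x. x m) = std_normal_distribution"
    using real_dist_normal_dist by (intro distr_PiM_component) (auto simp: real_distribution_def)
  then show ?thesis by (metis distr_cong sets_density sets_lborel)
qed

lemma measurable_white_noise[measurable]: "(\<lambda>x. x m) \<in> borel_measurable white_noise"
  using measurable_component_singleton[of m UNIV "\<lambda>_. std_normal_distribution"]
  by (simp cong: measurable_cong_sets)

lemma indep_vars_white_noise: "prob_space.indep_vars white_noise (\<lambda>_. borel) (\<lambda>m x. x m) UNIV"
proof -
  interpret prob_space white_noise by (rule prob_space_white_noise)
  have "distr white_noise (\<Pi>\<^sub>M m\<in>UNIV. borel) (\<lambda>x. \<lambda>m\<in>UNIV. x m) = distr white_noise white_noise (\<lambda>x. x)"
    by (intro distr_cong sets_PiM_cong) auto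
  also have "\<dots> = (\<Pi>\<^sub>M m\<in>UNIV. distr white_noise borel (\<lambda>x. x m))"
    unfolding distr_white_noise by (rule distr_id)
  finally show ?thesis
    by (subst indep_vars_iff_distr_eq_PiM) auto
qed

lemma integral_white_noise:
  "integrable white_noise (\<lambda>x. x m)" "(\<integral>x. x m \<partial>white_noise) = 0"
  "integrable white_noise (\<lambda>x. (x m)\<^sup>2)" "(\<integral>x. (x m)\<^sup>2 \<partial>white_noise) = 1"
proof -
  let ?W = white_noise
  have "integrable (distr white_noise borel (\<lambda>x. x m)) (\<lambda>z. z ^ k)" for k
    unfolding distr_white_noise by (rule integrable_std_normal_distribution_moment)
  then have *: "integrable ?W (\<lambda>x. (x m) ^ k)" for k
    by (subst (asm) integrable_distr_eq) auto
  show "integrable ?W (\<lambda>x. x m)" "integrable ?W (\<lambda>x. (x m)\<^sup>2)"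
    using *[of 1] *[of 2] by auto
  have "(\<integral>x. (x m) ^ k \<partial>?W) = (\<integral>z. z ^ k \<partial>distr white_noise borel (\<lambda>x. x m))" for k
    by (subst integral_distr) auto
  then have **: "(\<integral>x. (x m) ^ k \<partial>?W) = (\<integral>z. z ^ k \<partial>std_normal_distribution)" for k
    unfolding distr_white_noise .
  show "(\<integral>x. x m \<partial>?W) = 0"
    using **[of 1] integral_std_normal_distribution_moment_odd[of 1] by simp
  show "(\<integral>x. (x m)\<^sup>2 \<partial>?W) = 1"
    using **[of 2] std_normal_distribution_even_moments(1)[of 1] by simp
qed

lemma integral_white_noise_mult:
  "integrable white_noise (\<lambda>x. x i * x j)"
  "(\<integral>x. x i * x j \<partial>white_noise) = (if i = j then 1 else 0)"
proof -
  let ?W = white_noise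
  interpret prob_space white_noise by (rule prob_space_white_noise)
  have "integrable ?W (\<lambda>x. x i * x j) \<and>
    (\<integral>x. x i * x j \<partial>?W) = (if i = j then 1 else 0)"
  proof (cases "i = j")
    case True then show ?thesis using integral_white_noise(3,4)[of i] by (simp add: power2_eq_square)
  next
    case False
    have "indep_vars (\<lambda>_. borel) (\<lambda>m x. x m) {i, j}"
      by (rule indep_vars_subset[OF indep_vars_white_noise]) simp
    from indep_vars_lebesgue_integral[OF _ this] indep_vars_integrable[OF _ this]
    show ?thesis using integral_white_noise(1,2) False by simp
  qed
  then show "integrable ?W (\<lambda>x. x i * x j)"
    "(\<integral>x. x i * x j \<partial>?W) = (if i = j then 1 else 0)" by auto
qed

text \<open>The coordinates are orthonormal in mean square, so only the diagonal of the double sum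
  remains.\<close>

lemma white_noise_sum_norm:
  fixes v :: "nat \<Rightarrow> 'b::real_inner"
  assumes "finite A"
  shows "integrable white_noise (\<lambda>x. (norm (\<Sum>m\<in>A. x m *\<^sub>R v m))\<^sup>2)"
    "(\<integral>x. (norm (\<Sum>m\<in>A. x m *\<^sub>R v m))\<^sup>2 \<partial>white_noise) = (\<Sum>m\<in>A. (norm (v m))\<^sup>2)"
proof -
  have e: "(norm (\<Sum>m\<in>A. x m *\<^sub>R v m))\<^sup>2 = (\<Sum>i\<in>A. \<Sum>j\<in>A. (x i * x j) * (v i \<bullet> v j))" for x :: "nat \<Rightarrow> real"
    by (simp add: power2_norm_eq_inner inner_sum_left inner_sum_right sum_distrib_left mult.assoc mult.left_commute inner_commute)
  show "integrable white_noise (\<lambda>x. (norm (\<Sum>m\<in>A. x m *\<^sub>R v m))\<^sup>2)"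
    unfolding e using integral_white_noise_mult(1) by auto
  have "(\<integral>x. (norm (\<Sum>m\<in>A. x m *\<^sub>R v m))\<^sup>2 \<partial>white_noise)
      = (\<Sum>i\<in>A. \<Sum>j\<in>A. (if i = j then 1 else 0) * (v i \<bullet> v j))"
    unfolding e using integral_white_noise_mult
    by (subst Bochner_Integration.integral_sum, force)+ simp
  also have "\<dots> = (\<Sum>i\<in>A. \<Sum>j\<in>A. if i = j then v i \<bullet> v j else 0)"
    by (intro sum.cong) auto
  also have "\<dots> = (\<Sum>m\<in>A. (norm (v m))\<^sup>2)"
    using assms by (simp add: power2_norm_eq_inner)
  finally show "(\<integral>x. (norm (\<Sum>m\<in>A. x m *\<^sub>R v m))\<^sup>2 \<partial>white_noise) = (\<Sum>m\<in>A. (norm (v m))\<^sup>2)" .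
qed

lemma char_white_noise_sum:
  fixes v :: "nat \<Rightarrow> 'b::{real_inner, second_countable_topology}"
  assumes "finite A"
  shows "(\<integral>x. iexp ((\<Sum>m\<in>A. x m *\<^sub>R v m) \<bullet> w) \<partial>white_noise) = exp (- (\<Sum>m\<in>A. (v m \<bullet> w)\<^sup>2) / 2)"
proof -
  let ?W = white_noise
  interpret prob_space white_noise by (rule prob_space_white_noise)
  have ind: "indep_vars (\<lambda>_. borel) (\<lambda>m x. x m * (v m \<bullet> w)) A"
    by (rule indep_vars_compose2[OF indep_vars_subset[OF indep_vars_white_noise]]) auto
  have ch: "char (distr white_noise borel (\<lambda>x. x m * (v m \<bullet> w))) 1 = exp (- (v m \<bullet> w)\<^sup>2 / 2)" for m
  proof -
    have "char (distr white_noise borel (\<lambda>x. x m * (v m \<bullet> w))) 1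
       = char (distr white_noise borel (\<lambda>x. x m)) (v m \<bullet> w)"
      unfolding char_def by (subst (1 2) integral_distr) (auto simp: mult_ac)
    then show ?thesis unfolding distr_white_noise by (simp add: char_std_normal_distribution)
  qed
  have "(\<integral>x. iexp ((\<Sum>m\<in>A. x m *\<^sub>R v m) \<bullet> w) \<partial>?W)
      = char (distr white_noise borel (\<lambda>x. \<Sum>m\<in>A. x m * (v m \<bullet> w))) 1"
    unfolding char_def by (subst integral_distr) (auto simp: inner_sum_left)
  also have "\<dots> = (\<Prod>m\<in>A. complex_of_real (exp (- (v m \<bullet> w)\<^sup>2 / 2)))"
    unfolding char_distr_sum[OF ind] ch ..
  also have "\<dots> = exp (\<Sum>m\<in>A. - (v m \<bullet> w)\<^sup>2 / 2)"
    using assms by (simp add: exp_sum)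
  finally show ?thesis by (simp add: sum_negf sum_divide_distrib)
qed

text \<open>Almost sure convergence along a subsequence of the partial sums is enough: the law of
  each projection of the limit is pinned down by its characteristic function, and the second moment
  is bounded by Fatou's lemma.\<close>

proposition exists_gaussian_series:
  fixes v :: "nat \<Rightarrow> 'b::{real_inner, banach, second_countable_topology}"
  assumes Q: "\<And>x. (\<lambda>m. (v m \<bullet> x)\<^sup>2) sums Q x" and s: "summable (\<lambda>m. (norm (v m))\<^sup>2)"
  obtains \<nu> :: "'b measure" where "prob_space \<nu>" "sets \<nu> = sets borel"
    "integrable \<nu> (\<lambda>x. (norm x)\<^sup>2)"
    "\<And>w. distr \<nu> borel (\<lambda>x. x \<bullet> w) = distr std_normal_distribution borel (\<lambda>z. sqrt (Q w) * z)"
proof -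
  let ?W = white_noise
  interpret prob_space white_noise by (rule prob_space_white_noise)
  define S where "S n x = (\<Sum>m<n. x m *\<^sub>R v m)" for n :: nat and x :: "nat \<Rightarrow> real"
  have Sm[measurable]: "S n \<in> borel_measurable ?W" for n
    unfolding S_def[abs_def] by measurable
  \<comment> \<open>The bound \<open>(1/4)^j\<close> on a tail of squared lengths becomes the
    summable bound \<open>(1/2)^j\<close> on the mean norm of the corresponding block.\<close>
  have "\<exists>N. \<forall>m\<ge>N. \<forall>n. sum (\<lambda>m. (norm (v m))\<^sup>2) {m..<n} < (1/4)^j" for j
    using s[unfolded summable_Cauchy, rule_format, of "(1/4)^j"]
    by (simp add: sum_nonneg)
  then obtain N where N: "\<And>j m n. m \<ge> N j \<Longrightarrow> sum (\<lambda>m. (norm (v m))\<^sup>2) {m..<n} < (1/4)^j" by metis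
  \<comment> \<open>Along \<open>r\<close> the increments of the partial sums are summable in mean, hence almost surely.\<close>
  define r where "r j = (\<Sum>i\<le>j. N i) + j" for j
  have rN: "r j \<ge> N j" for j unfolding r_def
    by (rule trans_le_add1) (rule member_le_sum, auto)
  have rS: "r j \<le> r (Suc j)" for j unfolding r_def by simp
  have rj: "j \<le> r j" for j unfolding r_def by simp
  define D where "D j x = (\<Sum>m\<in>{r j..<r (Suc j)}. x m *\<^sub>R v m)" for j and x :: "nat \<Rightarrow> real"
  have Dm[measurable]: "D j \<in> borel_measurable ?W" for j
    unfolding D_def[abs_def] by measurable
  have SD: "S (r n) x = S (r 0) x + (\<Sum>j<n. D j x)" for n x
  proof (induction n)
    case (Suc n)
    have "S (r (Suc n)) x = S (r n) x + D n x"
      unfolding S_def D_def lessThan_atLeast0 using rS[of n] by (simp add: sum.atLeastLessThan_concat)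
    then show ?case using Suc by simp
  qed simp
  have D2: "integrable ?W (\<lambda>x. (norm (D j x))\<^sup>2)"
    "(\<integral>x. (norm (D j x))\<^sup>2 \<partial>?W) \<le> (1/4)^j" for j
    unfolding D_def white_noise_sum_norm(2)[OF finite_atLeastLessThan]
    using N[OF rN, of j "r (Suc j)"] by (auto intro!: white_noise_sum_norm less_imp_le)
  have Di: "integrable ?W (\<lambda>x. norm (D j x))" for j
    by (rule square_integrable_imp_integrable[OF _ D2(1)]) measurable
  have D1: "(\<integral>x. norm (D j x) \<partial>?W) \<le> (1/2)^j" for j
  proof -
    \<comment> \<open>Jensen's inequality for the square, read off from the variance being
      nonnegative.\<close>
    have "(\<integral>x. norm (D j x) \<partial>?W)\<^sup>2 \<le> (\<integral>x. (norm (D j x))\<^sup>2 \<partial>?W)"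
      using variance_positive[of "\<lambda>x. norm (D j x)"] variance_eq[OF Di D2(1)] by simp
    also have "\<dots> \<le> ((1/2)^j)\<^sup>2" using D2(2)[of j] by (simp add: power2_eq_square flip: power_mult_distrib)
    finally show ?thesis by (rule power2_le_imp_le) simp
  qed
  have "AE x in ?W. (\<Sum>j. ennreal (norm (D j x))) \<noteq> \<infinity>"
  proof (rule nn_integral_PInf_AE)
    have "(\<integral>\<^sup>+x. (\<Sum>j. ennreal (norm (D j x))) \<partial>?W) = (\<Sum>j. \<integral>\<^sup>+x. ennreal (norm (D j x)) \<partial>?W)"
      by (rule nn_integral_suminf) measurable
    also have "\<dots> = (\<Sum>j. ennreal (\<integral>x. norm (D j x) \<partial>?W))"
      using Di by (intro suminf_cong nn_integral_eq_integral) auto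
    also have "\<dots> \<noteq> \<infinity>"
    proof (simp only: infinity_ennreal_def, rule ennreal_suminf_neq_top)
      show "summable (\<lambda>j. \<integral>x. norm (D j x) \<partial>?W)"
        by (rule summable_comparison_test_ev[OF _ summable_geometric[of "1/2::real"]])
          (use D1 in \<open>auto intro!: always_eventually simp del: power_divide\<close>)
    qed auto
    finally show "(\<integral>\<^sup>+x. (\<Sum>j. ennreal (norm (D j x))) \<partial>?W) \<noteq> \<infinity>" .
  qed measurable
  then have conv: "AE x in ?W. convergent (\<lambda>n. S (r n) x)"
  proof eventually_elim
    case (elim x)
    then have "summable (\<lambda>j. norm (D j x))" by (intro summable_suminf_not_top) auto
    then have "summable (\<lambda>j. D j x)" by (rule summable_norm_cancel)
    then have "convergent (\<lambda>n. \<Sum>j<n. D j x)" by (simp add: summable_iff_convergent)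
    then have "convergent (\<lambda>n. S (r 0) x + (\<Sum>j<n. D j x))" by (intro convergent_add convergent_const)
    moreover have "(\<lambda>n. S (r n) x) = (\<lambda>n. S (r 0) x + (\<Sum>j<n. D j x))" by (rule ext, rule SD)
    ultimately show ?case by (simp only:)
  qed
  define G where "G x = lim (\<lambda>n. S (r n) x)" for x
  have Gm[measurable]: "G \<in> borel_measurable ?W"
    unfolding G_def[abs_def] by measurable
  have lim: "AE x in ?W. (\<lambda>n. S (r n) x) \<longlonglongrightarrow> G x"
    using conv by eventually_elim (simp add: G_def convergent_LIMSEQ_iff)
  have r_at_top: "filterlim r sequentially sequentially"
    by (rule filterlim_at_top_mono[OF filterlim_ident]) (use rj in auto)
  define \<nu> where "\<nu> = distr white_noise borel G"
  have p: "prob_space \<nu>" unfolding \<nu>_def by (rule prob_space_distr) measurable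
  have chG: "(\<integral>x. iexp (G x \<bullet> w) \<partial>?W) = exp (- Q w / 2)" for w
  proof (rule LIMSEQ_unique)
    show "(\<lambda>n. \<integral>x. iexp (S (r n) x \<bullet> w) \<partial>?W) \<longlonglongrightarrow> (\<integral>x. iexp (G x \<bullet> w) \<partial>?W)"
    proof (rule integral_dominated_convergence[where w="\<lambda>_. 1"])
      show "AE x in ?W. (\<lambda>n. iexp (S (r n) x \<bullet> w)) \<longlonglongrightarrow> iexp (G x \<bullet> w)"
        using lim by eventually_elim (intro tendsto_intros)
    qed auto
    have "(\<lambda>n. \<Sum>m<r n. (v m \<bullet> w)\<^sup>2) \<longlonglongrightarrow> Q w"
      using Q[of w] unfolding sums_def by (rule filterlim_compose[OF _ r_at_top])
    then have "(\<lambda>n. complex_of_real (exp (- (\<Sum>m<r n. (v m \<bullet> w)\<^sup>2) / 2))) \<longlonglongrightarrow> complex_of_real (exp (- Q w / 2))"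
      by (intro tendsto_intros) auto
    then show "(\<lambda>n. \<integral>x. iexp (S (r n) x \<bullet> w) \<partial>?W) \<longlonglongrightarrow> complex_of_real (exp (- Q w / 2))"
      unfolding S_def char_white_noise_sum[OF finite_lessThan] .
  qed
  show thesis
  proof (rule that[OF p])
    show "sets \<nu> = sets borel" by (simp add: \<nu>_def)
    fix w
    \<comment> \<open>Homogeneity of \<open>Q\<close> turns the characteristic functional in
      direction \<open>t *\<^sub>R w\<close> into the characteristic function at \<open>t\<close> of
      the projection on \<open>w\<close>.\<close>
    have Q2: "Q (t *\<^sub>R w) = t\<^sup>2 * Q w" for t
    proof -
      have "(\<lambda>m. t\<^sup>2 * (v m \<bullet> w)\<^sup>2) sums (t\<^sup>2 * Q w)" by (intro sums_mult Q)
      moreover have "(\<lambda>m. t\<^sup>2 * (v m \<bullet> w)\<^sup>2) sums Q (t *\<^sub>R w)"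
        using Q[of "t *\<^sub>R w"] by (simp add: power_mult_distrib)
      ultimately show ?thesis by (rule sums_unique2[symmetric])
    qed
    have Qnn: "Q w \<ge> 0" by (rule sums_le[OF _ sums_zero Q]) simp
    show "distr \<nu> borel (\<lambda>x. x \<bullet> w) = distr std_normal_distribution borel (\<lambda>z. sqrt (Q w) * z)"
    proof (rule Levy_uniqueness)
      show "real_distribution (distr \<nu> borel (\<lambda>x. x \<bullet> w))"
        by (rule prob_space.real_distribution_distr[OF p]) (simp add: \<nu>_def)
      show "real_distribution (distr std_normal_distribution borel (\<lambda>z. sqrt (Q w) * z))"
        using real_dist_normal_dist
        by (intro prob_space.real_distribution_distr) (auto simp: real_distribution_def)
      show "char (distr \<nu> borel (\<lambda>x. x \<bullet> w)) = char (distr std_normal_distribution borel (\<lambda>z. sqrt (Q w) * z))"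
      proof
        fix t
        have "char (distr \<nu> borel (\<lambda>x. x \<bullet> w)) t = (\<integral>x. iexp (G x \<bullet> (t *\<^sub>R w)) \<partial>?W)"
          unfolding char_def \<nu>_def by (subst distr_distr) (auto simp: integral_distr comp_def)
        also have "\<dots> = exp (- (sqrt (Q w) * t)\<^sup>2 / 2)"
          unfolding chG Q2 using Qnn by (simp add: power_mult_distrib mult.commute)
        finally show "char (distr \<nu> borel (\<lambda>x. x \<bullet> w)) t = char (distr std_normal_distribution borel (\<lambda>z. sqrt (Q w) * z)) t"
          unfolding gaussian_char_scaled .
      qed
    qed
  next
    define T where "T = (\<Sum>m. (norm (v m))\<^sup>2)"
    \<comment> \<open>Fatou's lemma along the almost surely convergent subsequence; the second
      moments of the partial sums stay below \<open>T\<close>.\<close>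
    have "(\<integral>\<^sup>+x. ennreal ((norm (G x))\<^sup>2) \<partial>?W)
       = (\<integral>\<^sup>+x. liminf (\<lambda>n. ennreal ((norm (S (r n) x))\<^sup>2)) \<partial>?W)"
    proof (rule nn_integral_cong_AE)
      show "AE x in ?W. ennreal ((norm (G x))\<^sup>2) = liminf (\<lambda>n. ennreal ((norm (S (r n) x))\<^sup>2))"
        using lim
      proof eventually_elim
        case (elim x)
        then have "(\<lambda>n. ennreal ((norm (S (r n) x))\<^sup>2)) \<longlonglongrightarrow> ennreal ((norm (G x))\<^sup>2)"
          by (intro tendsto_ennrealI tendsto_intros)
        then show ?case by (intro lim_imp_Liminf[symmetric]) auto
      qed
    qed
    also have "\<dots> \<le> liminf (\<lambda>n. \<integral>\<^sup>+x. ennreal ((norm (S (r n) x))\<^sup>2) \<partial>?W)"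
      by (rule nn_integral_liminf) measurable
    also have "\<dots> \<le> ennreal T"
    proof -
      have "(\<integral>\<^sup>+x. ennreal ((norm (S (r n) x))\<^sup>2) \<partial>?W) \<le> ennreal T" for n
      proof -
        have "(\<integral>\<^sup>+x. ennreal ((norm (S (r n) x))\<^sup>2) \<partial>?W) = ennreal (\<integral>x. (norm (S (r n) x))\<^sup>2 \<partial>?W)"
          unfolding S_def by (intro nn_integral_eq_integral white_noise_sum_norm) auto
        also have "\<dots> \<le> ennreal T"
          unfolding S_def white_noise_sum_norm(2)[OF finite_lessThan] T_def
          by (intro ennreal_leI sum_le_suminf s) auto
        finally show ?thesis .
      qed
      then have "liminf (\<lambda>n. \<integral>\<^sup>+x. ennreal ((norm (S (r n) x))\<^sup>2) \<partial>?W) \<le> liminf (\<lambda>n. ennreal T)"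
        by (intro Liminf_mono always_eventually) auto
      then show ?thesis by (simp add: Liminf_const)
    qed
    finally have "(\<integral>\<^sup>+x. ennreal ((norm (G x))\<^sup>2) \<partial>?W) < \<infinity>"
      by (rule le_less_trans) simp
    then have "integrable ?W (\<lambda>x. (norm (G x))\<^sup>2)"
      by (intro integrableI_bounded) auto
    then show "integrable \<nu> (\<lambda>x. (norm x)\<^sup>2)"
      unfolding \<nu>_def by (subst integrable_distr_eq) auto
  qed
qed

lemma integrable_of_norm_power2:
  fixes f :: "'a \<Rightarrow> 'b::{banach, second_countable_topology}"
  assumes "prob_space M" "f \<in> borel_measurable M" "integrable M (\<lambda>x. (norm (f x))\<^sup>2)"
  shows "integrable M f"
proof -
  interpret prob_space M by fact
  have "integrable M (\<lambda>x. norm (f x))"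
    by (rule square_integrable_imp_integrable[OF _ assms(3)]) (use assms(2) in measurable)
  then show ?thesis using assms(2) by (simp add: integrable_norm_iff)
qed

text \<open>\<open>Z\<close> is a bounded variable whose second moment form is \<open>S\<close>, not
  itself a Gaussian one. Giving \<open>S\<close> in this form supplies symmetry, positivity and
  finite trace at once.\<close>

proposition exists_gaussian_measure_of_covariance:
  fixes Z :: "'w \<Rightarrow> 'b::{real_inner, banach, second_countable_topology}"
  assumes M: "prob_space M" and Z: "Z \<in> borel_measurable M" and B: "\<And>\<omega>. norm (Z \<omega>) \<le> B"
    and S: "\<And>w v. S w \<bullet> v = (\<integral>\<omega>. (Z \<omega> \<bullet> w) * (Z \<omega> \<bullet> v) \<partial>M)"
  obtains \<nu> where "gaussian_measure 0 S \<nu>"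
    "\<And>w. char (distr \<nu> borel (\<lambda>x. x \<bullet> w)) 1 = exp (- (\<integral>\<omega>. (Z \<omega> \<bullet> w)\<^sup>2 \<partial>M) / 2)"
proof -
  define Q where "Q w = (\<integral>\<omega>. (Z \<omega> \<bullet> w)\<^sup>2 \<partial>M)" for w
  obtain v :: "nat \<Rightarrow> 'b" where v: "\<And>x. (\<lambda>m. (v m \<bullet> x)\<^sup>2) sums Q x" "summable (\<lambda>m. (norm (v m))\<^sup>2)"
    using covariance_rank_one_decomposition[OF M Z B] unfolding Q_def by blast
  obtain \<nu> :: "'b measure" where \<nu>: "prob_space \<nu>" and s[measurable_cong]: "sets \<nu> = sets borel"
    and i2: "integrable \<nu> (\<lambda>x. (norm x)\<^sup>2)"
    and d: "\<And>w. distr \<nu> borel (\<lambda>x. x \<bullet> w) = distr std_normal_distribution borel (\<lambda>z. sqrt (Q w) * z)"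
    using exists_gaussian_series[OF v] by blast
  have Qnn: "Q w \<ge> 0" for w unfolding Q_def by simp
  interpret prob_space \<nu> by (rule \<nu>)
  have i1: "integrable \<nu> (\<lambda>x. x)"
    by (rule integrable_of_norm_power2[OF \<nu> _ i2]) measurable
  have m: "(\<integral>x. x \<partial>\<nu>) = 0"
  proof -
    have "(\<integral>x. x \<partial>\<nu>) \<bullet> w = 0" for w
    proof -
      have "(\<integral>x. x \<partial>\<nu>) \<bullet> w = (\<integral>x. x \<bullet> w \<partial>\<nu>)"
        by (rule integral_inner_left[symmetric]) (rule i1)
      also have "\<dots> = (\<integral>z. z \<partial>distr \<nu> borel (\<lambda>x. x \<bullet> w))"
        by (rule integral_distr[symmetric]) measurable
      finally have "(\<integral>x. x \<partial>\<nu>) \<bullet> w = (\<integral>z. z \<partial>distr \<nu> borel (\<lambda>x. x \<bullet> w))" .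
      then show ?thesis unfolding d integral_scaled_normal .
    qed
    then show ?thesis by (intro vector_eq_rdot[THEN iffD1]) simp
  qed
  have q: "(\<integral>x. (x \<bullet> w)\<^sup>2 \<partial>\<nu>) = Q w" for w
  proof -
    have "(\<integral>x. (x \<bullet> w)\<^sup>2 \<partial>\<nu>) = (\<integral>z. z\<^sup>2 \<partial>distr \<nu> borel (\<lambda>x. x \<bullet> w))"
      by (rule integral_distr[symmetric]) measurable
    then show ?thesis unfolding d integral_scaled_normal using Qnn by simp
  qed
  have ii: "integrable \<nu> (\<lambda>x. (x \<bullet> w)\<^sup>2)" for w
  proof (rule Bochner_Integration.integrable_bound)
    show "integrable \<nu> (\<lambda>x. (norm w)\<^sup>2 * (norm x)\<^sup>2)" using i2 by simp
    show "AE x in \<nu>. norm ((x \<bullet> w)\<^sup>2) \<le> norm ((norm w)\<^sup>2 * (norm x)\<^sup>2)"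
    proof (rule AE_I2)
      fix x
      show "norm ((x \<bullet> w)\<^sup>2) \<le> norm ((norm w)\<^sup>2 * (norm x)\<^sup>2)"
        using power_mono[OF Cauchy_Schwarz_ineq2[of x w], of 2]
        by (simp add: power_mult_distrib mult.commute)
    qed
  qed measurable
  \<comment> \<open>The series construction fixes only the variance in each direction; polarization
    recovers the mixed moments, for \<open>\<nu>\<close> and for \<open>Z\<close> alike.\<close>
  have polar: "a * b = ((a + b)\<^sup>2 - (a - b)\<^sup>2) / 4" for a b :: real
    by (simp add: power2_eq_square algebra_simps)
  have iZ: "integrable M (\<lambda>\<omega>. (Z \<omega> \<bullet> w)\<^sup>2)" for w
    using integrable_inner_inner[OF M Z B, of w w] by (simp add: power2_eq_square)
  have bil: "(\<integral>x. (x \<bullet> w) * (x \<bullet> u) \<partial>\<nu>) = S w \<bullet> u" for w u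
  proof -
    have "(\<integral>x. (x \<bullet> w) * (x \<bullet> u) \<partial>\<nu>) = (\<integral>x. ((x \<bullet> (w + u))\<^sup>2 - (x \<bullet> (w - u))\<^sup>2) / 4 \<partial>\<nu>)"
      unfolding polar inner_add_right inner_diff_right ..
    also have "\<dots> = (Q (w + u) - Q (w - u)) / 4" using ii by (simp add: q)
    also have "\<dots> = (\<integral>\<omega>. ((Z \<omega> \<bullet> (w + u))\<^sup>2 - (Z \<omega> \<bullet> (w - u))\<^sup>2) / 4 \<partial>M)"
      using iZ by (simp add: Q_def)
    also have "\<dots> = S w \<bullet> u"
      unfolding S polar inner_add_right inner_diff_right ..
    finally show ?thesis .
  qed
  have it: "integrable \<nu> (\<lambda>x. (w \<bullet> x) *\<^sub>R x)" for w
  proof (rule Bochner_Integration.integrable_bound)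
    show "integrable \<nu> (\<lambda>x. norm w * (norm x)\<^sup>2)" using i2 by simp
    show "AE x in \<nu>. norm ((w \<bullet> x) *\<^sub>R x) \<le> norm (norm w * (norm x)\<^sup>2)"
    proof (rule AE_I2)
      fix x
      have "\<bar>w \<bullet> x\<bar> * norm x \<le> (norm w * norm x) * norm x"
        by (intro mult_right_mono Cauchy_Schwarz_ineq2) auto
      then show "norm ((w \<bullet> x) *\<^sub>R x) \<le> norm (norm w * (norm x)\<^sup>2)"
        by (simp add: power2_eq_square mult.assoc)
    qed
  qed measurable
  have cov: "cov_op \<nu> (\<lambda>x. x) (\<lambda>x. x) = S"
  proof
    fix w
    have "(\<integral>x. (w \<bullet> x) *\<^sub>R x \<partial>\<nu>) \<bullet> u = (\<integral>x. ((w \<bullet> x) *\<^sub>R x) \<bullet> u \<partial>\<nu>)" for u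
      by (rule integral_inner_left[symmetric]) (rule it)
    then have "(\<integral>x. (w \<bullet> x) *\<^sub>R x \<partial>\<nu>) \<bullet> u = S w \<bullet> u" for u
      unfolding bil[symmetric] by (simp add: inner_commute[of w])
    then have "(\<integral>x. (w \<bullet> x) *\<^sub>R x \<partial>\<nu>) = S w"
      by (intro vector_eq_rdot[THEN iffD1]) blast
    then show "cov_op \<nu> (\<lambda>x. x) (\<lambda>x. x) w = S w"
      unfolding cov_op_def tensor_def m by simp
  qed
  show thesis
  proof (rule that)
    show "gaussian_measure 0 S \<nu>"
      unfolding gaussian_measure_def using \<nu> s i2 m cov real_gaussian_scaled by (simp add: d)
    show "char (distr \<nu> borel (\<lambda>x. x \<bullet> w)) 1 = exp (- (\<integral>\<omega>. (Z \<omega> \<bullet> w)\<^sup>2 \<partial>M) / 2)" for w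
      unfolding d gaussian_char_scaled using Qnn by (simp add: Q_def)
  qed
qed

section \<open>Sums over independent families\<close>

text \<open>Fubini: with the other variables frozen at any value, the integral over the law of
  \<open>X p\<close> is already 0.\<close>

lemma (in prob_space) indep_vars_integral_separate:
  fixes X :: "'i \<Rightarrow> 'a \<Rightarrow> 'h::{second_countable_topology, real_normed_vector}"
    and F :: "'h \<Rightarrow> ('i \<Rightarrow> 'h) \<Rightarrow> real"
  assumes ind: "indep_vars (\<lambda>_. borel) X I" and p: "p \<in> I" "J \<subseteq> I" "p \<notin> J"
    and F[measurable]: "case_prod F \<in> borel_measurable (borel \<Otimes>\<^sub>M Pi\<^sub>M J (\<lambda>_. borel))"
    and B: "\<And>x y. \<bar>F x y\<bar> \<le> B"
    and zero: "\<And>y. (\<integral>x. F x y \<partial>distr M borel (X p)) = 0"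
  shows "(\<integral>\<omega>. F (X p \<omega>) (\<lambda>j\<in>J. X j \<omega>) \<partial>M) = 0"
proof -
  have [measurable]: "X j \<in> borel_measurable M" if "j \<in> I" for j
    using ind that unfolding indep_vars_def by auto
  \<comment> \<open>Independence of index blocks is a statement about restricted families, so
    \<open>X p\<close> is carried along as a family over the singleton \<open>{p}\<close>.\<close>
  define A Y where "A \<omega> = (\<lambda>j\<in>{p}. X j \<omega>)" and "Y \<omega> = (\<lambda>j\<in>J. X j \<omega>)" for \<omega>
  let ?Bp = "Pi\<^sub>M {p} (\<lambda>_. borel :: 'h measure)" and ?BJ = "Pi\<^sub>M J (\<lambda>_. borel :: 'h measure)"
  let ?DA = "distr M ?Bp A" and ?DY = "distr M ?BJ Y"
  have Xp[measurable]: "X p \<in> borel_measurable M" using p by simp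
  have A[measurable]: "A \<in> measurable M ?Bp"
    unfolding A_def using p by (intro measurable_restrict) auto
  have Y[measurable]: "Y \<in> measurable M ?BJ"
    unfolding Y_def using p by (intro measurable_restrict) auto
  have "indep_var ?Bp A ?BJ Y"
    unfolding A_def Y_def using p by (intro indep_var_restrict[OF ind]) auto
  then have joint: "?DA \<Otimes>\<^sub>M ?DY
      = distr M (?Bp \<Otimes>\<^sub>M ?BJ) (\<lambda>\<omega>. (A \<omega>, Y \<omega>))"
    unfolding indep_var_distribution_eq by simp
  have fm: "finite_measure (distr M (?Bp \<Otimes>\<^sub>M ?BJ) (\<lambda>\<omega>. (A \<omega>, Y \<omega>)))"
    by (intro prob_space.finite_measure[OF prob_space_distr]) measurable
  interpret A: prob_space "?DA" by (rule prob_space_distr) simp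
  interpret D: prob_space "?DY" by (rule prob_space_distr) simp
  interpret pair_prob_space "?DA" "?DY" ..
  have Fm: "(\<lambda>(f, y). F (f p) y) \<in> borel_measurable (?Bp \<Otimes>\<^sub>M ?BJ)"
  proof -
    have "(\<lambda>z. (fst z p, snd z)) \<in> measurable (?Bp \<Otimes>\<^sub>M ?BJ)
        (borel \<Otimes>\<^sub>M ?BJ)"
      by (intro measurable_Pair measurable_compose[OF measurable_fst measurable_component_singleton] measurable_snd)
        simp
    from measurable_compose[OF this F] show ?thesis by (simp add: case_prod_beta')
  qed
  have int: "integrable (?DA \<Otimes>\<^sub>M ?DY) (\<lambda>(f, y). F (f p) y)"
    unfolding joint
    using B Fm by (intro integrable_bounded_borel[OF fm, where B=B]) auto
  have in0: "(\<integral>f. F (f p) y \<partial>?DA) = 0" if y: "y \<in> space ?BJ" for y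
  proof -
    have Fy: "(\<lambda>x. F x y) \<in> borel_measurable borel"
      using measurable_compose[OF measurable_Pair2'[OF y] F] by simp
    have "(\<integral>f. F (f p) y \<partial>?DA) = (\<integral>\<omega>. F (A \<omega> p) y \<partial>M)"
      by (rule integral_distr) (auto intro: measurable_compose[OF _ Fy])
    also have "\<dots> = (\<integral>x. F x y \<partial>distr M borel (X p))"
      unfolding A_def by (subst integral_distr) (auto intro: Fy)
    finally show ?thesis unfolding zero .
  qed
  have "(\<integral>\<omega>. F (X p \<omega>) (Y \<omega>) \<partial>M)
      = (\<integral>z. (\<lambda>(f, y). F (f p) y) z \<partial>distr M (?Bp \<Otimes>\<^sub>M ?BJ) (\<lambda>\<omega>. (A \<omega>, Y \<omega>)))"
    using Fm by (subst integral_distr[OF measurable_Pair[OF A Y]]) (simp_all add: A_def)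
  also have "\<dots> = (\<integral>y. (\<integral>f. F (f p) y \<partial>?DA) \<partial>?DY)"
    unfolding joint[symmetric] by (rule integral_snd[symmetric]) (rule int)
  also have "\<dots> = (\<integral>y. 0 \<partial>?DY)"
    using in0 by (intro Bochner_Integration.integral_cong) auto
  finally show ?thesis unfolding Y_def by simp
qed

lemma borel_measurable_case_prod_compose:
  assumes "case_prod g \<in> measurable (A \<Otimes>\<^sub>M B) L" "f \<in> measurable N A" "h \<in> measurable N B"
  shows "(\<lambda>x. g (f x) (h x)) \<in> measurable N L"
  using measurable_compose[OF measurable_Pair[OF assms(2,3)] assms(1)] by simp

section \<open>Second moments of sums and of degenerate double sums\<close>

locale indep_family = prob_space M for M :: "'w measure" +
  fixes X :: "'i \<Rightarrow> 'w \<Rightarrow> 'h::{second_countable_topology, real_normed_vector}" and I :: "'i set"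
  assumes ind: "indep_vars (\<lambda>_. borel) X I" and fin: "finite I"
begin

abbreviation law :: "'i \<Rightarrow> 'h measure" where "law p \<equiv> distr M borel (X p)"

lemma X_measurable[measurable]: "p \<in> I \<Longrightarrow> X p \<in> borel_measurable M"
  using ind unfolding indep_vars_def by auto

lemma integrable_comp_bounded:
  fixes b :: "'h \<Rightarrow> 'b::{banach, second_countable_topology}"
  assumes [measurable]: "b \<in> borel_measurable borel" and "\<And>x. norm (b x) \<le> B" and "p \<in> I"
  shows "integrable M (\<lambda>\<omega>. b (X p \<omega>))" "integrable (law p) b"
proof -
  show "integrable M (\<lambda>\<omega>. b (X p \<omega>))"
    using assms(2,3) by (intro integrable_bounded[where B=B]) auto
  then show "integrable (law p) b" using assms(3) by (subst integrable_distr_eq) auto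
qed

text \<open>Orthogonality whenever one index occurs in a single place and its argument integrates to
  0. The other three indices may coincide, which is why they are collected in a set.\<close>

lemma integral_inner_separate:
  fixes f h :: "'h \<Rightarrow> 'h \<Rightarrow> 'b::{real_inner, banach, second_countable_topology}"
  assumes fm: "case_prod f \<in> borel_measurable (borel \<Otimes>\<^sub>M borel)"
    and hm: "case_prod h \<in> borel_measurable (borel \<Otimes>\<^sub>M borel)"
    and B: "\<And>x y. norm (f x y) \<le> B" "\<And>x y. norm (h x y) \<le> B"
    and zero: "\<And>y. (\<integral>x. f x y \<partial>law p) = 0"
    and I: "p \<in> I" "q \<in> I" "p' \<in> I" "q' \<in> I" and p: "p \<notin> {q, p', q'}"
  shows "(\<integral>\<omega>. f (X p \<omega>) (X q \<omega>) \<bullet> h (X p' \<omega>) (X q' \<omega>) \<partial>M) = 0"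
proof -
  define K where "K = {q, p', q'}"
  have m: "(\<lambda>z. snd z k) \<in> borel_measurable (borel \<Otimes>\<^sub>M Pi\<^sub>M K (\<lambda>_. borel))" if "k \<in> K" for k
    using that by measurable
  have "(\<integral>\<omega>. (\<lambda>x y. f x (y q) \<bullet> h (y p') (y q')) (X p \<omega>) (\<lambda>j\<in>K. X j \<omega>) \<partial>M) = 0"
  proof (rule indep_vars_integral_separate[OF ind, where B="B * B"])
    show "(\<lambda>(x, y). f x (y q) \<bullet> h (y p') (y q')) \<in> borel_measurable (borel \<Otimes>\<^sub>M Pi\<^sub>M K (\<lambda>_. borel))"
      unfolding case_prod_beta
      by (intro borel_measurable_inner borel_measurable_case_prod_compose[OF fm]
          borel_measurable_case_prod_compose[OF hm] measurable_fst m) (auto simp: K_def)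
    have "(\<lambda>x. f x y) \<in> borel_measurable borel" for y
      by (rule borel_measurable_case_prod_compose[OF fm]) simp_all
    then have "integrable (law p) (\<lambda>x. f x y)" for y
      by (rule integrable_comp_bounded(2)) (use B(1) I(1) in blast)+
    then show "(\<integral>x. f x (y q) \<bullet> h (y p') (y q') \<partial>law p) = 0" for y
      using zero by simp
  qed (use p I in \<open>auto simp: K_def intro: norm_inner_le B\<close>)
  then show ?thesis by (simp add: K_def)
qed

text \<open>Centring of \<open>b\<close> settles the off-diagonal terms, since there the index
  \<open>p\<close> occurs only in \<open>b p\<close>. Two families are allowed so that mixed moments
  in two directions are covered along with variances.\<close>

lemma covariance_sum:
  fixes b c :: "'i \<Rightarrow> 'h \<Rightarrow> 'b::{real_inner, banach, second_countable_topology}"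
  assumes bm[measurable]: "\<And>p. b p \<in> borel_measurable borel" and cm[measurable]: "\<And>p. c p \<in> borel_measurable borel"
    and B: "\<And>p x. norm (b p x) \<le> B" "\<And>p x. norm (c p x) \<le> B"
    and zero: "\<And>p. p \<in> I \<Longrightarrow> (\<integral>x. b p x \<partial>law p) = 0"
  shows "integrable M (\<lambda>\<omega>. (\<Sum>p\<in>I. b p (X p \<omega>)) \<bullet> (\<Sum>p\<in>I. c p (X p \<omega>)))"
    "(\<integral>\<omega>. (\<Sum>p\<in>I. b p (X p \<omega>)) \<bullet> (\<Sum>p\<in>I. c p (X p \<omega>)) \<partial>M) = (\<Sum>p\<in>I. \<integral>\<omega>. b p (X p \<omega>) \<bullet> c p (X p \<omega>) \<partial>M)"
proof -
  have x: "(\<Sum>p\<in>I. b p (X p \<omega>)) \<bullet> (\<Sum>p\<in>I. c p (X p \<omega>)) = (\<Sum>p\<in>I. \<Sum>q\<in>I. b p (X p \<omega>) \<bullet> c q (X q \<omega>))" for \<omega>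
    by (simp add: inner_sum_left inner_sum_right) (rule sum.swap)
  have i: "integrable M (\<lambda>\<omega>. b p (X p \<omega>) \<bullet> c q (X q \<omega>))" if "p \<in> I" "q \<in> I" for p q
    using that by (intro integrable_bounded[where B="B * B"])
      (auto intro: norm_inner_le B)
  show "integrable M (\<lambda>\<omega>. (\<Sum>p\<in>I. b p (X p \<omega>)) \<bullet> (\<Sum>p\<in>I. c p (X p \<omega>)))"
    unfolding x using i by auto
  have e: "(\<integral>\<omega>. b p (X p \<omega>) \<bullet> c q (X q \<omega>) \<partial>M)
      = (if p = q then \<integral>\<omega>. b p (X p \<omega>) \<bullet> c p (X p \<omega>) \<partial>M else 0)" if "p \<in> I" "q \<in> I" for p q
  proof (cases "p = q")
    case False
    \<comment> \<open>The second arguments are dummies that bring one-argument functions into the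
      form of \<open>integral_inner_separate\<close>.\<close>
    have "(\<integral>\<omega>. (\<lambda>x y. b p x) (X p \<omega>) (X q \<omega>) \<bullet> (\<lambda>x y. c q x) (X q \<omega>) (X q \<omega>) \<partial>M) = 0"
      by (rule integral_inner_separate[where B=B]) (use that False B zero in auto)
    then show ?thesis using False by simp
  qed simp
  have "(\<integral>\<omega>. (\<Sum>p\<in>I. b p (X p \<omega>)) \<bullet> (\<Sum>p\<in>I. c p (X p \<omega>)) \<partial>M)
      = (\<Sum>p\<in>I. \<Sum>q\<in>I. \<integral>\<omega>. b p (X p \<omega>) \<bullet> c q (X q \<omega>) \<partial>M)"
    unfolding x using i by (simp add: Bochner_Integration.integral_sum)
  also have "\<dots> = (\<Sum>p\<in>I. \<Sum>q\<in>I. if p = q then \<integral>\<omega>. b p (X p \<omega>) \<bullet> c p (X p \<omega>) \<partial>M else 0)"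
    using e by (intro sum.cong refl) auto
  finally show "(\<integral>\<omega>. (\<Sum>p\<in>I. b p (X p \<omega>)) \<bullet> (\<Sum>p\<in>I. c p (X p \<omega>)) \<partial>M) = (\<Sum>p\<in>I. \<integral>\<omega>. b p (X p \<omega>) \<bullet> c p (X p \<omega>) \<partial>M)"
    using fin by simp
qed

lemma variance_sum_le:
  fixes b :: "'i \<Rightarrow> 'h \<Rightarrow> 'b::{real_inner, banach, second_countable_topology}" and V :: real
  assumes bm: "\<And>p. b p \<in> borel_measurable borel" and B: "\<And>p x. norm (b p x) \<le> B"
    and zero: "\<And>p. p \<in> I \<Longrightarrow> (\<integral>x. b p x \<partial>law p) = 0"
    and V: "\<And>p. p \<in> I \<Longrightarrow> (\<integral>x. (norm (b p x))\<^sup>2 \<partial>law p) \<le> V"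
  shows "integrable M (\<lambda>\<omega>. (norm (\<Sum>p\<in>I. b p (X p \<omega>)))\<^sup>2)"
    "(\<integral>\<omega>. (norm (\<Sum>p\<in>I. b p (X p \<omega>)))\<^sup>2 \<partial>M) \<le> real (card I) * V"
proof -
  show "integrable M (\<lambda>\<omega>. (norm (\<Sum>p\<in>I. b p (X p \<omega>)))\<^sup>2)"
    unfolding power2_norm_eq_inner by (rule covariance_sum(1)[OF bm bm B B zero])
  have "(\<integral>\<omega>. b p (X p \<omega>) \<bullet> b p (X p \<omega>) \<partial>M) \<le> V" if "p \<in> I" for p
    using V[OF that] bm that by (subst (asm) integral_distr) (auto simp: power2_norm_eq_inner)
  then have "(\<Sum>p\<in>I. \<integral>\<omega>. b p (X p \<omega>) \<bullet> b p (X p \<omega>) \<partial>M) \<le> of_nat (card I) * V"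
    by (rule sum_bounded_above)
  moreover have "(\<integral>\<omega>. (\<Sum>p\<in>I. b p (X p \<omega>)) \<bullet> (\<Sum>p\<in>I. b p (X p \<omega>)) \<partial>M) = (\<Sum>p\<in>I. \<integral>\<omega>. b p (X p \<omega>) \<bullet> b p (X p \<omega>) \<partial>M)"
    by (rule covariance_sum(2)[OF bm bm B B zero])
  ultimately show "(\<integral>\<omega>. (norm (\<Sum>p\<in>I. b p (X p \<omega>)))\<^sup>2 \<partial>M) \<le> real (card I) * V"
    unfolding power2_norm_eq_inner by simp
qed

text \<open>When the squared norm is expanded over pairs of index pairs, a term can survive
  integration only if the second pair equals the first or its reversal. So each of the
  \<open>card J * card I\<close> pairs has at most two partners, and each partner contributes at
  most \<open>B\<^sup>2\<close>.\<close>

lemma degenerate_U_statistic_bound: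
  fixes d :: "'i \<Rightarrow> 'i \<Rightarrow> 'h \<Rightarrow> 'h \<Rightarrow> 'b::{real_inner, banach, second_countable_topology}"
  assumes dm[measurable]: "\<And>p q. case_prod (d p q) \<in> borel_measurable (borel \<Otimes>\<^sub>M borel)"
    and B: "\<And>p q x y. norm (d p q x y) \<le> B"
    and zero1: "\<And>p q y. p \<in> I \<Longrightarrow> q \<in> I \<Longrightarrow> (\<integral>x. d p q x y \<partial>law p) = 0"
    and zero2: "\<And>p q x. p \<in> I \<Longrightarrow> q \<in> I \<Longrightarrow> (\<integral>y. d p q x y \<partial>law q) = 0"
    and diag: "\<And>p x. d p p x x = 0" and J: "J \<subseteq> I"
  defines "U \<equiv> \<lambda>\<omega>. \<Sum>(p, q)\<in>J \<times> I. d p q (X p \<omega>) (X q \<omega>)"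
  shows "integrable M (\<lambda>\<omega>. (norm (U \<omega>))\<^sup>2)"
    "(\<integral>\<omega>. (norm (U \<omega>))\<^sup>2 \<partial>M) \<le> 2 * B\<^sup>2 * card J * card I"
proof -
  define D where "D r \<omega> = d (fst r) (snd r) (X (fst r) \<omega>) (X (snd r) \<omega>)" for r \<omega>
  have DJ: "U \<omega> = (\<Sum>r\<in>J \<times> I. D r \<omega>)" for \<omega>
    by (simp add: U_def D_def case_prod_beta)
  have x: "(norm (\<Sum>r\<in>J \<times> I. D r \<omega>))\<^sup>2 = (\<Sum>r\<in>J \<times> I. \<Sum>s\<in>J \<times> I. D r \<omega> \<bullet> D s \<omega>)" for \<omega>
    by (simp add: power2_norm_eq_inner inner_sum_left inner_sum_right) (rule sum.swap)
  note dm2 = borel_measurable_case_prod_compose[OF dm]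
  have DM: "D r \<in> borel_measurable M" if "r \<in> I \<times> I" for r
    unfolding D_def[abs_def] using that by (intro dm2 X_measurable) auto
  have DB: "\<bar>D r \<omega> \<bullet> D s \<omega>\<bar> \<le> B * B" for r s \<omega>
    unfolding D_def by (intro norm_inner_le B)
  have i: "integrable M (\<lambda>\<omega>. D r \<omega> \<bullet> D s \<omega>)" if "r \<in> I \<times> I" "s \<in> I \<times> I" for r s
    using DM[OF that(1)] DM[OF that(2)] DB
    by (intro integrable_bounded[where B="B * B"]) auto
  show "integrable M (\<lambda>\<omega>. (norm (U \<omega>))\<^sup>2)"
    unfolding DJ x using i J by (intro Bochner_Integration.integrable_sum) blast
  have e: "(\<integral>\<omega>. D r \<omega> \<bullet> D s \<omega> \<partial>M) \<le> (if s = r then B\<^sup>2 else 0) + (if s = prod.swap r then B\<^sup>2 else 0)"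
    if rs: "r \<in> I \<times> I" "s \<in> I \<times> I" for r s
  proof -
    obtain p q p' q' where req: "r = (p, q)" and seq: "s = (p', q')" by (metis surj_pair)
    have I: "p \<in> I" "q \<in> I" "p' \<in> I" "q' \<in> I" using rs by (auto simp: req seq)
    have B2: "(\<integral>\<omega>. D r \<omega> \<bullet> D s \<omega> \<partial>M) \<le> B\<^sup>2"
    proof -
      have "(\<integral>\<omega>. D r \<omega> \<bullet> D s \<omega> \<partial>M) \<le> (\<integral>\<omega>. B * B \<partial>M)"
        using i[OF rs] DB[of r _ s] by (intro integral_mono) (auto simp: abs_le_iff)
      then show ?thesis by (simp add: prob_space power2_eq_square)
    qed
    define R where "R = (if s = r then B\<^sup>2 else 0) + (if s = prod.swap r then B\<^sup>2 else 0)"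
    have R: "0 \<le> R" "s = r \<Longrightarrow> B\<^sup>2 \<le> R" "s = prod.swap r \<Longrightarrow> B\<^sup>2 \<le> R"
      by (simp_all add: R_def)
    \<comment> \<open>Diagonal pairs contribute nothing by \<open>diag\<close>. If
      \<open>p \<noteq> q\<close>, \<open>p' \<noteq> q'\<close> and the two index sets differ, then
      \<open>p\<close> or \<open>q\<close> is missing from the second pair and can be integrated
      out.\<close>
    have "(p = q \<or> p' = q') \<or> (p' = p \<and> q' = q) \<or> (p' = q \<and> q' = p)
      \<or> (p \<noteq> q \<and> p \<noteq> p' \<and> p \<noteq> q') \<or> (p \<noteq> q \<and> q \<noteq> p' \<and> q \<noteq> q')"
      by blast
    then have "(\<integral>\<omega>. D r \<omega> \<bullet> D s \<omega> \<partial>M) \<le> R"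
    proof (elim disjE[of "p = q \<or> p' = q'"] disjE[of "p' = p \<and> q' = q"] disjE[of "p' = q \<and> q' = p"]
        disjE[of "p \<noteq> q \<and> p \<noteq> p' \<and> p \<noteq> q'"])
      assume "p = q \<or> p' = q'"
      then have "D r \<omega> \<bullet> D s \<omega> = 0" for \<omega> by (auto simp: D_def diag req seq)
      then show ?thesis using R(1) by (simp only: integral_zero)
    next
      assume "p' = p \<and> q' = q"
      then have "s = r" by (simp add: req seq)
      then show ?thesis using B2 R by simp
    next
      assume "p' = q \<and> q' = p"
      then have "s = prod.swap r" by (simp add: req seq)
      then show ?thesis using B2 R by simp
    next
      assume 4: "p \<noteq> q \<and> p \<noteq> p' \<and> p \<noteq> q'"
      then have "(\<integral>\<omega>. D r \<omega> \<bullet> D s \<omega> \<partial>M) = 0"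
        unfolding D_def req seq fst_conv snd_conv using I B
        by (intro integral_inner_separate[OF dm dm _ _ zero1]) auto
      then show ?thesis using R(1) by (simp only:)
    next
      assume 5: "p \<noteq> q \<and> q \<noteq> p' \<and> q \<noteq> q'"
      \<comment> \<open>The arguments are exchanged, because the separated index has to come
        first.\<close>
      then have "(\<integral>\<omega>. (\<lambda>x y. d p q y x) (X q \<omega>) (X p \<omega>) \<bullet> d p' q' (X p' \<omega>) (X q' \<omega>) \<partial>M) = 0"
        using I B zero2 borel_measurable_case_prod_compose[OF dm measurable_snd measurable_fst, of p q]
        by (intro integral_inner_separate[OF _ dm]) (auto simp: case_prod_beta')
      then have "(\<integral>\<omega>. D r \<omega> \<bullet> D s \<omega> \<partial>M) = 0" by (simp add: D_def req seq)
      then show ?thesis using R(1) by (simp only:)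
    qed
    then show ?thesis unfolding R_def .
  qed
  have fJ: "finite (J \<times> I)" using fin J finite_subset by blast
  have "(\<integral>\<omega>. (norm (U \<omega>))\<^sup>2 \<partial>M)
      = (\<Sum>r\<in>J \<times> I. \<Sum>s\<in>J \<times> I. \<integral>\<omega>. D r \<omega> \<bullet> D s \<omega> \<partial>M)"
  proof -
    have ir: "integrable M (\<lambda>\<omega>. D r \<omega> \<bullet> D s \<omega>)" if "r \<in> J \<times> I" "s \<in> J \<times> I" for r s
      by (rule i) (use that J in \<open>blast+\<close>)
    have "(\<integral>\<omega>. (\<Sum>r\<in>J \<times> I. \<Sum>s\<in>J \<times> I. D r \<omega> \<bullet> D s \<omega>) \<partial>M)
        = (\<Sum>r\<in>J \<times> I. \<integral>\<omega>. (\<Sum>s\<in>J \<times> I. D r \<omega> \<bullet> D s \<omega>) \<partial>M)"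
      by (intro Bochner_Integration.integral_sum Bochner_Integration.integrable_sum ir)
    also have "\<dots> = (\<Sum>r\<in>J \<times> I. \<Sum>s\<in>J \<times> I. \<integral>\<omega>. D r \<omega> \<bullet> D s \<omega> \<partial>M)"
      by (intro sum.cong refl Bochner_Integration.integral_sum ir)
    finally show ?thesis unfolding DJ x .
  qed
  also have "\<dots> \<le> (\<Sum>r\<in>J \<times> I. \<Sum>s\<in>J \<times> I. (if s = r then B\<^sup>2 else 0) + (if s = prod.swap r then B\<^sup>2 else 0))"
  proof (rule sum_mono, rule sum_mono)
    fix r s assume "r \<in> J \<times> I" "s \<in> J \<times> I"
    then have "r \<in> I \<times> I" "s \<in> I \<times> I" using J by blast+
    then show "(\<integral>\<omega>. D r \<omega> \<bullet> D s \<omega> \<partial>M) \<le> (if s = r then B\<^sup>2 else 0) + (if s = prod.swap r then B\<^sup>2 else 0)"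
      by (rule e)
  qed
  also have "\<dots> \<le> (\<Sum>r\<in>J \<times> I. 2 * B\<^sup>2)"
  proof (rule sum_mono)
    fix r
    have "(\<Sum>s\<in>J \<times> I. if s = t then B\<^sup>2 else 0) \<le> B\<^sup>2" for t
      using fJ by simp
    from add_mono[OF this this, of r "prod.swap r"]
    show "(\<Sum>s\<in>J \<times> I. (if s = r then B\<^sup>2 else 0) + (if s = prod.swap r then B\<^sup>2 else 0)) \<le> 2 * B\<^sup>2"
      unfolding sum.distrib by (simp only: mult_2)
  qed
  also have "\<dots> = 2 * B\<^sup>2 * card J * card I"
    by (simp add: card_cartesian_product)
  finally show "(\<integral>\<omega>. (norm (U \<omega>))\<^sup>2 \<partial>M) \<le> 2 * B\<^sup>2 * card J * card I" .
qed

end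

section \<open>Lyapunov estimate for characteristic functions\<close>

lemma exp_minus_approx:
  assumes "(x::real) \<ge> 0"
  shows "\<bar>exp (- x) - (1 - x)\<bar> \<le> x\<^sup>2"
proof -
  have "exp (- x) \<le> 1 / (1 + x)"
    using exp_ge_add_one_self[of x] assms by (simp add: exp_minus divide_simps)
  also have "\<dots> \<le> 1 - x + x\<^sup>2"
  proof -
    have "1 \<le> (1 - x + x\<^sup>2) * (1 + x)"
      using zero_le_power[OF assms, of 3] by (simp add: power2_eq_square power3_eq_cube algebra_simps)
    then show ?thesis using assms by (simp add: divide_le_eq)
  qed
  finally show ?thesis using exp_ge_add_one_self[of "-x"] by (auto simp: abs_le_iff)
qed

text \<open>Both sides are compared with \<open>1 - s / 2\<close>, where \<open>s\<close> is the
  variance: the Taylor bound for the characteristic function gives \<open>c^3 / 6\<close>, the one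
  for the exponential gives \<open>(s / 2)\<^sup>2 \<le> c^4 / 4\<close>.\<close>

lemma (in prob_space) char_approx_bounded:
  assumes Y[measurable]: "Y \<in> borel_measurable M" and c: "\<And>\<omega>. \<bar>Y \<omega>\<bar> \<le> c" and zero: "expectation Y = 0"
  shows "cmod (char (distr M borel Y) 1 - exp (- (expectation (\<lambda>\<omega>. (Y \<omega>)\<^sup>2)) / 2)) \<le> c^3 / 6 + c^4 / 4"
proof -
  have c0: "c \<ge> 0" using c[of undefined] by linarith
  define s where "s = expectation (\<lambda>\<omega>. (Y \<omega>)\<^sup>2)"
  have sq: "(Y \<omega>)\<^sup>2 \<le> c\<^sup>2" for \<omega>
    using c[of \<omega>] c0 by (intro abs_le_square_iff[THEN iffD1]) auto
  have "integrable M Y"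
    using c by (intro integrable_bounded[where B=c]) auto
  moreover have "integrable M (\<lambda>\<omega>. (Y \<omega>)\<^sup>2)"
    using sq by (intro integrable_bounded[where B="c\<^sup>2"]) auto
  ultimately have i: "integrable M Y" "integrable M (\<lambda>\<omega>. (Y \<omega>)\<^sup>2)" .
  have s: "0 \<le> s" "s \<le> c\<^sup>2"
  proof -
    show "0 \<le> s" unfolding s_def by simp
    have "s \<le> expectation (\<lambda>\<omega>. c\<^sup>2)"
      unfolding s_def using i(2)
by (rule integral_mono) (simp_all add: sq)
    then show "s \<le> c\<^sup>2" by (simp add: prob_space)
  qed
  have "cmod (char (distr M borel Y) 1 - (1 - 1\<^sup>2 * s / 2))
      \<le> (1\<^sup>2 / 6) * expectation (\<lambda>x. min (6 * (Y x)\<^sup>2) (\<bar>1\<bar> * \<bar>Y x\<bar> ^ 3))"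
    using char_approx3'[of Y s "distr M borel Y" 1] i zero by (simp add: s_def)
  also have "\<dots> \<le> (1\<^sup>2 / 6) * expectation (\<lambda>x. c ^ 3)"
  proof (intro mult_left_mono integral_mono)
    show "integrable M (\<lambda>x. min (6 * (Y x)\<^sup>2) (\<bar>1\<bar> * \<bar>Y x\<bar> ^ 3))"
    proof (rule integrable_bounded[where B="c^3"])
      show "norm (min (6 * (Y x)\<^sup>2) (\<bar>1\<bar> * \<bar>Y x\<bar> ^ 3)) \<le> c ^ 3" for x
        using power_mono[OF c[of x], of 3] by (auto simp: min_def)
    qed measurable
    show "min (6 * (Y x)\<^sup>2) (\<bar>1\<bar> * \<bar>Y x\<bar> ^ 3) \<le> c ^ 3" for x
      using power_mono[OF c[of x], of 3] by auto
  qed auto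
  finally have 1: "cmod (char (distr M borel Y) 1 - (1 - s / 2)) \<le> c^3 / 6"
    by (simp add: prob_space)
  have "\<bar>exp (- (s / 2)) - (1 - s / 2)\<bar> \<le> (s / 2)\<^sup>2"
    using s by (intro exp_minus_approx) simp
  also have "\<dots> \<le> (c\<^sup>2 / 2)\<^sup>2" using s by (intro power_mono) auto
  also have "\<dots> = c^4 / 4" by (simp add: power_divide)
  finally have 2: "cmod ((1 - s / 2) - exp (- s / 2)) \<le> c^4 / 4"
    by (metis (no_types, lifting) abs_minus_commute norm_of_real of_real_diff of_real_1 minus_divide_left)
  show ?thesis
    using norm_triangle_mono[OF 1 2] by (simp add: s_def)
qed

text \<open>For factors of absolute value at most 1, two products differ by at most the sum of the
  differences of their factors. With \<open>n\<close> summands and \<open>c\<close> of order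
  \<open>1 / sqrt n\<close> the bound is again of order \<open>1 / sqrt n\<close>.\<close>

lemma (in indep_family) char_sum_approx:
  fixes b :: "'i \<Rightarrow> 'h \<Rightarrow> real"
  assumes bm[measurable]: "\<And>p. b p \<in> borel_measurable borel" and c: "\<And>p x. \<bar>b p x\<bar> \<le> c"
    and zero: "\<And>p. p \<in> I \<Longrightarrow> (\<integral>x. b p x \<partial>law p) = 0"
  shows "cmod (char (distr M borel (\<lambda>\<omega>. \<Sum>p\<in>I. b p (X p \<omega>))) 1
      - exp (- (\<Sum>p\<in>I. \<integral>x. (b p x)\<^sup>2 \<partial>law p) / 2)) \<le> card I * (c^3 / 6 + c^4 / 4)"
proof -
  have "indep_vars (\<lambda>_. borel) (\<lambda>p \<omega>. b p (X p \<omega>)) I"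
    by (rule indep_vars_compose2[OF ind]) simp
  note ch = char_distr_sum[OF this, of 1]
  have ex: "complex_of_real (exp (- (\<Sum>p\<in>I. \<integral>x. (b p x)\<^sup>2 \<partial>law p) / 2))
      = (\<Prod>p\<in>I. complex_of_real (exp (- (\<integral>x. (b p x)\<^sup>2 \<partial>law p) / 2)))"
  proof -
    have "- (\<Sum>p\<in>I. \<integral>x. (b p x)\<^sup>2 \<partial>law p) / 2 = (\<Sum>p\<in>I. - (\<integral>x. (b p x)\<^sup>2 \<partial>law p) / 2)"
      by (simp add: sum_negf sum_divide_distrib)
    then show ?thesis using fin by (simp only: exp_sum of_real_prod)
  qed
  have one: "cmod (char (distr M borel (\<lambda>\<omega>. b p (X p \<omega>))) 1 - complex_of_real (exp (- (\<integral>x. (b p x)\<^sup>2 \<partial>law p) / 2)))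
      \<le> c^3 / 6 + c^4 / 4" if p: "p \<in> I" for p
  proof -
    have e: "(\<integral>x. (b p x)\<^sup>2 \<partial>law p) = expectation (\<lambda>\<omega>. (b p (X p \<omega>))\<^sup>2)"
      "expectation (\<lambda>\<omega>. b p (X p \<omega>)) = 0"
      using p zero[OF p] by (simp_all add: integral_distr)
    show ?thesis unfolding e(1) using p c e(2) by (intro char_approx_bounded) auto
  qed
  have "cmod (char (distr M borel (\<lambda>\<omega>. \<Sum>p\<in>I. b p (X p \<omega>))) 1
      - exp (- (\<Sum>p\<in>I. \<integral>x. (b p x)\<^sup>2 \<partial>law p) / 2))
    \<le> (\<Sum>p\<in>I. cmod (char (distr M borel (\<lambda>\<omega>. b p (X p \<omega>))) 1 - complex_of_real (exp (- (\<integral>x. (b p x)\<^sup>2 \<partial>law p) / 2))))"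
    unfolding ch ex
  proof (rule norm_prod_diff)
    fix p assume p: "p \<in> I"
    interpret rd: real_distribution "distr M borel (\<lambda>\<omega>. b p (X p \<omega>))"
      using p by (intro real_distribution_distr) simp
    show "cmod (char (distr M borel (\<lambda>\<omega>. b p (X p \<omega>))) 1) \<le> 1" by (rule rd.cmod_char_le_1)
    show "cmod (complex_of_real (exp (- (\<integral>x. (b p x)\<^sup>2 \<partial>law p) / 2))) \<le> 1"
      by simp
  qed
  also have "\<dots> \<le> of_nat (card I) * (c^3 / 6 + c^4 / 4)"
    by (rule sum_bounded_above) (rule one)
  finally show ?thesis by simp
qed

text \<open>Provides the compact sets for tightness: \<open>V\<close> will be the finite set of
  values of the approximating simple functions. Induction adds one segment at a time, as sums of
  compact sets are compact.\<close>

lemma compact_bounded_combinations: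
  fixes V :: "'b::real_normed_vector set"
  assumes "finite V"
  obtains K where "compact K" "\<And>c. (\<And>v. v \<in> V \<Longrightarrow> \<bar>c v\<bar> \<le> R) \<Longrightarrow> (\<Sum>v\<in>V. c v *\<^sub>R v) \<in> K"
proof -
  from assms have "\<exists>K. compact K \<and> (\<forall>c. (\<forall>v\<in>V. \<bar>c v\<bar> \<le> R) \<longrightarrow> (\<Sum>v\<in>V. c v *\<^sub>R v) \<in> K)"
  proof induction
    case (insert u V)
    then obtain K where K: "compact K" "\<And>c. \<forall>v\<in>V. \<bar>c v\<bar> \<le> R \<Longrightarrow> (\<Sum>v\<in>V. c v *\<^sub>R v) \<in> K" by blast
    define L where "L = {x + y | x y. x \<in> (\<lambda>t. t *\<^sub>R u) ` {-R..R} \<and> y \<in> K}"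
    have "compact L"
      unfolding L_def by (intro compact_sums K compact_continuous_image continuous_intros) auto
    moreover have "(\<Sum>v\<in>insert u V. c v *\<^sub>R v) \<in> L" if c: "\<forall>v\<in>insert u V. \<bar>c v\<bar> \<le> R" for c
    proof -
      have "c u *\<^sub>R u \<in> (\<lambda>t. t *\<^sub>R u) ` {-R..R}" using c by (auto simp: abs_le_iff)
      moreover have "(\<Sum>v\<in>V. c v *\<^sub>R v) \<in> K" using K(2) c by simp
      ultimately show ?thesis unfolding L_def using insert.hyps by auto
    qed
    ultimately show ?case by blast
  qed auto
  then show thesis using that by blast
qed

lemma (in prob_space) centered_second_moment_le:
  fixes f :: "'a \<Rightarrow> 'b::{real_inner, banach, second_countable_topology}"
  assumes [measurable]: "f \<in> borel_measurable M" and B: "\<And>x. norm (f x) \<le> B"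
  shows "(\<integral>x. (norm (f x - expectation f))\<^sup>2 \<partial>M) \<le> (\<integral>x. (norm (f x))\<^sup>2 \<partial>M)"
proof -
  define m where "m = expectation f"
  have i: "integrable M f" 
    by (rule integrable_bounded[OF _ B]) simp
  have i2: "integrable M (\<lambda>x. (norm (f x))\<^sup>2)"
    using B by (intro integrable_bounded[where B="B\<^sup>2"]) (auto intro: power_mono)
  have "(\<integral>x. (norm (f x - m))\<^sup>2 \<partial>M) = (\<integral>x. (norm (f x))\<^sup>2 - 2 * (f x \<bullet> m) + m \<bullet> m \<partial>M)"
    by (intro Bochner_Integration.integral_cong)
      (auto simp: power2_norm_eq_inner inner_diff_left inner_diff_right inner_commute)
  also have "\<dots> = (\<integral>x. (norm (f x))\<^sup>2 \<partial>M) - 2 * (m \<bullet> m) + m \<bullet> m"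
    using i i2 by (simp add: prob_space m_def)
  also have "\<dots> \<le> (\<integral>x. (norm (f x))\<^sup>2 \<partial>M)" by simp
  finally show ?thesis unfolding m_def .
qed

section \<open>Linear statistics of several samples\<close>

locale k_sample = prob_space M for M :: "'w measure" +
  fixes P :: "'k::finite \<Rightarrow> 'h::{real_inner, banach, second_countable_topology} measure"
    and X :: "'k \<Rightarrow> nat \<Rightarrow> 'w \<Rightarrow> 'h" and N :: "nat \<Rightarrow> 'k \<Rightarrow> nat" and lam :: "'k \<Rightarrow> real"
  assumes P: "\<And>k. prob_space (P k)" and sets_P[measurable_cong]: "\<And>k. sets (P k) = sets borel"
    and indep: "\<And>n. indep_vars (\<lambda>_. borel) (\<lambda>(k, i). X k i) (SIGMA k:UNIV. {1..N n k})"
    and law_X: "\<And>n k i. i \<in> {1..N n k} \<Longrightarrow> distr M borel (X k i) = P k"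
    and sum_N: "\<And>n. (\<Sum>k\<in>UNIV. N n k) = n"
    and lam_pos: "\<And>k. 0 < lam k"
    and lam_lim: "\<And>k. (\<lambda>n. real (N n k) / real n) \<longlonglongrightarrow> lam k"
begin

definition idx :: "nat \<Rightarrow> ('k \<times> nat) set" where "idx n = (SIGMA k:UNIV. {1..N n k})"

abbreviation XX :: "'k \<times> nat \<Rightarrow> 'w \<Rightarrow> 'h" where "XX \<equiv> \<lambda>(k, i). X k i"

lemma family: "indep_family M XX (idx n)"
  unfolding idx_def by unfold_locales (use indep in auto)

lemma XX_measurable: "p \<in> idx n \<Longrightarrow> XX p \<in> borel_measurable M"
  by (rule indep_family.X_measurable[OF family])

lemma law_XX: "p \<in> idx n \<Longrightarrow> distr M borel (XX p) = P (fst p)"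
  unfolding idx_def using law_X by auto

lemma sum_idx:
  fixes f :: "'k \<Rightarrow> 'b::real_vector"
  shows "(\<Sum>p\<in>idx n. f (fst p)) = (\<Sum>k\<in>UNIV. real (N n k) *\<^sub>R f k)"
proof -
  have "(\<Sum>p\<in>idx n. f (fst p)) = (\<Sum>(k, i)\<in>idx n. f k)" by (intro sum.cong) auto
  also have "\<dots> = (\<Sum>k\<in>UNIV. \<Sum>i\<in>{1..N n k}. f k)"
    unfolding idx_def by (rule sum.Sigma[symmetric]) auto
  finally show ?thesis by (simp add: sum_constant_scaleR)
qed

lemma card_idx: "card (idx n) = n"
  unfolding idx_def by (subst card_SigmaI) (auto simp: sum_N)

lemma space_P[simp]: "space (P k) = UNIV"
  using sets_eq_imp_space_eq[OF sets_P[of k]] by simp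

lemma prob_P_UNIV[simp]: "measure (P k) UNIV = 1"
  using prob_space.prob_space[OF P, of k] by simp

lemma integrable_P:
  fixes f :: "'h \<Rightarrow> 'b::{banach, second_countable_topology}"
  assumes "f \<in> borel_measurable borel" "\<And>x. norm (f x) \<le> B"
  shows "integrable (P k) f"
  using assms by (intro integrable_bounded_borel[OF prob_space.finite_measure[OF P], where B=B])
    (auto cong: measurable_cong_sets)

lemma eventually_groups_nonempty: "\<forall>\<^sub>F n in sequentially. \<forall>k. N n k > 0"
proof (rule eventually_all_finite)
  fix k
  have "\<forall>\<^sub>F n in sequentially. real (N n k) / real n > 0"
    using order_tendstoD(1)[OF lam_lim lam_pos] .
  then show "\<forall>\<^sub>F n in sequentially. N n k > 0" by eventually_elim (simp add: zero_less_divide_iff)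
qed

definition linear_stat :: "('k \<Rightarrow> 'h \<Rightarrow> 'b::real_normed_vector) \<Rightarrow> nat \<Rightarrow> 'w \<Rightarrow> 'b" where
  "linear_stat \<zeta> n \<omega> = (\<Sum>p\<in>idx n. (1 / sqrt (real n)) *\<^sub>R \<zeta> (fst p) (XX p \<omega>))"

lemma linear_stat_measurable:
  fixes \<zeta> :: "'k \<Rightarrow> 'h \<Rightarrow> 'b::{real_normed_vector, second_countable_topology}"
  assumes "\<And>k. \<zeta> k \<in> borel_measurable borel"
  shows "linear_stat \<zeta> n \<in> borel_measurable M"
  unfolding linear_stat_def[abs_def]
  using measurable_compose[OF XX_measurable assms] by (intro borel_measurable_sum borel_measurable_scaleR) auto

lemma linear_stat_second_moment:
  fixes \<zeta> :: "'k \<Rightarrow> 'h \<Rightarrow> 'b::{real_inner, banach, second_countable_topology}"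
  assumes \<zeta>m[measurable]: "\<And>k. \<zeta> k \<in> borel_measurable borel" and B: "\<And>k x. norm (\<zeta> k x) \<le> B"
    and zero: "\<And>k. (\<integral>x. \<zeta> k x \<partial>P k) = 0" and V: "\<And>k. (\<integral>x. (norm (\<zeta> k x))\<^sup>2 \<partial>P k) \<le> V"
  shows "integrable M (\<lambda>\<omega>. (norm (linear_stat \<zeta> n \<omega>))\<^sup>2)"
    "(\<integral>\<omega>. (norm (linear_stat \<zeta> n \<omega>))\<^sup>2 \<partial>M) \<le> V"
proof -
  interpret indep_family M XX "idx n" by (rule family)
  define b where "b p x = (1 / sqrt (real n)) *\<^sub>R \<zeta> (fst p) x" for p :: "'k \<times> nat" and x
  have bm: "b p \<in> borel_measurable borel" for p unfolding b_def[abs_def] by measurable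
  have bB: "norm (b p x) \<le> (1 / sqrt (real n)) * B" for p x
    unfolding b_def norm_scaleR using B by (simp add: divide_right_mono)
  have bz: "(\<integral>x. b p x \<partial>law p) = 0" if "p \<in> idx n" for p
    unfolding law_XX[OF that] b_def using zero by simp
  have L: "linear_stat \<zeta> n \<omega> = (\<Sum>p\<in>idx n. b p (XX p \<omega>))" for \<omega>
    unfolding linear_stat_def b_def ..
  have V0: "0 \<le> V" by (rule order_trans[OF _ V]) simp
  have "(\<integral>x. (norm (b p x))\<^sup>2 \<partial>law p) \<le> (1 / real n) * V" if "p \<in> idx n" for p
    unfolding law_XX[OF that] b_def using V[of "fst p"]
    by (simp add: power_divide divide_right_mono)
  note v = variance_sum_le[of b, OF bm bB bz this]
  show "integrable M (\<lambda>\<omega>. (norm (linear_stat \<zeta> n \<omega>))\<^sup>2)"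
    unfolding L by (rule v(1))
  from v(2) have "(\<integral>\<omega>. (norm (linear_stat \<zeta> n \<omega>))\<^sup>2 \<partial>M) \<le> real n * ((1 / real n) * V)"
    unfolding L card_idx .
  \<comment> \<open>Only an inequality, since for \<open>n = 0\<close> the left side is 0.\<close>
  also have "\<dots> \<le> V" using V0 by simp
  finally show "(\<integral>\<omega>. (norm (linear_stat \<zeta> n \<omega>))\<^sup>2 \<partial>M) \<le> V" .
qed

lemma linear_stat_char_tendsto:
  fixes \<zeta> :: "'k \<Rightarrow> 'h \<Rightarrow> 'b::{real_inner, banach, second_countable_topology}"
  assumes \<zeta>m[measurable]: "\<And>k. \<zeta> k \<in> borel_measurable borel" and B: "\<And>k x. norm (\<zeta> k x) \<le> B"
    and zero: "\<And>k. (\<integral>x. \<zeta> k x \<partial>P k) = 0"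
  shows "(\<lambda>n. char (distr M borel (\<lambda>\<omega>. linear_stat \<zeta> n \<omega> \<bullet> w)) 1)
     \<longlonglongrightarrow> exp (- (\<Sum>k\<in>UNIV. lam k * (\<integral>x. (\<zeta> k x \<bullet> w)\<^sup>2 \<partial>P k)) / 2)"
proof -
  define V where "V k = (\<integral>x. (\<zeta> k x \<bullet> w)\<^sup>2 \<partial>P k)" for k
  define c where "c n = B * norm w / sqrt (real n)" for n
  define b where "b n p x = (1 / sqrt (real n)) * (\<zeta> (fst p) x \<bullet> w)" for n and p :: "'k \<times> nat" and x
  have bm: "b n p \<in> borel_measurable borel" for n p unfolding b_def[abs_def] by measurable
  have bc: "\<bar>b n p x\<bar> \<le> c n" for n p x
    unfolding b_def c_def abs_mult
    using norm_inner_le[OF B[of "fst p" x] order_refl[of "norm w"]] by (simp add: divide_right_mono)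
  have L: "linear_stat \<zeta> n \<omega> \<bullet> w = (\<Sum>p\<in>idx n. b n p (XX p \<omega>))" for n \<omega>
    unfolding linear_stat_def b_def by (simp add: inner_sum_left)
  have i: "integrable (P k) (\<zeta> k)" for k by (rule integrable_P[OF \<zeta>m B])
  have bz: "(\<integral>x. b n p x \<partial>distr M borel (XX p)) = 0" if "p \<in> idx n" for n p
    unfolding law_XX[OF that] b_def using i zero by simp
  have sq: "(\<Sum>p\<in>idx n. \<integral>x. (b n p x)\<^sup>2 \<partial>distr M borel (XX p)) = (\<Sum>k\<in>UNIV. real (N n k) / real n * V k)" for n
  proof -
    have "(\<Sum>p\<in>idx n. \<integral>x. (b n p x)\<^sup>2 \<partial>distr M borel (XX p)) = (\<Sum>p\<in>idx n. V (fst p) / real n)"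
      by (intro sum.cong refl) (simp add: law_XX b_def V_def power_mult_distrib power_divide)
    also have "\<dots> = (\<Sum>k\<in>UNIV. real (N n k) * (V k / real n))"
      using sum_idx[of "\<lambda>k. V k / real n" n] by simp
    finally show ?thesis by (simp add: mult.commute)
  qed
  have bound: "cmod (char (distr M borel (\<lambda>\<omega>. linear_stat \<zeta> n \<omega> \<bullet> w)) 1
      - exp (- (\<Sum>k\<in>UNIV. real (N n k) / real n * V k) / 2)) \<le> real n * ((c n)^3 / 6 + (c n)^4 / 4)" for n
    using indep_family.char_sum_approx[OF family[of n], of "b n" "c n", OF bm bc bz]
    unfolding L sq card_idx by simp
  have c0: "(\<lambda>n. real n * ((c n)^3 / 6 + (c n)^4 / 4)) \<longlonglongrightarrow> 0"
  proof -
    define a where "a = B * norm w"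
    \<comment> \<open>Here \<open>c n = a / sqrt n\<close>: over \<open>n\<close> observations the
      cubic error decays like \<open>1 / sqrt n\<close> and the quartic one like
      \<open>1 / n\<close>.\<close>
    have "real n * ((c n)^3 / 6 + (c n)^4 / 4) = (a^3 / 6) * (1 / sqrt (real n)) + (a^4 / 4) * (1 / real n)" if "n > 0" for n
    proof -
      have "sqrt (real n) ^ 3 = real n * sqrt (real n)" "sqrt (real n) ^ 4 = real n * real n"
        using that by (simp_all add: power3_eq_cube power4_eq_xxxx)
      then show ?thesis using that by (simp add: c_def a_def power_divide field_simps)
    qed
    then have ev: "\<forall>\<^sub>F n in sequentially. (a^3 / 6) * (1 / sqrt (real n)) + (a^4 / 4) * (1 / real n)
        = real n * ((c n)^3 / 6 + (c n)^4 / 4)"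
      by (intro eventually_sequentiallyI[of 1]) simp
    have s1: "(\<lambda>n. 1 / sqrt (real n)) \<longlonglongrightarrow> 0"
      by (rule tendsto_divide_0[OF tendsto_const])
        (intro filterlim_at_top_imp_at_infinity filterlim_compose[OF sqrt_at_top filterlim_real_sequentially])
    have "(\<lambda>n. (a^3 / 6) * (1 / sqrt (real n)) + (a^4 / 4) * (1 / real n)) \<longlonglongrightarrow> (a^3/6) * 0 + (a^4/4) * 0"
      by (intro tendsto_add tendsto_mult tendsto_const s1 lim_1_over_n)
    then show ?thesis using tendsto_cong[OF ev] by simp
  qed
  have "(\<lambda>n. complex_of_real (exp (- (\<Sum>k\<in>UNIV. real (N n k) / real n * V k) / 2)))
      \<longlonglongrightarrow> complex_of_real (exp (- (\<Sum>k\<in>UNIV. lam k * V k) / 2))"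
    by (intro tendsto_intros lam_lim) simp
  moreover have "(\<lambda>n. char (distr M borel (\<lambda>\<omega>. linear_stat \<zeta> n \<omega> \<bullet> w)) 1
      - exp (- (\<Sum>k\<in>UNIV. real (N n k) / real n * V k) / 2)) \<longlonglongrightarrow> 0"
    by (rule Lim_null_comparison[OF _ c0]) (use bound in auto)
  ultimately have "(\<lambda>n. char (distr M borel (\<lambda>\<omega>. linear_stat \<zeta> n \<omega> \<bullet> w)) 1)
      \<longlonglongrightarrow> complex_of_real (exp (- (\<Sum>k\<in>UNIV. lam k * V k) / 2))"
    using tendsto_add by fastforce
  then show ?thesis unfolding V_def .
qed

text \<open>Mean-square density of simple functions, with a uniform bound kept on \<open>F\<close>.
  The factor 2 comes from the pointwise approximation theorem, and \<open>(3 * B)\<^sup>2\<close>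
  dominates the squared error.\<close>

lemma simple_approximation:
  fixes f :: "'h \<Rightarrow> 'b::{real_inner, banach, second_countable_topology}"
  assumes fm[measurable]: "f \<in> borel_measurable borel" and B: "\<And>x. norm (f x) \<le> B" and "e > 0"
  obtains F where "simple_function borel F" "\<And>x. norm (F x) \<le> 2 * B"
    "(\<integral>x. (norm (f x - F x))\<^sup>2 \<partial>P k) \<le> e"
proof -
  interpret P: prob_space "P k" by (rule P)
  have B0: "B \<ge> 0" using B[of undefined] norm_ge_zero order_trans by blast
  obtain F where F: "\<And>i. simple_function borel (F i)" "\<And>x. (\<lambda>i. F i x) \<longlonglongrightarrow> f x"
    "\<And>i x. dist (F i x) 0 \<le> 2 * dist (f x) 0"
    using borel_measurable_implies_sequence_metric[OF fm, of 0] by auto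
  have FB: "norm (F i x) \<le> 2 * B" for i x using F(3)[of i x] B[of x] by simp
  have [measurable]: "F i \<in> borel_measurable borel" for i using F(1) by (rule borel_measurable_simple_function)
  have "(\<lambda>i. \<integral>x. (norm (f x - F i x))\<^sup>2 \<partial>P k) \<longlonglongrightarrow> (\<integral>x. 0 \<partial>P k)"
  proof (rule integral_dominated_convergence[where w="\<lambda>_. (3 * B)\<^sup>2"])
    show "AE x in P k. (\<lambda>i. (norm (f x - F i x))\<^sup>2) \<longlonglongrightarrow> 0"
    proof (rule AE_I2)
      fix x
      have "(\<lambda>i. (norm (f x - F i x))\<^sup>2) \<longlonglongrightarrow> (norm (f x - f x))\<^sup>2"
        by (intro tendsto_intros F(2))
      then show "(\<lambda>i. (norm (f x - F i x))\<^sup>2) \<longlonglongrightarrow> 0" by simp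
    qed
    show "AE x in P k. norm ((norm (f x - F i x))\<^sup>2) \<le> (3 * B)\<^sup>2" for i
    proof (rule AE_I2)
      fix x
      have "norm (f x - F i x) \<le> 3 * B"
        using norm_triangle_ineq4[of "f x" "F i x"] B[of x] FB[of i x] by linarith
      then show "norm ((norm (f x - F i x))\<^sup>2) \<le> (3 * B)\<^sup>2"
        unfolding real_norm_def abs_of_nonneg[OF zero_le_power2] by (rule power_mono) simp
    qed
  qed auto
  then have "(\<lambda>i. \<integral>x. (norm (f x - F i x))\<^sup>2 \<partial>P k) \<longlonglongrightarrow> 0" by simp
  from order_tendstoD(2)[OF this \<open>e > 0\<close>]
  obtain i where "(\<integral>x. (norm (f x - F i x))\<^sup>2 \<partial>P k) < e"
    by (auto simp: eventually_sequentially)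
  then show thesis using that[OF F(1) FB] by (meson less_imp_le)
qed

text \<open>The statistic stays in the span of the finite set \<open>V\<close>, and its coefficients
  are real linear statistics of centred indicators, to which the second moment bound applies
  uniformly in \<open>n\<close>.\<close>

lemma linear_stat_simple:
  fixes F :: "'k \<Rightarrow> 'h \<Rightarrow> 'b::{real_inner, banach, second_countable_topology}"
  assumes V: "finite V" "\<And>k x. F k x \<in> V" and Fm: "\<And>k v. F k -` {v} \<in> sets borel"
  shows "linear_stat (\<lambda>k x. F k x - (\<integral>y. F k y \<partial>P k)) n \<omega>
    = (\<Sum>v\<in>V. linear_stat (\<lambda>k x. indicator (F k -` {v}) x - measure (P k) (F k -` {v})) n \<omega> *\<^sub>R v)"
proof -
  have Fv: "F k x = (\<Sum>v\<in>V. indicator (F k -` {v}) x *\<^sub>R v)" for k x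
  proof -
    have "(\<Sum>v\<in>V. indicator (F k -` {v}) x *\<^sub>R v) = (\<Sum>v\<in>V. if v = F k x then v else 0)"
      by (intro sum.cong) (auto simp: indicator_def)
    then show ?thesis using V by simp
  qed
  have IF: "(\<integral>y. F k y \<partial>P k) = (\<Sum>v\<in>V. measure (P k) (F k -` {v}) *\<^sub>R v)" for k
  proof -
    interpret P: prob_space "P k" by (rule P)
    have ii: "integrable (P k) (indicator (F k -` {v}) :: _ \<Rightarrow> real)" for v
      using Fm[of k v] by (intro integrable_real_indicator) (auto simp: sets_P less_top[symmetric])
    have "(\<integral>y. F k y \<partial>P k) = (\<integral>y. (\<Sum>v\<in>V. indicator (F k -` {v}) y *\<^sub>R v) \<partial>P k)"
      by (simp only: Fv[symmetric])
    also have "\<dots> = (\<Sum>v\<in>V. (\<integral>y. indicator (F k -` {v}) y \<partial>P k) *\<^sub>R v)"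
      using ii by (subst Bochner_Integration.integral_sum) auto
    finally show ?thesis by simp
  qed
  have "linear_stat (\<lambda>k x. F k x - (\<integral>y. F k y \<partial>P k)) n \<omega>
     = (\<Sum>p\<in>idx n. \<Sum>v\<in>V. ((1 / sqrt (real n)) * (indicator (F (fst p) -` {v}) (XX p \<omega>) - measure (P (fst p)) (F (fst p) -` {v}))) *\<^sub>R v)"
    unfolding linear_stat_def IF
    by (subst Fv) (simp add: scaleR_sum_right sum_subtractf[symmetric] scaleR_diff_left[symmetric])
  also have "\<dots> = (\<Sum>v\<in>V. \<Sum>p\<in>idx n. ((1 / sqrt (real n)) * (indicator (F (fst p) -` {v}) (XX p \<omega>) - measure (P (fst p)) (F (fst p) -` {v}))) *\<^sub>R v)"
    by (rule sum.swap)
  finally show ?thesis unfolding linear_stat_def by (simp add: scaleR_sum_left)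
qed

lemma linear_stat_diff:
  "linear_stat (\<lambda>k x. f k x - g k x) n \<omega> = linear_stat f n \<omega> - linear_stat g n \<omega>"
  unfolding linear_stat_def by (simp add: scaleR_diff_right sum_subtractf)

text \<open>Balls are not compact in infinite dimensions, so a bounded second moment of the sum
  itself would not do. Second moments are used for the finitely many coefficients of the simple part
  and for the small remainder.\<close>

lemma linear_stat_tight:
  fixes \<zeta> :: "'k \<Rightarrow> 'h \<Rightarrow> 'b::{real_inner, banach, second_countable_topology}"
  assumes \<zeta>m[measurable]: "\<And>k. \<zeta> k \<in> borel_measurable borel" and B: "\<And>k x. norm (\<zeta> k x) \<le> B"
    and zero: "\<And>k. (\<integral>x. \<zeta> k x \<partial>P k) = 0"
  shows "tight_seq (\<lambda>n. distr M borel (linear_stat \<zeta> n))"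
proof (rule tight_seqI_approx)
  have Lm[measurable]: "linear_stat \<zeta> n \<in> borel_measurable M" for n
    by (rule linear_stat_measurable) simp
  show "prob_space (distr M borel (linear_stat \<zeta> n))" for n by (rule prob_space_distr) simp
  show "sets (distr M borel (linear_stat \<zeta> n)) = sets borel" for n by simp
  fix r d :: real assume r: "r > 0" and d: "d > 0"
  \<comment> \<open>Chebyshev's inequality at level \<open>r\<close> then gives the remainder an
    exceptional event of probability at most \<open>e / r\<^sup>2 = d / 2\<close>.\<close>
  define e where "e = r\<^sup>2 * d / 2"
  have "e > 0" using r d by (simp add: e_def)
  have "\<exists>F. simple_function borel F \<and> (\<forall>x. norm (F x) \<le> 2 * B) \<and> (\<integral>x. (norm (\<zeta> k x - F x))\<^sup>2 \<partial>P k) \<le> e" for k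
    using simple_approximation[OF \<zeta>m B \<open>e > 0\<close>, of k k] by metis
  then obtain F where F: "\<And>k. simple_function borel (F k)" "\<And>k x. norm (F k x) \<le> 2 * B"
    "\<And>k. (\<integral>x. (norm (\<zeta> k x - F k x))\<^sup>2 \<partial>P k) \<le> e" by metis
  have Fm[measurable]: "F k \<in> borel_measurable borel" for k using F(1) by (rule borel_measurable_simple_function)
  define m where "m k = (\<integral>x. F k x \<partial>P k)" for k
  define V where "V = (\<Union>k. range (F k))"
  have V: "finite V" "\<And>k x. F k x \<in> V"
    unfolding V_def using F(1) by (auto simp: simple_function_def)
  have Fv: "F k -` {v} \<in> sets borel" for k v
    using measurable_sets[OF Fm, of "{v}" k] by simp
  define c where "c v n \<omega> = linear_stat (\<lambda>k x. indicator (F k -` {v}) x - measure (P k) (F k -` {v})) n \<omega>"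
    for v n \<omega>
  have cm: "c v n \<in> borel_measurable M" for v n
    unfolding c_def[abs_def] using Fv by (intro linear_stat_measurable) auto
  have c2: "integrable M (\<lambda>\<omega>. (c v n \<omega>)\<^sup>2)" "(\<integral>\<omega>. (c v n \<omega>)\<^sup>2 \<partial>M) \<le> 1" for v n
  proof -
    define q where "q k = measure (P k) (F k -` {v})" for k
    define g where "g k x = indicator (F k -` {v}) x - q k" for k x
    have q: "0 \<le> q k" "q k \<le> 1" for k
      unfolding q_def using prob_space.prob_le_1[OF P] by auto
    have g1: "norm (g k x) \<le> 1" for k x
      unfolding g_def using q[of k] by (auto simp: indicator_def)
    have gm: "g k \<in> borel_measurable borel" for k
      unfolding g_def[abs_def] using Fv by auto
    have gz: "(\<integral>x. g k x \<partial>P k) = 0" for k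
    proof -
      interpret P: prob_space "P k" by (rule P)
      have "integrable (P k) (indicator (F k -` {v}) :: _ \<Rightarrow> real)"
        using Fv[of k v] by (intro integrable_real_indicator) (auto simp: sets_P less_top[symmetric])
      then show ?thesis by (simp add: g_def q_def)
    qed
    have gV: "(\<integral>x. (norm (g k x))\<^sup>2 \<partial>P k) \<le> 1" for k
    proof -
      interpret P: prob_space "P k" by (rule P)
      have "(norm (g k x))\<^sup>2 \<le> 1" for x using power_mono[OF g1[of k x], of 2] by simp
      then have "(\<integral>x. (norm (g k x))\<^sup>2 \<partial>P k) \<le> (\<integral>x. 1 \<partial>P k)"
        by (intro integral_mono_AE') auto
      then show ?thesis by simp
    qed
    show "integrable M (\<lambda>\<omega>. (c v n \<omega>)\<^sup>2)" "(\<integral>\<omega>. (c v n \<omega>)\<^sup>2 \<partial>M) \<le> 1"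
      using linear_stat_second_moment[of g 1 1 n, OF gm g1 gz gV]
      unfolding c_def g_def q_def by auto
  qed
  \<comment> \<open>Chebyshev's inequality at level \<open>R\<close> for each of the
    \<open>card V\<close> coefficients leaves at most \<open>d / 2\<close> in total; the summand 1
    makes \<open>R\<close> positive without asking whether \<open>V\<close> is empty.\<close>
  define R where "R = sqrt (2 * (card V + 1) / d)"
  have R: "R > 0" "card V * (1 / R\<^sup>2) \<le> d / 2"
  proof -
    show "R > 0" unfolding R_def using d by simp
    have "R\<^sup>2 = 2 * (card V + 1) / d" unfolding R_def using d by simp
    then have "card V * (1 / R\<^sup>2) = d / 2 * (card V / (card V + 1))" by (simp add: field_simps)
    also have "\<dots> \<le> d / 2 * 1" using d by (intro mult_left_mono) auto
    finally show "card V * (1 / R\<^sup>2) \<le> d / 2" by simp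
  qed
  \<comment> \<open>The approximation error is centred again, so that the second moment bound for
    linear statistics applies; centring does not increase its second moment.\<close>
  define \<delta> where "\<delta> k x = (\<zeta> k x - F k x) - (\<integral>x. \<zeta> k x - F k x \<partial>P k)" for k x
  have i\<zeta>: "integrable (P k) (\<zeta> k)" and iF: "integrable (P k) (F k)" for k
    using integrable_P[OF \<zeta>m B] integrable_P[OF Fm F(2)] by auto
  have \<delta>': "\<delta> k x = \<zeta> k x - (F k x - m k)" for k x
    unfolding \<delta>_def m_def using i\<zeta>[of k] iF[of k] zero[of k] by simp
  have \<delta>m: "\<delta> k \<in> borel_measurable borel" for k unfolding \<delta>_def[abs_def] by measurable
  have mB: "norm (m k) \<le> 2 * B" for k
  proof -
    interpret P: prob_space "P k" by (rule P)
    have "norm (m k) \<le> (\<integral>x. norm (F k x) \<partial>P k)" unfolding m_def by (rule integral_norm_bound)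
    also have "\<dots> \<le> (\<integral>x. 2 * B \<partial>P k)" using F(2) iF[of k] by (intro integral_mono) auto
    finally show ?thesis by simp
  qed
  \<comment> \<open>\<open>B\<close> for \<open>\<zeta>\<close>, \<open>2 * B\<close> for
    \<open>F\<close> and \<open>2 * B\<close> for the mean of \<open>F\<close>.\<close>
  have \<delta>B: "norm (\<delta> k x) \<le> 5 * B" for k x
    unfolding \<delta>' using norm_triangle_ineq4[of "\<zeta> k x" "F k x - m k"] norm_triangle_ineq4[of "F k x" "m k"]
      B[of k x] F(2)[of k x] mB[of k] by linarith
  have \<delta>z: "(\<integral>x. \<delta> k x \<partial>P k) = 0" for k
  proof -
    interpret P: prob_space "P k" by (rule P)
    show ?thesis unfolding \<delta>_def using i\<zeta>[of k] iF[of k] by simp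
  qed
  have \<delta>V: "(\<integral>x. (norm (\<delta> k x))\<^sup>2 \<partial>P k) \<le> e" for k
  proof -
    have "norm (\<zeta> k x - F k x) \<le> 3 * B" for x
      using norm_triangle_ineq4[of "\<zeta> k x" "F k x"] B[of k x] F(2)[of k x] by linarith
    from prob_space.centered_second_moment_le[OF P _ this]
    have "(\<integral>x. (norm (\<delta> k x))\<^sup>2 \<partial>P k) \<le> (\<integral>x. (norm (\<zeta> k x - F k x))\<^sup>2 \<partial>P k)"
      unfolding \<delta>_def by simp
    then show ?thesis using F(3)[of k] by linarith
  qed
  have \<delta>2: "integrable M (\<lambda>\<omega>. (norm (linear_stat \<delta> n \<omega>))\<^sup>2)" "(\<integral>\<omega>. (norm (linear_stat \<delta> n \<omega>))\<^sup>2 \<partial>M) \<le> e" for n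
    using linear_stat_second_moment[of \<delta> "5 * B" e n, OF \<delta>m \<delta>B \<delta>z \<delta>V] by auto
  have L\<delta>m[measurable]: "linear_stat \<delta> n \<in> borel_measurable M" for n
    by (rule linear_stat_measurable) (rule \<delta>m)
  obtain K where K: "compact K" and KR: "\<And>c. (\<And>v. v \<in> V \<Longrightarrow> \<bar>c v\<bar> \<le> R) \<Longrightarrow> (\<Sum>v\<in>V. c v *\<^sub>R v) \<in> K"
    using compact_bounded_combinations[OF V(1)] by blast
  have "measure (distr M borel (linear_stat \<zeta> n)) (\<Union>x\<in>K. \<Union>y\<in>cball 0 r. {x + y}) \<ge> 1 - d" for n
  proof -
    define S where "S = (\<Union>x\<in>K. \<Union>y\<in>cball 0 r. {x + y})"
    have "closed S" unfolding S_def by (intro compact_closed_sums K closed_cball)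
    then have [measurable]: "S \<in> sets borel" by simp
    define A where "A = {\<omega>\<in>space M. \<bar>norm (linear_stat \<delta> n \<omega>)\<bar> \<ge> r}"
    define D where "D v = {\<omega>\<in>space M. \<bar>c v n \<omega>\<bar> \<ge> R}" for v
    have Am[measurable]: "A \<in> sets M" unfolding A_def by measurable
    have Dm: "D v \<in> sets M" for v unfolding D_def using cm[of v n] by measurable
    have "measure M A \<le> (\<integral>\<omega>. (norm (linear_stat \<delta> n \<omega>))\<^sup>2 \<partial>M) / r\<^sup>2"
      unfolding A_def using r \<delta>2 by (intro second_moment_method) auto
    also have "\<dots> \<le> e / r\<^sup>2" using \<delta>2(2)[of n] by (simp add: divide_right_mono)
    also have "\<dots> = d / 2" using r by (simp add: e_def)
    finally have A: "measure M A \<le> d / 2" .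
    have D: "measure M (D v) \<le> 1 / R\<^sup>2" for v
    proof -
      have "measure M (D v) \<le> (\<integral>\<omega>. (c v n \<omega>)\<^sup>2 \<partial>M) / R\<^sup>2"
        unfolding D_def using R c2 cm by (intro second_moment_method) auto
      also have "\<dots> \<le> 1 / R\<^sup>2" using c2(2)[of v n] by (simp add: divide_right_mono)
      finally show ?thesis .
    qed
    have "measure M (\<Union>v\<in>V. D v) \<le> (\<Sum>v\<in>V. measure M (D v))"
      using V Dm by (intro finite_measure_subadditive_finite) auto
    also have "\<dots> \<le> of_nat (card V) * (1 / R\<^sup>2)" by (intro sum_bounded_above D)
    also have "\<dots> \<le> d / 2" using R by simp
    finally have DV: "measure M (\<Union>v\<in>V. D v) \<le> d / 2" .
    have UD: "(\<Union>v\<in>V. D v) \<in> sets M" using V Dm by auto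
    have "space M - (A \<union> (\<Union>v\<in>V. D v)) \<subseteq> linear_stat \<zeta> n -` S \<inter> space M"
    proof
      fix \<omega> assume "\<omega> \<in> space M - (A \<union> (\<Union>v\<in>V. D v))"
      then have \<omega>: "\<omega> \<in> space M" "norm (linear_stat \<delta> n \<omega>) < r" "\<And>v. v \<in> V \<Longrightarrow> \<bar>c v n \<omega>\<bar> \<le> R"
        unfolding A_def D_def by force+
      have "linear_stat \<zeta> n \<omega> = linear_stat (\<lambda>k x. F k x - m k) n \<omega> + linear_stat \<delta> n \<omega>"
        unfolding \<delta>'[abs_def] linear_stat_diff by simp
      also have "linear_stat (\<lambda>k x. F k x - m k) n \<omega> = (\<Sum>v\<in>V. c v n \<omega> *\<^sub>R v)"
        unfolding m_def c_def by (rule linear_stat_simple[OF V Fv])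
      finally have e: "linear_stat \<zeta> n \<omega> = (\<Sum>v\<in>V. c v n \<omega> *\<^sub>R v) + linear_stat \<delta> n \<omega>" .
      moreover have "(\<Sum>v\<in>V. c v n \<omega> *\<^sub>R v) \<in> K" using \<omega>(3) by (rule KR)
      moreover have "linear_stat \<delta> n \<omega> \<in> cball 0 r" using \<omega>(2) by simp
      ultimately have "linear_stat \<zeta> n \<omega> \<in> S" unfolding S_def by blast
      then show "\<omega> \<in> linear_stat \<zeta> n -` S \<inter> space M" using \<omega>(1) by simp
    qed
    then have "measure M (space M - (A \<union> (\<Union>v\<in>V. D v))) \<le> measure M (linear_stat \<zeta> n -` S \<inter> space M)"
      by (intro finite_measure_mono) measurable
    moreover have "measure M (space M - (A \<union> (\<Union>v\<in>V. D v))) = 1 - measure M (A \<union> (\<Union>v\<in>V. D v))"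
      using UD by (intro prob_compl) auto
    moreover have "measure M (A \<union> (\<Union>v\<in>V. D v)) \<le> measure M A + measure M (\<Union>v\<in>V. D v)"
      using UD by (intro measure_Un_le) auto
    ultimately show ?thesis
      using A DV unfolding S_def[symmetric] by (simp add: measure_distr)
  qed
  then show "\<exists>K. compact K \<and> (\<forall>n. 1 - d \<le> measure (distr M borel (linear_stat \<zeta> n)) (\<Union>x\<in>K. \<Union>y\<in>cball 0 r. {x + y}))"
    using K by blast
qed

end

section \<open>The covariance of conditional sign means\<close>

text \<open>Uniqueness is reduced to real conditional expectations of the projections on countably
  many directions, so that the exceptional null sets can be united.\<close>

lemma cond_exp_unique:
  fixes g1 g2 :: "'w \<Rightarrow> 'h::{real_inner, banach, second_countable_topology}"
  assumes "prob_space M" and g1: "is_cond_exp M F Y g1" and g2: "is_cond_exp M F Y g2"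
  shows "AE x in M. g1 x = g2 x"
proof -
  interpret prob_space M by fact
  have sub: "subalgebra M F" using g1 unfolding is_cond_exp_def by simp
  interpret finite_measure_subalgebra M F by unfold_locales (rule sub)
  have int: "integrable M g1" "integrable M g2" and m: "g1 \<in> borel_measurable F" "g2 \<in> borel_measurable F"
    using g1 g2 unfolding is_cond_exp_def by auto
  have eq: "set_lebesgue_integral M S g1 = set_lebesgue_integral M S g2" if "S \<in> sets F" for S
    using g1 g2 that unfolding is_cond_exp_def by auto
  have w: "AE x in M. g1 x \<bullet> w = g2 x \<bullet> w" for w
  proof -
    have si: "(\<integral>x\<in>S. (g x \<bullet> w) \<partial>M) = set_lebesgue_integral M S g \<bullet> w"
      if "integrable M g" "S \<in> sets F" for g :: "'w \<Rightarrow> 'h" and S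
    proof -
      have "S \<in> sets M" using that(2) sub unfolding subalgebra_def by blast
      then have "integrable M (\<lambda>x. indicator S x *\<^sub>R g x)" using that(1) by (rule integrable_mult_indicator)
      then have "set_lebesgue_integral M S g \<bullet> w = (\<integral>x. (indicator S x *\<^sub>R g x) \<bullet> w \<partial>M)"
        unfolding set_lebesgue_integral_def by (intro integral_inner_left[symmetric])
      then show ?thesis unfolding set_lebesgue_integral_def by simp
    qed
    have iw: "integrable M (\<lambda>x. g1 x \<bullet> w)" "integrable M (\<lambda>x. g2 x \<bullet> w)" using int by auto
    have mw: "(\<lambda>x. g1 x \<bullet> w) \<in> borel_measurable F" "(\<lambda>x. g2 x \<bullet> w) \<in> borel_measurable F"
      using m by (auto intro: borel_measurable_inner)
    have "AE x in M. real_cond_exp M F (\<lambda>x. g1 x \<bullet> w) x = g1 x \<bullet> w"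
      by (rule real_cond_exp_charact[OF _ iw(1) iw(1) mw(1)]) simp
    moreover have "AE x in M. real_cond_exp M F (\<lambda>x. g1 x \<bullet> w) x = g2 x \<bullet> w"
      using si[OF int(1)] si[OF int(2)] eq
      by (intro real_cond_exp_charact[OF _ iw(1) iw(2) mw(2)]) simp
    ultimately show ?thesis by eventually_elim simp
  qed
  obtain D :: "'h set" where D: "countable D" "\<And>X. open X \<Longrightarrow> X \<noteq> {} \<Longrightarrow> \<exists>d\<in>D. d \<in> X"
    by (erule countable_dense_setE)
  have "AE x in M. \<forall>w\<in>D. g1 x \<bullet> w = g2 x \<bullet> w"
    using D(1) w by (simp add: AE_ball_countable)
  then show ?thesis
  proof eventually_elim
    case (elim x)
    show ?case
    proof (rule ccontr)
      assume ne: "g1 x \<noteq> g2 x"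
      define u where "u = g1 x - g2 x"
      \<comment> \<open>The open half-space of directions with positive inner product contains
        \<open>u\<close> itself, hence also a direction from the dense set, and that one tells the
        two values apart.\<close>
      have "open {w. u \<bullet> w > 0}" by (intro open_Collect_less continuous_intros)
      moreover have "u \<in> {w. u \<bullet> w > 0}" using ne by (simp add: u_def)
      ultimately obtain d where "d \<in> D" "u \<bullet> d > 0" using D(2)[of "{w. u \<bullet> w > 0}"] by blast
      then show False using elim unfolding u_def by (simp add: inner_diff_left)
    qed
  qed
qed

text \<open>The freezing lemma: an independent variable is integrated out with \<open>Z\<close> held
  fixed. Events of the generated sigma-algebra are preimages under \<open>Z\<close>, and the joint
  law is a product, so Fubini applies.\<close>

lemma is_cond_exp_independent:
  fixes X Z :: "'t \<Rightarrow> 'h::{real_inner, banach, second_countable_topology}" and f :: "'h \<Rightarrow> 'h \<Rightarrow> 'h"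
  assumes T: "prob_space T" and ind: "prob_space.indep_var T borel X borel Z"
    and f[measurable]: "case_prod f \<in> borel_measurable (borel \<Otimes>\<^sub>M borel)" and B: "\<And>x y. norm (f x y) \<le> B"
  shows "is_cond_exp T (vimage_algebra (space T) Z borel) (\<lambda>\<omega>. f (X \<omega>) (Z \<omega>))
    (\<lambda>\<omega>. \<integral>x. f x (Z \<omega>) \<partial>distr T borel X)"
proof -
  let ?D = "distr T (borel \<Otimes>\<^sub>M borel) (\<lambda>\<omega>. (X \<omega>, Z \<omega>))"
  interpret prob_space T by fact
  let ?F = "vimage_algebra (space T) Z borel"
  let ?PX = "distr T borel X" and ?PZ = "distr T borel Z"
  define h where "h z = (\<integral>x. f x z \<partial>?PX)" for z
  from ind have X[measurable]: "X \<in> borel_measurable T" and Z[measurable]: "Z \<in> borel_measurable T"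
    and joint: "?PX \<Otimes>\<^sub>M ?PZ = ?D"
    unfolding indep_var_distribution_eq by auto
  have pX: "prob_space ?PX" and pZ: "prob_space ?PZ" by (auto intro: prob_space_distr)
  have fmm: "finite_measure (?D)"
    by (intro prob_space.finite_measure[OF prob_space_distr]) measurable
  interpret PX: prob_space ?PX by (rule pX)
  interpret PZ: prob_space ?PZ by (rule pZ)
  interpret pair_prob_space ?PX ?PZ ..
  have hm[measurable]: "h \<in> borel_measurable borel"
  proof -
    have "(\<lambda>(z, x). f x z) \<in> borel_measurable (borel \<Otimes>\<^sub>M ?PX)"
      using measurable_compose[OF measurable_pair_swap' f] by (simp add: case_prod_beta' cong: measurable_cong_sets)
    then show ?thesis unfolding h_def[abs_def] by (intro PX.borel_measurable_lebesgue_integral)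
  qed
  have hB: "norm (h z) \<le> B" for z
  proof -
    have "integrable ?PX (\<lambda>x. f x z)"
      using measurable_compose[OF measurable_Pair2' f, of z] B
      by (intro PX.integrable_bounded[where B=B]) auto
    then have "norm (h z) \<le> (\<integral>x. B \<partial>?PX)"
      unfolding h_def using B by (intro order_trans[OF integral_norm_bound] integral_mono) auto
    then show ?thesis using PX.prob_space by simp
  qed
  have Ttm: "finite_measure T" by unfold_locales
  have hZi: "integrable T (\<lambda>\<omega>. h (Z \<omega>))"
    by (rule integrable_bounded_borel[OF Ttm, where B=B]) (auto intro: hB)
  have "set_lebesgue_integral T S (\<lambda>\<omega>. h (Z \<omega>)) = set_lebesgue_integral T S (\<lambda>\<omega>. f (X \<omega>) (Z \<omega>))"
    if S: "S \<in> sets ?F" for S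
  proof -
    obtain A where A[measurable]: "A \<in> sets borel" and SA: "S = Z -` A \<inter> space T"
      using S by (auto simp: sets_vimage_algebra2)
    have int: "integrable (?PX \<Otimes>\<^sub>M ?PZ) (\<lambda>(x, z). indicator A z *\<^sub>R f x z)"
      unfolding joint
    proof (rule integrable_bounded_borel[OF fmm, where B=B])
      show "(\<lambda>(x, z). indicator A z *\<^sub>R f x z)
        \<in> borel_measurable (?D)" by measurable
      fix p show "norm ((\<lambda>(x, z). indicator A z *\<^sub>R f x z) p) \<le> B"
        using B order_trans[OF norm_ge_zero B] by (auto simp: indicator_def split: prod.split)
    qed
    have "set_lebesgue_integral T S (\<lambda>\<omega>. f (X \<omega>) (Z \<omega>)) = (\<integral>\<omega>. (\<lambda>(x, z). indicator A z *\<^sub>R f x z) (X \<omega>, Z \<omega>) \<partial>T)"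
      unfolding set_lebesgue_integral_def SA
      by (intro Bochner_Integration.integral_cong) (auto simp: indicator_def)
    also have "\<dots> = (\<integral>p. (\<lambda>(x, z). indicator A z *\<^sub>R f x z) p \<partial>(?PX \<Otimes>\<^sub>M ?PZ))"
      unfolding joint by (rule integral_distr[symmetric]) measurable
    also have "\<dots> = (\<integral>z. (\<integral>x. indicator A z *\<^sub>R f x z \<partial>?PX) \<partial>?PZ)"
      by (rule integral_snd[symmetric]) (rule int)
    also have "\<dots> = (\<integral>z. indicator A z *\<^sub>R h z \<partial>?PZ)"
      unfolding h_def by simp
    also have "\<dots> = (\<integral>\<omega>. indicator A (Z \<omega>) *\<^sub>R h (Z \<omega>) \<partial>T)"
      by (rule integral_distr) measurable
    also have "\<dots> = set_lebesgue_integral T S (\<lambda>\<omega>. h (Z \<omega>))"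
      unfolding set_lebesgue_integral_def SA
      by (intro Bochner_Integration.integral_cong) (auto simp: indicator_def)
    finally show ?thesis ..
  qed
  moreover have "(\<lambda>\<omega>. h (Z \<omega>)) \<in> borel_measurable ?F"
    by (rule measurable_compose[OF measurable_vimage_algebra1 hm]) simp
  moreover have "subalgebra T ?F"
    unfolding subalgebra_def using measurable_sets[OF Z] by (auto simp: sets_vimage_algebra2)
  ultimately show ?thesis
    unfolding is_cond_exp_def h_def[symmetric] using hZi by blast
qed

lemma cond_exp_given_independent:
  fixes X Z :: "'t \<Rightarrow> 'h::{real_inner, banach, second_countable_topology}" and f :: "'h \<Rightarrow> 'h \<Rightarrow> 'h"
  assumes T: "prob_space T" and ind: "prob_space.indep_var T borel X borel Z"
    and f: "case_prod f \<in> borel_measurable (borel \<Otimes>\<^sub>M borel)" and B: "\<And>x y. norm (f x y) \<le> B"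
  shows "AE \<omega> in T. cond_exp_given T Z (\<lambda>\<omega>. f (X \<omega>) (Z \<omega>)) \<omega> = (\<integral>x. f x (Z \<omega>) \<partial>distr T borel X)"
    "cond_exp_given T Z (\<lambda>\<omega>. f (X \<omega>) (Z \<omega>)) \<in> borel_measurable T"
proof -
  have ce: "is_cond_exp T (vimage_algebra (space T) Z borel) (\<lambda>\<omega>. f (X \<omega>) (Z \<omega>))
    (cond_exp_given T Z (\<lambda>\<omega>. f (X \<omega>) (Z \<omega>)))"
    unfolding cond_exp_given_def
    by (rule someI[of "is_cond_exp T (vimage_algebra (space T) Z borel) (\<lambda>\<omega>. f (X \<omega>) (Z \<omega>))"]) (rule is_cond_exp_independent[OF assms])
  show "AE \<omega> in T. cond_exp_given T Z (\<lambda>\<omega>. f (X \<omega>) (Z \<omega>)) \<omega> = (\<integral>x. f x (Z \<omega>) \<partial>distr T borel X)"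
    by (rule cond_exp_unique[OF T ce is_cond_exp_independent[OF assms]])
  show "cond_exp_given T Z (\<lambda>\<omega>. f (X \<omega>) (Z \<omega>)) \<in> borel_measurable T"
    using ce unfolding is_cond_exp_def by (auto dest: measurable_from_subalg)
qed

section \<open>Mean sign functions and their covariances\<close>

lemma borel_measurable_sgn_diff:
  "(\<lambda>(x, y). sgn (x - y :: 'h::{real_normed_vector, second_countable_topology})) \<in> borel_measurable (borel \<Otimes>\<^sub>M borel)"
  unfolding sgn_div_norm by measurable

lemma norm_sgn_le: "norm (sgn (x :: 'h::real_normed_vector)) \<le> 1"
  by (simp add: norm_sgn)

text \<open>The population version of the spatial rank of a point with respect to
  \<open>Q\<close>.\<close>

definition sign_mean :: "'h measure \<Rightarrow> 'h \<Rightarrow> 'h::{real_inner, banach, second_countable_topology}" where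
  "sign_mean Q x = (\<integral>y. sgn (x - y) \<partial>Q)"

lemma sign_mean_measurable:
  assumes "prob_space Q" and [measurable_cong]: "sets Q = sets borel"
  shows "sign_mean Q \<in> borel_measurable borel"
proof -
  interpret Q: prob_space Q by fact
  have "(\<lambda>(x, y). sgn (x - y :: 'a)) \<in> borel_measurable (borel \<Otimes>\<^sub>M Q)"
    using borel_measurable_sgn_diff by (simp cong: measurable_cong_sets)
  then show ?thesis
    unfolding sign_mean_def[abs_def] by (rule Q.borel_measurable_lebesgue_integral)
qed

lemma integrable_sgn_diff:
  fixes z :: "'h::{real_inner, banach, second_countable_topology}"
  assumes "prob_space Q" and [measurable_cong]: "sets Q = sets borel"
  shows "integrable Q (\<lambda>y. sgn (z - y))" "integrable Q (\<lambda>y. sgn (y - z))"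
proof -
  interpret Q: prob_space Q by fact
  have "(\<lambda>y. sgn (z - y)) \<in> borel_measurable Q" "(\<lambda>y. sgn (y - z)) \<in> borel_measurable Q"
    unfolding sgn_div_norm by measurable
  then show "integrable Q (\<lambda>y. sgn (z - y))" "integrable Q (\<lambda>y. sgn (y - z))"
    by (auto intro!: Q.integrable_bounded[where B=1] simp: norm_sgn_le)
qed

lemma norm_sign_mean_le:
  assumes "prob_space Q" and "sets Q = sets borel"
  shows "norm (sign_mean Q z) \<le> 1"
proof -
  interpret Q: prob_space Q by fact
  have "norm (sign_mean Q z) \<le> (\<integral>y. 1 \<partial>Q)"
    unfolding sign_mean_def using integrable_sgn_diff(1)[OF assms]
    by (intro order_trans[OF integral_norm_bound] integral_mono) (auto simp: norm_sgn_le)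
  then show ?thesis using Q.prob_space by simp
qed

lemma integral_sgn_diff_flip: "(\<integral>x. sgn (x - z) \<partial>Q) = - sign_mean Q z"
proof -
  have "sgn (x - z) = - sgn (z - x)" for x :: 'a by (metis minus_diff_eq sgn_minus)
  then show ?thesis unfolding sign_mean_def by simp
qed

text \<open>Given \<open>Z\<close>, the mean of \<open>sgn (X - Z)\<close> is minus the mean sign
  function of the law of \<open>X\<close> at \<open>Z\<close>. The two minus signs cancel in the
  covariance, which leaves centred mean sign functions integrated over the law of
  \<open>Z\<close>.\<close>

lemma sign_cov_eq:
  fixes X Y Z :: "'t \<Rightarrow> 'h::{real_inner, banach, second_countable_topology}"
  assumes T: "prob_space T" and ind: "prob_space.indep_vars T (\<lambda>_. borel) ((!) [X, Y, Z]) {0, 1, 2}"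
    and laws: "distr T borel X = P1" "distr T borel Y = P2" "distr T borel Z = P3"
  defines "m1 \<equiv> (\<integral>z. sign_mean P1 z \<partial>P3)" and "m2 \<equiv> (\<integral>z. sign_mean P2 z \<partial>P3)"
  shows "sign_cov T X Y Z w \<bullet> v = (\<integral>z. ((sign_mean P1 z - m1) \<bullet> w) * ((sign_mean P2 z - m2) \<bullet> v) \<partial>P3)"
proof -
  interpret prob_space T by (rule T)
  have iv: "indep_var borel X borel Z" "indep_var borel Y borel Z"
  proof -
    \<comment> \<open>The family is the list \<open>[X, Y, Z]\<close> indexed by 0, 1, 2; a pair is
      extracted as two singleton blocks followed by evaluation.\<close>
    have "indep_var borel (((!) [X, Y, Z]) i) borel (((!) [X, Y, Z]) j)" if "i \<noteq> j" "i \<in> {0,1,2}" "j \<in> {0,1,2}" for i j :: nat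
    proof -
      have "indep_var borel ((\<lambda>f. f i) \<circ> (\<lambda>\<omega>. \<lambda>l\<in>{i}. ((!) [X, Y, Z]) l \<omega>))
          borel ((\<lambda>f. f j) \<circ> (\<lambda>\<omega>. \<lambda>l\<in>{j}. ((!) [X, Y, Z]) l \<omega>))"
        using that by (intro indep_var_compose[OF indep_var_restrict[OF ind]]) auto
      then show ?thesis by (simp add: comp_def)
    qed
    from this[of 0 2] this[of 1 2] show "indep_var borel X borel Z" "indep_var borel Y borel Z" by simp_all
  qed
  have [measurable]: "X \<in> borel_measurable T" "Y \<in> borel_measurable T" "Z \<in> borel_measurable T"
    using iv unfolding indep_var_distribution_eq by auto
  have pr: "prob_space P1" "prob_space P2" "prob_space P3" and
    st[measurable_cong]: "sets P1 = sets borel" "sets P2 = sets borel" "sets P3 = sets borel"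
    unfolding laws[symmetric] by (auto intro: prob_space_distr)
  interpret P3: prob_space P3 by (rule pr)
  define A where "A = cond_exp_given T Z (\<lambda>\<omega>. sgn (X \<omega> - Z \<omega>))"
  define D where "D = cond_exp_given T Z (\<lambda>\<omega>. sgn (Y \<omega> - Z \<omega>))"
  have A: "AE \<omega> in T. A \<omega> = - sign_mean P1 (Z \<omega>)" "A \<in> borel_measurable T"
    using cond_exp_given_independent[OF T iv(1) borel_measurable_sgn_diff norm_sgn_le]
    unfolding A_def laws integral_sgn_diff_flip by auto
  have D: "AE \<omega> in T. D \<omega> = - sign_mean P2 (Z \<omega>)" "D \<in> borel_measurable T"
    using cond_exp_given_independent[OF T iv(2) borel_measurable_sgn_diff norm_sgn_le]
    unfolding D_def laws integral_sgn_diff_flip by auto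
  note m1m[measurable] = sign_mean_measurable[OF pr(1) st(1)] and m2m[measurable] = sign_mean_measurable[OF pr(2) st(2)]
  note B1 = norm_sign_mean_le[OF pr(1) st(1)] and B2 = norm_sign_mean_le[OF pr(2) st(2)]
  have ZP: "(\<integral>\<omega>. f (Z \<omega>) \<partial>T) = (\<integral>z. f z \<partial>P3)" if "f \<in> borel_measurable borel"
    for f :: "'h \<Rightarrow> 'c::{banach, second_countable_topology}"
    unfolding laws(3)[symmetric] using that by (intro integral_distr[symmetric]) auto
  have EA: "(\<integral>\<omega>. A \<omega> \<partial>T) = - m1"
  proof -
    have "(\<integral>\<omega>. A \<omega> \<partial>T) = (\<integral>\<omega>. - sign_mean P1 (Z \<omega>) \<partial>T)"
      using A by (intro integral_cong_AE) auto
    then show ?thesis unfolding m1_def using ZP[of "sign_mean P1"] by simp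
  qed
  have ED: "(\<integral>\<omega>. D \<omega> \<partial>T) = - m2"
  proof -
    have "(\<integral>\<omega>. D \<omega> \<partial>T) = (\<integral>\<omega>. - sign_mean P2 (Z \<omega>) \<partial>T)"
      using D by (intro integral_cong_AE) auto
    then show ?thesis unfolding m2_def using ZP[of "sign_mean P2"] by simp
  qed
  have EAD: "(\<integral>\<omega>. (w \<bullet> A \<omega>) *\<^sub>R D \<omega> \<partial>T) = (\<integral>z. (w \<bullet> sign_mean P1 z) *\<^sub>R sign_mean P2 z \<partial>P3)"
  proof -
    have "(\<integral>\<omega>. (w \<bullet> A \<omega>) *\<^sub>R D \<omega> \<partial>T) = (\<integral>\<omega>. (w \<bullet> sign_mean P1 (Z \<omega>)) *\<^sub>R sign_mean P2 (Z \<omega>) \<partial>T)"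
    proof (rule integral_cong_AE)
      show "AE \<omega> in T. (w \<bullet> A \<omega>) *\<^sub>R D \<omega> = (w \<bullet> sign_mean P1 (Z \<omega>)) *\<^sub>R sign_mean P2 (Z \<omega>)"
        using A(1) D(1) by eventually_elim simp
    qed (use A(2) D(2) in measurable)
    also have "\<dots> = (\<integral>z. (w \<bullet> sign_mean P1 z) *\<^sub>R sign_mean P2 z \<partial>P3)" by (rule ZP) measurable
    finally show ?thesis .
  qed
  have i1: "integrable P3 (sign_mean P1)" "integrable P3 (sign_mean P2)"
    using B1 B2 by (auto intro!: P3.integrable_bounded[where B=1])
  have i2: "integrable P3 (\<lambda>z. (w \<bullet> sign_mean P1 z) *\<^sub>R sign_mean P2 z)"
  proof (rule P3.integrable_bounded[where B="norm w"])
    fix z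
    have "\<bar>w \<bullet> sign_mean P1 z\<bar> \<le> norm w * 1"
      by (rule order_trans[OF Cauchy_Schwarz_ineq2]) (intro mult_left_mono B1 norm_ge_zero)
    then have "\<bar>w \<bullet> sign_mean P1 z\<bar> * norm (sign_mean P2 z) \<le> norm w * 1"
      by (intro mult_mono B2) auto
    then show "norm ((w \<bullet> sign_mean P1 z) *\<^sub>R sign_mean P2 z) \<le> norm w" by simp
  qed measurable
  have i3: "integrable P3 (\<lambda>z. (w \<bullet> sign_mean P1 z) * (sign_mean P2 z \<bullet> v))"
    using integrable_inner_left[OF i2, of v] by simp
  have "sign_cov T X Y Z w \<bullet> v = (\<integral>z. (w \<bullet> sign_mean P1 z) *\<^sub>R sign_mean P2 z \<partial>P3) \<bullet> v - (w \<bullet> m1) * (m2 \<bullet> v)"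
    unfolding sign_cov_def cov_op_def tensor_def A_def[symmetric] D_def[symmetric] EA ED EAD
    by (simp add: inner_diff_left)
  also have "(\<integral>z. (w \<bullet> sign_mean P1 z) *\<^sub>R sign_mean P2 z \<partial>P3) \<bullet> v
      = (\<integral>z. (w \<bullet> sign_mean P1 z) * (sign_mean P2 z \<bullet> v) \<partial>P3)"
    using integral_inner_left[OF i2, of v] by simp
  \<comment> \<open>The means are moved inside: the two mixed terms integrate to minus twice the
    product of the means, and the constant adds it back once.\<close>
  also have "(\<integral>z. (w \<bullet> sign_mean P1 z) * (sign_mean P2 z \<bullet> v) \<partial>P3) - (w \<bullet> m1) * (m2 \<bullet> v)
    = (\<integral>z. (w \<bullet> sign_mean P1 z) * (sign_mean P2 z \<bullet> v) - (m2 \<bullet> v) * (w \<bullet> sign_mean P1 z)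
         - (w \<bullet> m1) * (sign_mean P2 z \<bullet> v) + (w \<bullet> m1) * (m2 \<bullet> v) \<partial>P3)"
  proof -
    have e1: "(\<integral>z. w \<bullet> sign_mean P1 z \<partial>P3) = w \<bullet> m1"
      unfolding m1_def by (rule integral_inner_right) (use i1 in simp)
    have e2: "(\<integral>z. sign_mean P2 z \<bullet> v \<partial>P3) = m2 \<bullet> v"
      unfolding m2_def by (rule integral_inner_left) (use i1 in simp)
    have "integrable P3 (\<lambda>z. w \<bullet> sign_mean P1 z)" "integrable P3 (\<lambda>z. sign_mean P2 z \<bullet> v)"
      using i1 by auto
    then show ?thesis using i3 e1 e2 P3.prob_space by simp
  qed
  also have "\<dots> = (\<integral>z. ((sign_mean P1 z - m1) \<bullet> w) * ((sign_mean P2 z - m2) \<bullet> v) \<partial>P3)"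
    by (intro Bochner_Integration.integral_cong) (auto simp: inner_diff_left inner_commute algebra_simps)
  finally show ?thesis .
qed

section \<open>Projection of the rank vector\<close>

lemma (in prob_space) expectation_norm_le_sqrt:
  fixes Y :: "'a \<Rightarrow> 'b::{banach, second_countable_topology}"
  assumes [measurable]: "Y \<in> borel_measurable M" and i2: "integrable M (\<lambda>\<omega>. (norm (Y \<omega>))\<^sup>2)"
    and V: "expectation (\<lambda>\<omega>. (norm (Y \<omega>))\<^sup>2) \<le> V"
  shows "integrable M (\<lambda>\<omega>. norm (Y \<omega>))" "expectation (\<lambda>\<omega>. norm (Y \<omega>)) \<le> sqrt V"
proof -
  show i: "integrable M (\<lambda>\<omega>. norm (Y \<omega>))"
    by (rule square_integrable_imp_integrable[OF _ i2]) measurable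
  have "(expectation (\<lambda>\<omega>. norm (Y \<omega>)))\<^sup>2 \<le> V"
    using variance_positive[of "\<lambda>\<omega>. norm (Y \<omega>)"] variance_eq[OF i i2] V by simp
  then show "expectation (\<lambda>\<omega>. norm (Y \<omega>)) \<le> sqrt V"
    by (rule real_le_rsqrt)
qed

text \<open>A vector is the finite sum of its components placed on the axes, and each axis embedding
  is continuous.\<close>

lemma borel_measurable_vec_lambda:
  fixes f :: "'k::finite \<Rightarrow> 'a \<Rightarrow> 'h::{real_normed_vector, second_countable_topology}"
  assumes "\<And>k. f k \<in> borel_measurable M"
  shows "(\<lambda>x. \<chi> k. f k x) \<in> borel_measurable M"
proof -
  have "(\<lambda>x. \<chi> k. f k x) = (\<lambda>x. \<Sum>k\<in>UNIV. axis k (f k x))"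
    by (auto simp: vec_eq_iff axis_def if_distrib cong: if_cong)
  moreover have "(axis k :: 'h \<Rightarrow> 'h ^ 'k) \<in> borel_measurable borel" for k
  proof (rule borel_measurable_continuous_onI)
    have "continuous_on UNIV (\<lambda>x. \<chi> j. if j = k then x else (0::'h))"
    proof (rule continuous_on_vec_lambda)
      show "continuous_on UNIV (\<lambda>x. if j = k then x else (0::'h))" for j
        by (cases "j = k") auto
    qed
    then show "continuous_on UNIV (axis k :: 'h \<Rightarrow> 'h ^ 'k)" unfolding axis_def[abs_def] .
  qed
  ultimately show ?thesis
    using measurable_compose[OF assms] by (auto intro!: borel_measurable_sum)
qed

lemma norm_vec_le_sum: "norm x \<le> (\<Sum>k\<in>UNIV. norm (x $ k))"
  unfolding norm_vec_def by (rule L2_set_le_sum) simp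

section \<open>Hoeffding decomposition of the sign kernel\<close>

context k_sample
begin

definition sign_mean_mean :: "'k \<Rightarrow> 'k \<Rightarrow> 'h" where
  "sign_mean_mean a l = (\<integral>x. sign_mean (P l) x \<partial>P a)"

definition centered_sign_mean :: "'k \<Rightarrow> 'k \<Rightarrow> 'h \<Rightarrow> 'h" where
  "centered_sign_mean l a x = sign_mean (P l) x - sign_mean_mean a l"

text \<open>The second-order Hoeffding term of \<open>sgn (x - y)\<close>. The projection on
  \<open>y\<close> is \<open>- sign_mean (P k) y\<close> because the sign is odd, and the overall
  mean is added since the two projections subtract it twice.\<close>

definition degenerate_kernel :: "'k \<Rightarrow> 'k \<Rightarrow> 'h \<Rightarrow> 'h \<Rightarrow> 'h" where
  "degenerate_kernel k l x y = sgn (x - y) - sign_mean (P l) x + sign_mean (P k) y + sign_mean_mean k l"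

lemmas sm_measurable[measurable] = sign_mean_measurable[OF P sets_P]
lemmas sm_bound = norm_sign_mean_le[OF P sets_P]

lemma sm_integrable: "integrable (P a) (sign_mean (P l))"
  by (rule integrable_P[OF _ sm_bound]) simp

lemma sign_mean_mean_bound: "norm (sign_mean_mean a l) \<le> 1"
proof -
  have "norm (sign_mean_mean a l) \<le> (\<integral>x. 1 \<partial>P a)"
    unfolding sign_mean_mean_def using sm_integrable prob_space.finite_measure[OF P]
    by (intro order_trans[OF integral_norm_bound] integral_mono) (auto simp: sm_bound intro: integrable_bounded_borel)
  then show ?thesis by simp
qed

text \<open>Fubini together with oddness of \<open>sgn\<close>: the mean sign of a difference,
  integrated in the two orders.\<close>

lemma sign_mean_mean_antisym: "sign_mean_mean k l = - sign_mean_mean l k"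
proof -
  interpret A: prob_space "P k" by (rule P)
  interpret D: prob_space "P l" by (rule P)
  interpret pair_prob_space "P k" "P l" ..
  have s: "sets (P k \<Otimes>\<^sub>M P l) = sets (borel \<Otimes>\<^sub>M borel)" by (intro sets_pair_measure_cong sets_P)
  have "(\<lambda>(x, y). sgn (x - y :: 'h)) \<in> borel_measurable (P k \<Otimes>\<^sub>M P l)"
    using borel_measurable_sgn_diff measurable_cong_sets[OF s refl] by blast
  then have "integrable (P k \<Otimes>\<^sub>M P l) (\<lambda>(x, y). sgn (x - y))"
    by (intro integrable_bounded_borel[where B=1]) (auto simp: norm_sgn_le intro: finite_measure_axioms)
  from Fubini_integral[OF this]
  have "(\<integral>y. (\<integral>x. sgn (x - y) \<partial>P k) \<partial>P l) = sign_mean_mean k l"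
    unfolding sign_mean_mean_def sign_mean_def .
  then show ?thesis unfolding integral_sgn_diff_flip by (simp add: sign_mean_mean_def)
qed

text \<open>Together with \<open>sgn 0 = 0\<close> this makes
  \<open>degenerate_kernel k k x x\<close> vanish.\<close>

lemma sign_mean_mean_self[simp]: "sign_mean_mean k k = 0"
  using sign_mean_mean_antisym[of k k] by (metis add.right_inverse scaleR_2 scale_eq_0_iff zero_neq_numeral)

lemma degenerate_kernel_bound: "norm (degenerate_kernel k l x y) \<le> 4"
proof -
  have "norm (degenerate_kernel k l x y) \<le> 1 + 1 + 1 + 1"
    unfolding degenerate_kernel_def
    by (intro norm_triangle_mono norm_triangle_le_diff norm_sgn_le sm_bound sign_mean_mean_bound order_refl
        order_trans[OF norm_triangle_ineq4] add_mono)
  then show ?thesis by simp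
qed

lemma degenerate_kernel_measurable:
  "case_prod (degenerate_kernel k l) \<in> borel_measurable (borel \<Otimes>\<^sub>M borel)"
proof -
  have "(\<lambda>p. sgn (fst p - snd p :: 'h)) \<in> borel_measurable (borel \<Otimes>\<^sub>M borel)"
    using borel_measurable_sgn_diff by (simp add: case_prod_beta')
  then show ?thesis
    unfolding degenerate_kernel_def case_prod_beta' by measurable
qed

lemma degenerate_kernel_integral1: "(\<integral>x. degenerate_kernel k l x y \<partial>P k) = 0"
proof -
  have "(\<integral>x. degenerate_kernel k l x y \<partial>P k)
     = (\<integral>x. sgn (x - y) \<partial>P k) - sign_mean_mean k l + sign_mean (P k) y + sign_mean_mean k l"
    unfolding degenerate_kernel_def
    using integrable_sgn_diff(2)[OF P sets_P, of k y] sm_integrable prob_space.finite_measure[OF P]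
    by (simp add: sign_mean_mean_def[symmetric] finite_measure.integrable_const)
  then show ?thesis unfolding integral_sgn_diff_flip by simp
qed

lemma degenerate_kernel_integral2: "(\<integral>y. degenerate_kernel k l x y \<partial>P l) = 0"
proof -
  have "(\<integral>y. degenerate_kernel k l x y \<partial>P l)
     = (\<integral>y. sgn (x - y) \<partial>P l) - sign_mean (P l) x + sign_mean_mean l k + sign_mean_mean k l"
    unfolding degenerate_kernel_def
    using integrable_sgn_diff(1)[OF P sets_P, of l x] sm_integrable prob_space.finite_measure[OF P]
    by (simp add: sign_mean_mean_def[symmetric] finite_measure.integrable_const)
  then show ?thesis
    unfolding sign_mean_def[symmetric] using sign_mean_mean_antisym[of k l] by simp
qed

lemma sgn_decomposition:
  "sgn (x - y) = degenerate_kernel k l x y + centered_sign_mean l k x - centered_sign_mean k l y + sign_mean_mean k l"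
  unfolding degenerate_kernel_def centered_sign_mean_def using sign_mean_mean_antisym[of k l] by simp

lemma csm_measurable[measurable]: "centered_sign_mean l a \<in> borel_measurable borel"
  unfolding centered_sign_mean_def[abs_def] by measurable

lemma csm_bound: "norm (centered_sign_mean l a x) \<le> 2"
  unfolding centered_sign_mean_def
  using norm_triangle_ineq4[of "sign_mean (P l) x" "sign_mean_mean a l"] sm_bound[of l x] sign_mean_mean_bound[of a l]
  by linarith

lemma csm_integral: "(\<integral>x. centered_sign_mean l a x \<partial>P a) = 0"
  unfolding centered_sign_mean_def using sm_integrable prob_space.finite_measure[OF P]
  by (simp add: sign_mean_mean_def[symmetric] finite_measure.integrable_const)

text \<open>
  \<open>own_part\<close> comes from the projection on the ranked observation, which lies in group \<open>k\<close>, and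
  \<open>pooled_part\<close> from the projection on the observation it is compared with.
\<close>

definition own_part :: "'k \<Rightarrow> 'k \<Rightarrow> nat \<Rightarrow> 'w \<Rightarrow> 'h" where
  "own_part l k = linear_stat (\<lambda>a x. if a = k then centered_sign_mean l k x else 0)"

definition pooled_part :: "'k \<Rightarrow> nat \<Rightarrow> 'w \<Rightarrow> 'h" where
  "pooled_part k = linear_stat (centered_sign_mean k)"

text \<open>The influence of one observation from group \<open>a\<close> on all components of the
  rank vector. The weights \<open>lam l / sqrt (lam k)\<close> and \<open>sqrt (lam k)\<close> are
  the limits of \<open>N n l / sqrt (N n k * n)\<close> and \<open>sqrt (N n k / n)\<close>.\<close>

definition score :: "'k \<Rightarrow> 'h \<Rightarrow> 'h ^ 'k" where
  "score a x = (\<chi> k. (if a = k then \<Sum>l\<in>UNIV. (lam l / sqrt (lam k)) *\<^sub>R centered_sign_mean l k x else 0)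
     - sqrt (lam k) *\<^sub>R centered_sign_mean k a x)"

definition degenerate_part :: "'k \<Rightarrow> nat \<Rightarrow> 'w \<Rightarrow> 'h" where
  "degenerate_part k n \<omega> = (1 / (sqrt (real (N n k)) * real n)) *\<^sub>R
     (\<Sum>(p, q)\<in>({k} \<times> {1..N n k}) \<times> idx n. degenerate_kernel (fst p) (fst q) (XX p \<omega>) (XX q \<omega>))"

text \<open>The bounds 2 are square roots of second moment bounds 4, which come from
  \<open>csm_bound\<close>.\<close>

lemma parts_moments:
  shows "own_part l k n \<in> borel_measurable M" "integrable M (\<lambda>\<omega>. norm (own_part l k n \<omega>))"
    "expectation (\<lambda>\<omega>. norm (own_part l k n \<omega>)) \<le> 2"
    "pooled_part k n \<in> borel_measurable M" "integrable M (\<lambda>\<omega>. norm (pooled_part k n \<omega>))"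
    "expectation (\<lambda>\<omega>. norm (pooled_part k n \<omega>)) \<le> 2"
proof -
  have V: "(\<integral>x. (norm (f x))\<^sup>2 \<partial>P a) \<le> 4" if "\<And>x. norm (f x) \<le> 2" "f \<in> borel_measurable borel" for f :: "'h \<Rightarrow> 'h" and a
  proof -
    interpret Pa: prob_space "P a" by (rule P)
    have le: "(norm (f x))\<^sup>2 \<le> 4" for x using power_mono[OF that(1)[of x], of 2] by simp
    have "(\<integral>x. (norm (f x))\<^sup>2 \<partial>P a) \<le> (\<integral>x. 4 \<partial>P a)"
      using le that(2) by (intro integral_mono Pa.integrable_bounded[where B=4]) auto
    then show ?thesis by simp
  qed
  define f where "f a x = (if a = k then centered_sign_mean l k x else 0)" for a x
  have f: "f a \<in> borel_measurable borel" "norm (f a x) \<le> 2" "(\<integral>x. f a x \<partial>P a) = 0" for a x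
    unfolding f_def[abs_def] using csm_bound csm_integral by (cases "a = k"; simp)+
  have o: "own_part l k = linear_stat f" unfolding own_part_def f_def[abs_def] ..
  show m1: "own_part l k n \<in> borel_measurable M" unfolding o by (rule linear_stat_measurable) (rule f)
  show m2: "pooled_part k n \<in> borel_measurable M" unfolding pooled_part_def by (rule linear_stat_measurable) measurable
  have s4: "sqrt 4 = 2" by simp
  note L1 = linear_stat_second_moment[of f 2 4 n, OF f V[OF f(2) f(1)]]
  note L2 = linear_stat_second_moment[of "centered_sign_mean k" 2 4 n, OF csm_measurable csm_bound csm_integral V[OF csm_bound csm_measurable]]
  show "integrable M (\<lambda>\<omega>. norm (own_part l k n \<omega>))" "expectation (\<lambda>\<omega>. norm (own_part l k n \<omega>)) \<le> 2"
    using expectation_norm_le_sqrt[OF m1 L1[folded o]] unfolding s4 by auto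
  show "integrable M (\<lambda>\<omega>. norm (pooled_part k n \<omega>))" "expectation (\<lambda>\<omega>. norm (pooled_part k n \<omega>)) \<le> 2"
    using expectation_norm_le_sqrt[OF m2 L2[folded pooled_part_def]] unfolding s4 by auto
qed

text \<open>The constant is \<open>32 = 2 * 4\<^sup>2\<close>, with 4 the bound on the kernel. The
  double sum has second moment at most \<open>32 * N n k * n\<close>, and the squared normalization
  \<open>1 / (N n k * n\<^sup>2)\<close> leaves \<open>32 / n\<close>.\<close>

lemma degenerate_part_moments:
  shows "degenerate_part k n \<in> borel_measurable M" "integrable M (\<lambda>\<omega>. norm (degenerate_part k n \<omega>))"
    "expectation (\<lambda>\<omega>. norm (degenerate_part k n \<omega>)) \<le> sqrt (32 / real n)"
proof -
  interpret indep_family M XX "idx n" by (rule family)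
  define J where "J = {k} \<times> {1..N n k}"
  have J: "J \<subseteq> idx n" "card J = N n k" unfolding J_def idx_def by (auto simp: card_cartesian_product)
  define d where "d p q = degenerate_kernel (fst p) (fst q)" for p q :: "'k \<times> nat"
  define T where "T \<omega> = (\<Sum>(p, q)\<in>J \<times> idx n. d p q (XX p \<omega>) (XX q \<omega>))" for \<omega>
  define c where "c = 1 / (sqrt (real (N n k)) * real n)"
  have D: "degenerate_part k n \<omega> = c *\<^sub>R T \<omega>" for \<omega>
    unfolding degenerate_part_def T_def c_def J_def d_def ..
  have dm: "case_prod (d p q) \<in> borel_measurable (borel \<Otimes>\<^sub>M borel)" for p q
    unfolding d_def by (rule degenerate_kernel_measurable)
  have dB: "norm (d p q x y) \<le> 4" for p q x y unfolding d_def by (rule degenerate_kernel_bound)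
  have z1: "(\<integral>x. d p q x y \<partial>law p) = 0" if "p \<in> idx n" "q \<in> idx n" for p q y
    unfolding d_def law_XX[OF that(1)] by (rule degenerate_kernel_integral1)
  have z2: "(\<integral>y. d p q x y \<partial>law q) = 0" if "p \<in> idx n" "q \<in> idx n" for p q x
    unfolding d_def law_XX[OF that(2)] by (rule degenerate_kernel_integral2)
  have dg: "d p p x x = 0" for p x unfolding d_def degenerate_kernel_def by simp
  note U = degenerate_U_statistic_bound[of d 4 J, OF dm dB z1 z2 dg J(1)]
  have Tm[measurable]: "T \<in> borel_measurable M"
    unfolding T_def[abs_def]
  proof (rule borel_measurable_sum)
    fix r assume "r \<in> J \<times> idx n"
    then obtain p q where r: "r = (p, q)" and "p \<in> idx n" "q \<in> idx n" using J(1) by blast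
    then have "(\<lambda>\<omega>. d p q (XX p \<omega>) (XX q \<omega>)) \<in> borel_measurable M"
      by (intro borel_measurable_case_prod_compose[OF dm] X_measurable)
    then show "(\<lambda>\<omega>. case r of (p, q) \<Rightarrow> d p q (XX p \<omega>) (XX q \<omega>)) \<in> borel_measurable M"
      unfolding r prod.case .
  qed
  have i: "integrable M (\<lambda>\<omega>. (norm (T \<omega>))\<^sup>2)" and le: "expectation (\<lambda>\<omega>. (norm (T \<omega>))\<^sup>2) \<le> 32 * real (N n k) * real n"
    using U unfolding T_def J(2) card_idx by auto
  have sq: "(norm (degenerate_part k n \<omega>))\<^sup>2 = c\<^sup>2 * (norm (T \<omega>))\<^sup>2" for \<omega>
    unfolding D by (simp add: power_mult_distrib)
  show m: "degenerate_part k n \<in> borel_measurable M"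
    unfolding D[abs_def] by measurable
  have i': "integrable M (\<lambda>\<omega>. (norm (degenerate_part k n \<omega>))\<^sup>2)" unfolding sq using i by simp
  have "expectation (\<lambda>\<omega>. (norm (degenerate_part k n \<omega>))\<^sup>2) \<le> c\<^sup>2 * (32 * real (N n k) * real n)"
    unfolding sq using le by (simp add: mult_left_mono)
  also have "\<dots> \<le> 32 / real n"
  \<comment> \<open>An empty group or \<open>n = 0\<close> makes \<open>c = 0\<close> by division by
    zero.\<close>
  proof (cases "N n k = 0 \<or> n = 0")
    case False
    show ?thesis
    proof -
      have "c\<^sup>2 = 1 / (real (N n k) * (real n)\<^sup>2)"
        unfolding c_def by (simp add: power_divide power_mult_distrib)
      then show ?thesis using False by (simp add: power2_eq_square)
    qed
  qed (auto simp: c_def)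
  finally have le': "expectation (\<lambda>\<omega>. (norm (degenerate_part k n \<omega>))\<^sup>2) \<le> 32 / real n" .
  show "integrable M (\<lambda>\<omega>. norm (degenerate_part k n \<omega>))"
    "expectation (\<lambda>\<omega>. norm (degenerate_part k n \<omega>)) \<le> sqrt (32 / real n)"
    by (rule expectation_norm_le_sqrt[OF m i' le'])+
qed

lemma sum_idx_own:
  "(\<Sum>p\<in>idx n. if fst p = k then f (XX p \<omega>) else 0) = (\<Sum>i=1..N n k. f (X k i \<omega>))"
proof -
  have "(\<Sum>p\<in>idx n. if fst p = k then f (XX p \<omega>) else 0) = (\<Sum>(a, i)\<in>idx n. if a = k then f (X a i \<omega>) else 0)"
    by (intro sum.cong) auto
  also have "\<dots> = (\<Sum>a\<in>UNIV. \<Sum>i\<in>{1..N n a}. if a = k then f (X a i \<omega>) else 0)"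
    unfolding idx_def by (rule sum.Sigma[symmetric]) auto
  also have "\<dots> = (\<Sum>a\<in>UNIV. if a = k then (\<Sum>i\<in>{1..N n a}. f (X a i \<omega>)) else 0)"
    by (intro sum.cong) auto
  finally show ?thesis by simp
qed

lemma own_part_eq: "own_part l k n \<omega> = (1 / sqrt (real n)) *\<^sub>R (\<Sum>i=1..N n k. centered_sign_mean l k (X k i \<omega>))"
  unfolding own_part_def linear_stat_def scaleR_sum_right[symmetric] by (simp only: sum_idx_own)

lemma pooled_part_eq: "pooled_part k n \<omega> = (1 / sqrt (real n)) *\<^sub>R (\<Sum>q\<in>idx n. centered_sign_mean k (fst q) (XX q \<omega>))"
  unfolding pooled_part_def linear_stat_def scaleR_sum_right[symmetric] ..

lemma linear_stat_score:
  "linear_stat score n \<omega> $ k = (\<Sum>l\<in>UNIV. (lam l / sqrt (lam k)) *\<^sub>R own_part l k n \<omega>) - sqrt (lam k) *\<^sub>R pooled_part k n \<omega>"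
proof -
  define s where "s = 1 / sqrt (real n)"
  have "linear_stat score n \<omega> $ k
      = (\<Sum>p\<in>idx n. s *\<^sub>R ((if fst p = k then \<Sum>l\<in>UNIV. (lam l / sqrt (lam k)) *\<^sub>R centered_sign_mean l k (XX p \<omega>) else 0)
          - sqrt (lam k) *\<^sub>R centered_sign_mean k (fst p) (XX p \<omega>)))"
    unfolding linear_stat_def s_def by (simp add: score_def)
  also have "\<dots> = s *\<^sub>R ((\<Sum>p\<in>idx n. if fst p = k then \<Sum>l\<in>UNIV. (lam l / sqrt (lam k)) *\<^sub>R centered_sign_mean l k (XX p \<omega>) else 0)
     - sqrt (lam k) *\<^sub>R (\<Sum>p\<in>idx n. centered_sign_mean k (fst p) (XX p \<omega>)))"
    by (simp only: scaleR_sum_right[symmetric] sum_subtractf)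
  also have "(\<Sum>p\<in>idx n. if fst p = k then \<Sum>l\<in>UNIV. (lam l / sqrt (lam k)) *\<^sub>R centered_sign_mean l k (XX p \<omega>) else 0)
      = (\<Sum>i=1..N n k. \<Sum>l\<in>UNIV. (lam l / sqrt (lam k)) *\<^sub>R centered_sign_mean l k (X k i \<omega>))"
    by (rule sum_idx_own)
  also have "\<dots> = (\<Sum>l\<in>UNIV. (lam l / sqrt (lam k)) *\<^sub>R (\<Sum>i=1..N n k. centered_sign_mean l k (X k i \<omega>)))"
    unfolding scaleR_sum_right by (rule sum.swap)
  finally show ?thesis
    unfolding own_part_eq pooled_part_eq s_def[symmetric]
    by (simp add: scaleR_diff_right scaleR_sum_right mult.commute)
qed

text \<open>The deterministic remainder of the decomposition; \<open>tendsto_L1_centered\<close>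
  later exchanges it for the mean.\<close>

definition rank_center :: "nat \<Rightarrow> 'h ^ 'k" where
  "rank_center n = (\<chi> k. (sqrt (real (N n k)) / real n) *\<^sub>R (\<Sum>l\<in>UNIV. real (N n l) *\<^sub>R sign_mean_mean k l))"

text \<open>An exact identity for finite \<open>n\<close>. Apart from the degenerate term and the
  centre it differs from \<open>linear_stat_score\<close> only in having \<open>\<rho>\<close> in
  place of \<open>lam\<close>, so that the limit passage concerns coefficients alone.\<close>

lemma rank_vector_decomposition:
  assumes pos: "N n k > 0"
  defines "\<rho> \<equiv> \<lambda>l. real (N n l) / real n"
  shows "rank_vector (\<lambda>k i. X k i \<omega>) (N n) $ k = degenerate_part k n \<omega>
     + (\<Sum>l\<in>UNIV. (\<rho> l / sqrt (\<rho> k)) *\<^sub>R own_part l k n \<omega>) - sqrt (\<rho> k) *\<^sub>R pooled_part k n \<omega> + rank_center n $ k"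
proof -
  define c where "c = 1 / (sqrt (real (N n k)) * real n)"
  have "N n k \<le> (\<Sum>l\<in>UNIV. N n l)" by (rule member_le_sum) auto
  then have n: "n > 0" using pos sum_N[of n] by simp
  have "c * real (N n k) = (real (N n k) / sqrt (real (N n k))) / real n"
    unfolding c_def by simp
  then have ck: "c * real (N n k) = sqrt (real (N n k)) / real n"
    by (simp add: real_div_sqrt)
  have q: "(\<Sum>l\<in>UNIV. \<Sum>j=1..N n l. sgn (z - X l j \<omega>)) = (\<Sum>q\<in>idx n. sgn (z - XX q \<omega>))" for z
    unfolding idx_def by (subst sum.Sigma) (auto intro!: sum.cong)
  have "rank_vector (\<lambda>k i. X k i \<omega>) (N n) $ k
     = (sqrt (real (N n k)) * (1 / real (N n k)) * (1 / real n)) *\<^sub>R (\<Sum>i=1..N n k. \<Sum>q\<in>idx n. sgn (X k i \<omega> - XX q \<omega>))"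
    unfolding rank_vector_def mean_rank_def spatial_rank_def sum_N q
    by (simp add: scaleR_sum_right[symmetric])
  also have "sqrt (real (N n k)) * (1 / real (N n k)) * (1 / real n) = c"
    unfolding c_def using pos n by (simp add: field_simps)
  also have "(\<Sum>i=1..N n k. \<Sum>q\<in>idx n. sgn (X k i \<omega> - XX q \<omega>))
      = (\<Sum>i=1..N n k. \<Sum>q\<in>idx n. degenerate_kernel k (fst q) (X k i \<omega>) (XX q \<omega>))
        + (\<Sum>i=1..N n k. \<Sum>l\<in>UNIV. real (N n l) *\<^sub>R centered_sign_mean l k (X k i \<omega>))
        - real (N n k) *\<^sub>R (\<Sum>q\<in>idx n. centered_sign_mean k (fst q) (XX q \<omega>))
        + real (N n k) *\<^sub>R (\<Sum>l\<in>UNIV. real (N n l) *\<^sub>R sign_mean_mean k l)"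
    (is "?S = ?D + ?A - ?B + ?C")
  proof -
    have "?S = (\<Sum>i=1..N n k. \<Sum>q\<in>idx n. degenerate_kernel k (fst q) (X k i \<omega>) (XX q \<omega>)
        + centered_sign_mean (fst q) k (X k i \<omega>) - centered_sign_mean k (fst q) (XX q \<omega>) + sign_mean_mean k (fst q))"
      by (intro sum.cong refl sgn_decomposition)
    also have "\<dots> = ?D + (\<Sum>i=1..N n k. \<Sum>q\<in>idx n. centered_sign_mean (fst q) k (X k i \<omega>))
       - (\<Sum>i=1..N n k. \<Sum>q\<in>idx n. centered_sign_mean k (fst q) (XX q \<omega>)) + (\<Sum>i=1..N n k. \<Sum>q\<in>idx n. sign_mean_mean k (fst q))"
      by (simp only: sum.distrib sum_subtractf)
    also have "\<dots> = ?D + ?A - ?B + ?C"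
      using sum_idx[of "\<lambda>l. centered_sign_mean l k x" n for x] sum_idx[of "sign_mean_mean k" n]
      by (simp add: sum_constant_scaleR)
    finally show ?thesis .
  qed
  also have "c *\<^sub>R (?D + ?A - ?B + ?C) = c *\<^sub>R ?D + c *\<^sub>R ?A - c *\<^sub>R ?B + c *\<^sub>R ?C"
    by (simp add: scaleR_add_right scaleR_diff_right)
  also have "c *\<^sub>R ?D = degenerate_part k n \<omega>"
  proof -
    have "(\<Sum>(p, q)\<in>({k} \<times> {1..N n k}) \<times> idx n. degenerate_kernel (fst p) (fst q) (XX p \<omega>) (XX q \<omega>))
        = (\<Sum>p\<in>{k} \<times> {1..N n k}. \<Sum>q\<in>idx n. degenerate_kernel (fst p) (fst q) (XX p \<omega>) (XX q \<omega>))"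
      by (rule sum.cartesian_product[symmetric])
    also have "\<dots> = ?D"
    proof -
      have "(\<Sum>p\<in>{k} \<times> {1..N n k}. G p) = (\<Sum>i=1..N n k. G (k, i))" for G :: "'k \<times> nat \<Rightarrow> 'h"
        by (rule sum.reindex_bij_witness[of _ "Pair k" snd]) auto
      then show ?thesis by simp
    qed
    finally show ?thesis unfolding degenerate_part_def c_def by (simp only:)
  qed
  also have "c *\<^sub>R ?A = (\<Sum>l\<in>UNIV. (\<rho> l / sqrt (\<rho> k)) *\<^sub>R own_part l k n \<omega>)"
  proof -
    \<comment> \<open>The weight splits into a coefficient that converges and the normalization
      built into \<open>linear_stat\<close>.\<close>
    have e: "c * real (N n l) = (\<rho> l / sqrt (\<rho> k)) * (1 / sqrt (real n))" for l
      unfolding c_def \<rho>_def using pos n by (simp add: real_sqrt_divide field_simps)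
    have "c *\<^sub>R ?A = (\<Sum>l\<in>UNIV. (c * real (N n l)) *\<^sub>R (\<Sum>i=1..N n k. centered_sign_mean l k (X k i \<omega>)))"
      by (subst sum.swap) (simp add: scaleR_sum_right)
    then show ?thesis unfolding e own_part_eq by simp
  qed
  also have "c *\<^sub>R ?B = sqrt (\<rho> k) *\<^sub>R pooled_part k n \<omega>"
  proof -
    have "c * real (N n k) = sqrt (real (N n k)) / real n" by (rule ck)
    also have "\<dots> = sqrt (\<rho> k) * (1 / sqrt (real n))"
      unfolding \<rho>_def using n by (simp add: real_sqrt_divide)
    finally show ?thesis unfolding pooled_part_eq by simp
  qed
  also have "c *\<^sub>R ?C = rank_center n $ k"
  proof -
    from ck show ?thesis unfolding rank_center_def by simp
  qed
  finally show ?thesis .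
qed

end

section \<open>Measurability, boundedness and centring of the rank vector\<close>

lemma rank_vector_measurable:
  fixes X :: "'k::finite \<Rightarrow> nat \<Rightarrow> 'w \<Rightarrow> 'h::{real_inner, banach, second_countable_topology}"
  assumes "\<And>k i. i \<in> {1..m k} \<Longrightarrow> X k i \<in> borel_measurable M"
  shows "(\<lambda>\<omega>. rank_vector (\<lambda>k i. X k i \<omega>) m) \<in> borel_measurable M"
proof -
  have sg: "(\<lambda>\<omega>. sgn (X k i \<omega> - X l j \<omega>)) \<in> borel_measurable M" if "i \<in> {1..m k}" "j \<in> {1..m l}" for k i l j
    using measurable_compose[OF measurable_Pair[OF assms[OF that(1)] assms[OF that(2)]] borel_measurable_sgn_diff] by simp
  show ?thesis
    unfolding rank_vector_def mean_rank_def spatial_rank_def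
    by (intro borel_measurable_vec_lambda borel_measurable_scaleR borel_measurable_const borel_measurable_sum sg)
qed

lemma norm_spatial_rank_le: "norm (spatial_rank x m z) \<le> 1"
proof -
  have "norm (\<Sum>k\<in>UNIV. \<Sum>i=1..m k. sgn (z - x k i)) \<le> (\<Sum>k\<in>UNIV. \<Sum>i=1..m k. 1)"
    by (intro sum_norm_le norm_sgn_le)
  also have "\<dots> = real (\<Sum>k\<in>UNIV. m k)" by simp
  finally show ?thesis unfolding spatial_rank_def
    by (cases "(\<Sum>k\<in>UNIV. m k) = 0") (auto simp: divide_le_eq simp del: of_nat_sum sum_eq_0_iff)
qed

lemma norm_rank_vector_le: "norm (rank_vector x m) \<le> (\<Sum>k\<in>UNIV. sqrt (real (m k)))"
proof -
  have "norm (rank_vector x m $ k) \<le> sqrt (real (m k))" for k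
  proof -
    have "norm (\<Sum>i=1..m k. spatial_rank x m (x k i)) \<le> (\<Sum>i=1..m k. 1)"
      by (intro sum_norm_le norm_spatial_rank_le)
    then have "norm (mean_rank x m k) \<le> 1"
      unfolding mean_rank_def by (cases "m k = 0") (auto simp: divide_le_eq)
    then show ?thesis unfolding rank_vector_def by (simp add: mult_left_le)
  qed
  then show ?thesis by (intro order_trans[OF norm_vec_le_sum] sum_mono) auto
qed

text \<open>A deterministic centre can be exchanged for the mean at the price of a factor 2:
  subtracting its expectation from a variable at most doubles the mean norm, and \<open>L n\<close>
  has mean 0.\<close>

lemma (in prob_space) tendsto_L1_centered:
  fixes U L :: "nat \<Rightarrow> 'a \<Rightarrow> 'b::{banach, second_countable_topology}"
  assumes U: "\<And>n. integrable M (U n)" and L: "\<And>n. integrable M (L n)" and L0: "\<And>n. expectation (L n) = 0"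
    and lim: "(\<lambda>n. expectation (\<lambda>\<omega>. norm (U n \<omega> - c n - L n \<omega>))) \<longlonglongrightarrow> 0"
  shows "integrable M (\<lambda>\<omega>. norm (U n \<omega> - expectation (U n) - L n \<omega>))"
    "(\<lambda>n. expectation (\<lambda>\<omega>. norm (U n \<omega> - expectation (U n) - L n \<omega>))) \<longlonglongrightarrow> 0"
proof -
  let ?N = "\<lambda>n. expectation (\<lambda>\<omega>. norm (U n \<omega> - expectation (U n) - L n \<omega>))"
  show int: "integrable M (\<lambda>\<omega>. norm (U n \<omega> - expectation (U n) - L n \<omega>))" for n
    using U L by auto
  have le: "?N n
      \<le> 2 * expectation (\<lambda>\<omega>. norm (U n \<omega> - c n - L n \<omega>))" for n
  proof -
    define R where "R \<omega> = U n \<omega> - c n - L n \<omega>" for \<omega>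
    have iR: "integrable M R" unfolding R_def[abs_def] using U L by auto
    have ER: "expectation R = expectation (U n) - c n"
      unfolding R_def[abs_def] using U[of n] L[of n] L0[of n] by (simp add: prob_space)
    have "?N n = expectation (\<lambda>\<omega>. norm (R \<omega> - expectation R))"
      unfolding ER by (simp add: R_def algebra_simps)
    also have "\<dots> \<le> expectation (\<lambda>\<omega>. norm (R \<omega>) + norm (expectation R))"
      using iR by (intro integral_mono norm_triangle_ineq4) auto
    also have "\<dots> = expectation (\<lambda>\<omega>. norm (R \<omega>)) + norm (expectation R)"
      using iR by (simp add: prob_space)
    also have "\<dots> \<le> 2 * expectation (\<lambda>\<omega>. norm (R \<omega>))"
      using integral_norm_bound[of M R] by simp
    finally show ?thesis unfolding R_def .
  qed
  show "(\<lambda>n. expectation (\<lambda>\<omega>. norm (U n \<omega> - expectation (U n) - L n \<omega>))) \<longlonglongrightarrow> 0"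
    by (rule tendsto_sandwich[OF _ _ tendsto_const tendsto_mult_right_zero[OF lim, of 2]])
      (use le in \<open>auto intro!: always_eventually\<close>)
qed

section \<open>Reduction to the linear statistic and weak convergence\<close>

context k_sample
begin

abbreviation U_stat :: "nat \<Rightarrow> 'w \<Rightarrow> 'h ^ 'k" where
  "U_stat n \<omega> \<equiv> rank_vector (\<lambda>k i. X k i \<omega>) (N n)"

lemma U_stat_measurable: "U_stat n \<in> borel_measurable M"
proof (rule rank_vector_measurable)
  fix k i assume "i \<in> {1..N n k}"
  then have "(k, i) \<in> idx n" unfolding idx_def by simp
  from XX_measurable[OF this] show "X k i \<in> borel_measurable M" by simp
qed

lemma U_stat_integrable: "integrable M (U_stat n)"
  by (rule integrable_bounded[OF U_stat_measurable norm_rank_vector_le])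

lemma score_measurable: "score a \<in> borel_measurable borel"
  unfolding score_def[abs_def]
proof (rule borel_measurable_vec_lambda)
  fix k
  have "(\<lambda>x. \<Sum>l\<in>UNIV. (lam l / sqrt (lam k)) *\<^sub>R centered_sign_mean l k x) \<in> borel_measurable borel"
    by (intro borel_measurable_sum borel_measurable_scaleR borel_measurable_const csm_measurable)
  moreover have "(\<lambda>x. sqrt (lam k) *\<^sub>R centered_sign_mean k a x) \<in> borel_measurable borel"
    by (intro borel_measurable_scaleR borel_measurable_const csm_measurable)
  ultimately show "(\<lambda>x. (if a = k then \<Sum>l\<in>UNIV. (lam l / sqrt (lam k)) *\<^sub>R centered_sign_mean l k x else 0)
     - sqrt (lam k) *\<^sub>R centered_sign_mean k a x) \<in> borel_measurable borel"
    by (cases "a = k") (simp_all add: borel_measurable_diff)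
qed

lemma score_bound: "\<exists>B. \<forall>a x. norm (score a x) \<le> B"
proof -
  define B where "B = (\<Sum>k\<in>UNIV. (\<Sum>l\<in>UNIV. \<bar>lam l / sqrt (lam k)\<bar> * 2) + \<bar>sqrt (lam k)\<bar> * 2)"
  have "norm (score a x $ k) \<le> (\<Sum>l\<in>UNIV. \<bar>lam l / sqrt (lam k)\<bar> * 2) + \<bar>sqrt (lam k)\<bar> * 2" for a x k
  proof -
    have 1: "norm (if a = k then \<Sum>l\<in>UNIV. (lam l / sqrt (lam k)) *\<^sub>R centered_sign_mean l k x else 0)
       \<le> (\<Sum>l\<in>UNIV. \<bar>lam l / sqrt (lam k)\<bar> * 2)"
      using csm_bound by (auto intro!: sum_norm_le sum_nonneg mult_left_mono simp del: abs_divide)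
    have 2: "norm (sqrt (lam k) *\<^sub>R centered_sign_mean k a x) \<le> \<bar>sqrt (lam k)\<bar> * 2"
      unfolding norm_scaleR by (intro mult_left_mono csm_bound) simp
    show ?thesis unfolding score_def vec_lambda_beta
      by (rule order_trans[OF norm_triangle_ineq4 add_mono[OF 1 2]])
  qed
  then have "norm (score a x) \<le> B" for a x
    unfolding B_def by (intro order_trans[OF norm_vec_le_sum] sum_mono)
  then show ?thesis by blast
qed

lemma score_integral: "(\<integral>x. score a x \<partial>P a) = 0"
proof -
  obtain B where B: "\<And>a x. norm (score a x) \<le> B" using score_bound by blast
  have i: "integrable (P a) (score a)"
    by (rule integrable_P[OF score_measurable B])
  have ic: "integrable (P a) (centered_sign_mean l b)" for l b
    by (rule integrable_P[OF csm_measurable csm_bound])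
  have "(\<integral>x. score a x \<partial>P a) $ k = 0" for k
  proof -
    have "(\<integral>x. score a x \<partial>P a) $ k = (\<integral>x. score a x $ k \<partial>P a)"
      using integral_bounded_linear[OF bounded_linear_vec_nth i] by metis
    also have "\<dots> = (if a = k then \<Sum>l\<in>UNIV. (lam l / sqrt (lam k)) *\<^sub>R (\<integral>x. centered_sign_mean l k x \<partial>P a) else 0)
       - sqrt (lam k) *\<^sub>R (\<integral>x. centered_sign_mean k a x \<partial>P a)"
      unfolding score_def vec_lambda_beta using ic
      by (cases "a = k") (simp_all add: Bochner_Integration.integral_sum)
    finally show ?thesis by (simp add: csm_integral)
  qed
  then show ?thesis by (simp add: vec_eq_iff)
qed

text \<open>The error consists of the degenerate part and of coefficient errors that multiply
  statistics bounded in mean. The exact decomposition requires nonempty groups, which is the case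
  for large \<open>n\<close>.\<close>

lemma U_stat_approximation:
  "(\<lambda>n. expectation (\<lambda>\<omega>. norm (U_stat n \<omega> - rank_center n - linear_stat score n \<omega>))) \<longlonglongrightarrow> 0"
proof -
  let ?R = "\<lambda>n \<omega>. U_stat n \<omega> - rank_center n - linear_stat score n \<omega>"
  define \<rho> where "\<rho> n l = real (N n l) / real n" for n l
  define \<alpha> where "\<alpha> n k l = \<bar>\<rho> n l / sqrt (\<rho> n k) - lam l / sqrt (lam k)\<bar>" for n k l
  define \<beta> where "\<beta> n k = \<bar>sqrt (\<rho> n k) - sqrt (lam k)\<bar>" for n k
  \<comment> \<open>The factors 2 are the mean norm bounds for the own and the pooled parts, and the
    square root is the bound for the degenerate part.\<close>
  define E where "E n = (\<Sum>k\<in>UNIV. sqrt (32 / real n) + (\<Sum>l\<in>UNIV. \<alpha> n k l * 2) + \<beta> n k * 2)" for n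
  have le: "\<forall>\<^sub>F n in sequentially. expectation (\<lambda>\<omega>. norm (?R n \<omega>)) \<le> E n"
    using eventually_groups_nonempty
  proof eventually_elim
    case (elim n)
    define b where "b \<omega> = (\<Sum>k\<in>UNIV. norm (degenerate_part k n \<omega>) + (\<Sum>l\<in>UNIV. \<alpha> n k l * norm (own_part l k n \<omega>))
        + \<beta> n k * norm (pooled_part k n \<omega>))" for \<omega>
    have "norm (?R n \<omega> $ k)
       \<le> norm (degenerate_part k n \<omega>) + (\<Sum>l\<in>UNIV. \<alpha> n k l * norm (own_part l k n \<omega>)) + \<beta> n k * norm (pooled_part k n \<omega>)" for \<omega> k
    proof -
      have e: "?R n \<omega> $ k
        = degenerate_part k n \<omega> + (\<Sum>l\<in>UNIV. (\<rho> n l / sqrt (\<rho> n k) - lam l / sqrt (lam k)) *\<^sub>R own_part l k n \<omega>)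
          - (sqrt (\<rho> n k) - sqrt (lam k)) *\<^sub>R pooled_part k n \<omega>"
        unfolding vector_minus_component linear_stat_score rank_vector_decomposition[OF elim[rule_format]] \<rho>_def
        by (simp add: scaleR_diff_left sum_subtractf)
      have "norm (?R n \<omega> $ k) \<le> norm (degenerate_part k n \<omega>)
          + norm (\<Sum>l\<in>UNIV. (\<rho> n l / sqrt (\<rho> n k) - lam l / sqrt (lam k)) *\<^sub>R own_part l k n \<omega>)
          + norm ((sqrt (\<rho> n k) - sqrt (lam k)) *\<^sub>R pooled_part k n \<omega>)"
        unfolding e by (rule order_trans[OF norm_triangle_ineq4 add_right_mono[OF norm_triangle_ineq]])
      also have "\<dots> \<le> norm (degenerate_part k n \<omega>) + (\<Sum>l\<in>UNIV. \<alpha> n k l * norm (own_part l k n \<omega>)) + \<beta> n k * norm (pooled_part k n \<omega>)"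
      proof -
        have "norm (\<Sum>l\<in>UNIV. (\<rho> n l / sqrt (\<rho> n k) - lam l / sqrt (lam k)) *\<^sub>R own_part l k n \<omega>)
            \<le> (\<Sum>l\<in>UNIV. \<alpha> n k l * norm (own_part l k n \<omega>))"
          by (rule sum_norm_le) (simp only: \<alpha>_def norm_scaleR order_refl)
        moreover have "norm ((sqrt (\<rho> n k) - sqrt (lam k)) *\<^sub>R pooled_part k n \<omega>) = \<beta> n k * norm (pooled_part k n \<omega>)"
          by (simp only: \<beta>_def norm_scaleR)
        ultimately show ?thesis by linarith
      qed
      finally show ?thesis .
    qed
    then have nb: "norm (?R n \<omega>) \<le> b \<omega>" for \<omega>
      unfolding b_def by (intro order_trans[OF norm_vec_le_sum] sum_mono)
    have ib: "integrable M b"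
      unfolding b_def[abs_def]
      by (intro Bochner_Integration.integrable_sum Bochner_Integration.integrable_add integrable_mult_right
          parts_moments degenerate_part_moments)
    have "expectation (\<lambda>\<omega>. norm (?R n \<omega>)) \<le> expectation b"
      by (rule integral_mono_AE') (use ib nb order_trans[OF norm_ge_zero nb] in auto)
    also have "\<dots> = (\<Sum>k\<in>UNIV. expectation (\<lambda>\<omega>. norm (degenerate_part k n \<omega>))
        + (\<Sum>l\<in>UNIV. \<alpha> n k l * expectation (\<lambda>\<omega>. norm (own_part l k n \<omega>))) + \<beta> n k * expectation (\<lambda>\<omega>. norm (pooled_part k n \<omega>)))"
      unfolding b_def[abs_def] using parts_moments(2,5) degenerate_part_moments(2)
      by (simp add: Bochner_Integration.integral_sum Bochner_Integration.integrable_sum)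
    also have "\<dots> \<le> E n"
      unfolding E_def
      by (intro sum_mono add_mono mult_left_mono degenerate_part_moments(3) parts_moments(3,6))
        (auto simp: \<alpha>_def \<beta>_def)
    finally show ?case .
  qed
  have E0: "E \<longlonglongrightarrow> 0"
  proof -
    have \<rho>: "(\<lambda>n. \<rho> n k) \<longlonglongrightarrow> lam k" for k unfolding \<rho>_def by (rule lam_lim)
    have a: "(\<lambda>n. \<alpha> n k l) \<longlonglongrightarrow> 0" for k l
    proof -
      have "(\<lambda>n. \<alpha> n k l) \<longlonglongrightarrow> \<bar>lam l / sqrt (lam k) - lam l / sqrt (lam k)\<bar>"
        unfolding \<alpha>_def using lam_pos[of k] by (intro tendsto_intros \<rho>) auto
      then show ?thesis by simp
    qed
    have b: "(\<lambda>n. \<beta> n k) \<longlonglongrightarrow> 0" for k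
    proof -
      have "(\<lambda>n. \<beta> n k) \<longlonglongrightarrow> \<bar>sqrt (lam k) - sqrt (lam k)\<bar>"
        unfolding \<beta>_def by (intro tendsto_intros \<rho>)
      then show ?thesis by simp
    qed
    have c: "(\<lambda>n. sqrt (32 / real n)) \<longlonglongrightarrow> 0"
      using tendsto_real_sqrt[OF lim_const_over_n[of 32]] by simp
    have "E \<longlonglongrightarrow> (\<Sum>k\<in>(UNIV::'k set). 0 + (\<Sum>l\<in>(UNIV::'k set). 0 * 2) + 0 * 2)"
      unfolding E_def[abs_def] by (intro tendsto_sum tendsto_add tendsto_mult tendsto_const a b c)
    then show ?thesis by simp
  qed
  show ?thesis
    by (rule tendsto_sandwich[OF _ le tendsto_const E0]) simp
qed

text \<open>
  One observation from each group, with weights \<open>sqrt (lam a)\<close>, has the limit covariance.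
\<close>

lemma score_covariance_witness:
  obtains Z :: "'w \<Rightarrow> 'h ^ 'k" and B where "Z \<in> borel_measurable M" "\<And>\<omega>. norm (Z \<omega>) \<le> B"
    "\<And>w v. (\<integral>\<omega>. (Z \<omega> \<bullet> w) * (Z \<omega> \<bullet> v) \<partial>M) = (\<Sum>a\<in>UNIV. lam a * (\<integral>x. (score a x \<bullet> w) * (score a x \<bullet> v) \<partial>P a))"
proof -
  obtain B where B: "\<And>a x. norm (score a x) \<le> B" using score_bound by blast
  note sm[measurable] = score_measurable
  obtain n where n: "\<And>k. N n k > 0"
    using eventually_groups_nonempty by (auto simp: eventually_sequentially)
  \<comment> \<open>The first observation of each group; it belongs to the sample because
    \<open>n\<close> was taken so large that no group is empty.\<close>
  define J where "J = (\<lambda>a::'k. (a, 1::nat)) ` UNIV"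
  have J: "J \<subseteq> idx n" unfolding J_def idx_def using n by (auto simp: Suc_le_eq)
  have indJ: "indep_family M XX J"
    by unfold_locales (use indep_vars_subset[OF indep_family.ind[OF family] J] in \<open>auto simp: J_def\<close>)
  interpret indep_family M XX J by (rule indJ)
  define b where "b p x = sqrt (lam (fst p)) *\<^sub>R score (fst p) x" for p :: "'k \<times> nat" and x
  define Z where "Z \<omega> = (\<Sum>p\<in>J. b p (XX p \<omega>))" for \<omega>
  have bm[measurable]: "b p \<in> borel_measurable borel" for p unfolding b_def[abs_def] by measurable
  define C where "C = (\<Sum>a\<in>UNIV. sqrt (lam a) * B)"
  have bB: "norm (b p x) \<le> sqrt (lam (fst p)) * B" for p x
    unfolding b_def norm_scaleR using lam_pos[of "fst p"] B by (simp add: mult_left_mono)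
  have lawJ: "law p = P (fst p)" if "p \<in> J" for p using law_XX J that by blast
  have Zm[measurable]: "Z \<in> borel_measurable M"
    unfolding Z_def[abs_def] by (intro borel_measurable_sum measurable_compose[OF X_measurable bm])
  have sJ: "(\<Sum>p\<in>J. f (fst p)) = (\<Sum>a\<in>UNIV. f a)" for f :: "'k \<Rightarrow> real"
    unfolding J_def by (subst sum.reindex) (auto simp: inj_on_def)
  have ZB: "norm (Z \<omega>) \<le> C" for \<omega>
  proof -
    have "norm (Z \<omega>) \<le> (\<Sum>p\<in>J. sqrt (lam (fst p)) * B)" unfolding Z_def by (intro sum_norm_le bB)
    also have "\<dots> = C" unfolding C_def by (rule sJ)
    finally show ?thesis .
  qed
  define D where "D w = (\<Sum>a\<in>UNIV. sqrt (lam a) * (\<bar>B\<bar> * norm w))" for w :: "'h ^ 'k"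
  have bD: "norm (b p x \<bullet> w) \<le> D w" for p x w
  proof -
    have "norm (b p x \<bullet> w) = sqrt (lam (fst p)) * \<bar>score (fst p) x \<bullet> w\<bar>"
      unfolding b_def using lam_pos[of "fst p"] by (simp add: abs_mult)
    also have "\<dots> \<le> sqrt (lam (fst p)) * (\<bar>B\<bar> * norm w)"
      using B[of "fst p" x] lam_pos[of "fst p"] by (intro mult_left_mono norm_inner_le) auto
    also have "\<dots> \<le> D w" unfolding D_def
      by (rule member_le_sum[of "fst p" UNIV "\<lambda>a. sqrt (lam a) * (\<bar>B\<bar> * norm w)"])
        (auto intro!: mult_nonneg_nonneg simp: less_imp_le[OF lam_pos])
    finally show ?thesis .
  qed
  have bil: "(\<integral>\<omega>. (Z \<omega> \<bullet> w) * (Z \<omega> \<bullet> v) \<partial>M) = (\<Sum>a\<in>UNIV. lam a * (\<integral>x. (score a x \<bullet> w) * (score a x \<bullet> v) \<partial>P a))" for w v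
  proof -
    have bz: "(\<integral>x. b p x \<bullet> w \<partial>law p) = 0" if "p \<in> J" for p
      unfolding lawJ[OF that] b_def using integrable_P[OF score_measurable B] score_integral by simp
    have bm': "(\<lambda>x. b p x \<bullet> u) \<in> borel_measurable borel" for p u by measurable
    \<comment> \<open>\<open>covariance_sum\<close> takes one bound valid for both families.\<close>
    have bB': "norm (b p x \<bullet> w) \<le> D w + D v" "norm (b p x \<bullet> v) \<le> D w + D v" for p x
      using bD[of p x w] bD[of p x v] norm_ge_zero[of "b p x \<bullet> w"] norm_ge_zero[of "b p x \<bullet> v"] by linarith+
    have "(\<integral>\<omega>. (Z \<omega> \<bullet> w) * (Z \<omega> \<bullet> v) \<partial>M) = (\<Sum>p\<in>J. \<integral>\<omega>. (b p (XX p \<omega>) \<bullet> w) * (b p (XX p \<omega>) \<bullet> v) \<partial>M)"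
      using covariance_sum(2)[of "\<lambda>p x. b p x \<bullet> w" "\<lambda>p x. b p x \<bullet> v", OF bm' bm' bB'(1) bB'(2) bz]
      unfolding Z_def inner_sum_left inner_real_def .
    also have "\<dots> = (\<Sum>p\<in>J. lam (fst p) * (\<integral>x. (score (fst p) x \<bullet> w) * (score (fst p) x \<bullet> v) \<partial>P (fst p)))"
    proof (rule sum.cong[OF refl])
      fix p assume p: "p \<in> J"
      have "(\<integral>\<omega>. (b p (XX p \<omega>) \<bullet> w) * (b p (XX p \<omega>) \<bullet> v) \<partial>M) = (\<integral>x. (b p x \<bullet> w) * (b p x \<bullet> v) \<partial>law p)"
        by (rule integral_distr[symmetric]) (use p in measurable)
      also have "\<dots> = (\<integral>x. lam (fst p) * ((score (fst p) x \<bullet> w) * (score (fst p) x \<bullet> v)) \<partial>law p)"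
        unfolding b_def using lam_pos[of "fst p"]
        by (intro Bochner_Integration.integral_cong) (auto simp: mult_ac real_sqrt_mult_self less_imp_le)
      finally show "(\<integral>\<omega>. (b p (XX p \<omega>) \<bullet> w) * (b p (XX p \<omega>) \<bullet> v) \<partial>M)
          = lam (fst p) * (\<integral>x. (score (fst p) x \<bullet> w) * (score (fst p) x \<bullet> v) \<partial>P (fst p))"
        unfolding lawJ[OF p] by simp
    qed
    also have "\<dots> = (\<Sum>a\<in>UNIV. lam a * (\<integral>x. (score a x \<bullet> w) * (score a x \<bullet> v) \<partial>P a))" by (rule sJ)
    finally show ?thesis .
  qed
  show thesis by (rule that[OF Zm ZB bil])
qed

text \<open>\<open>S\<close> enters only through its bilinear form, so that the explicit formula for
  the covariance can be verified separately.\<close>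

theorem U_stat_weak_convergence:
  assumes S: "\<And>w v. S w \<bullet> v = (\<Sum>a\<in>UNIV. lam a * (\<integral>x. (score a x \<bullet> w) * (score a x \<bullet> v) \<partial>P a))"
  shows "\<exists>\<nu>. gaussian_measure 0 S \<nu> \<and>
    weakly_converges (\<lambda>n. distr M borel (\<lambda>\<omega>. U_stat n \<omega> - expectation (U_stat n))) \<nu>"
proof -
  obtain B where B: "\<And>a x. norm (score a x) \<le> B" using score_bound by blast
  obtain Z B' where Z: "Z \<in> borel_measurable M" "\<And>\<omega>. norm (Z \<omega>) \<le> B'"
    and Zc: "\<And>w v. (\<integral>\<omega>. (Z \<omega> \<bullet> w) * (Z \<omega> \<bullet> v) \<partial>M) = (\<Sum>a\<in>UNIV. lam a * (\<integral>x. (score a x \<bullet> w) * (score a x \<bullet> v) \<partial>P a))"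
    using score_covariance_witness by blast
  have SZ: "S w \<bullet> v = (\<integral>\<omega>. (Z \<omega> \<bullet> w) * (Z \<omega> \<bullet> v) \<partial>M)" for w v unfolding S Zc ..
  obtain \<nu> where \<nu>: "gaussian_measure 0 S \<nu>"
    and ch: "\<And>w. char (distr \<nu> borel (\<lambda>x. x \<bullet> w)) 1 = exp (- (\<integral>\<omega>. (Z \<omega> \<bullet> w)\<^sup>2 \<partial>M) / 2)"
    using exists_gaussian_measure_of_covariance[OF prob_space_axioms Z SZ] by blast
  have \<nu>': "prob_space \<nu>" "sets \<nu> = sets borel" using \<nu> unfolding gaussian_measure_def by auto
  define L where "L = linear_stat score"
  have Lm[measurable]: "L n \<in> borel_measurable M" for n
    unfolding L_def by (rule linear_stat_measurable) (rule score_measurable)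
  have tight: "tight_seq (\<lambda>n. distr M borel (L n))"
    unfolding L_def by (rule linear_stat_tight[OF score_measurable B score_integral])
  have convL: "weakly_converges (\<lambda>n. distr M borel (L n)) \<nu>"
  proof (rule weakly_converges_char[OF _ _ \<nu>' _ tight])
    show "prob_space (distr M borel (L n))" for n by (rule prob_space_distr) simp
    fix w
    have "char (distr (distr M borel (L n)) borel (\<lambda>x. x \<bullet> w)) 1 = char (distr M borel (\<lambda>\<omega>. L n \<omega> \<bullet> w)) 1" for n
      by (subst distr_distr) (auto simp: comp_def)
    moreover have "(\<Sum>k\<in>UNIV. lam k * (\<integral>x. (score k x \<bullet> w)\<^sup>2 \<partial>P k)) = (\<integral>\<omega>. (Z \<omega> \<bullet> w)\<^sup>2 \<partial>M)"
      using Zc[of w w] by (simp add: power2_eq_square)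
    ultimately show "(\<lambda>n. char (distr (distr M borel (L n)) borel (\<lambda>x. x \<bullet> w)) 1) \<longlonglongrightarrow> char (distr \<nu> borel (\<lambda>x. x \<bullet> w)) 1"
      using linear_stat_char_tendsto[OF score_measurable B score_integral, of w] unfolding ch L_def by simp
  qed simp
  have i2: "integrable M (\<lambda>\<omega>. (norm (L n \<omega>))\<^sup>2)" for n
  proof -
    \<comment> \<open>The sum over the groups serves as a bound that does not depend on the
      group.\<close>
    have "(\<integral>x. (norm (score k x))\<^sup>2 \<partial>P k) \<le> (\<Sum>k\<in>UNIV. \<integral>x. (norm (score k x))\<^sup>2 \<partial>P k)" for k
      by (rule member_le_sum) auto
    from linear_stat_second_moment(1)[OF score_measurable B score_integral this]
    show ?thesis unfolding L_def .
  qed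
  have iL: "integrable M (L n)" for n
    by (rule integrable_of_norm_power2[OF prob_space_axioms Lm i2])
  have L0: "expectation (L n) = 0" for n
  proof -
    have "(\<integral>\<omega>. score (fst p) (XX p \<omega>) \<partial>M) = 0" if p: "p \<in> idx n" for p
    proof -
      have "(\<integral>\<omega>. score (fst p) (XX p \<omega>) \<partial>M) = (\<integral>x. score (fst p) x \<partial>distr M borel (XX p))"
        by (rule integral_distr[symmetric, OF XX_measurable[OF p] score_measurable])
      then show ?thesis unfolding law_XX[OF p] score_integral .
    qed
    moreover have "integrable M (\<lambda>\<omega>. score (fst p) (XX p \<omega>))" if p: "p \<in> idx n" for p
      by (rule integrable_bounded[OF measurable_compose[OF XX_measurable[OF p] score_measurable] B])
    ultimately show ?thesis
      unfolding L_def linear_stat_def by (subst Bochner_Integration.integral_sum) auto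
  qed
  note L1 = tendsto_L1_centered[of U_stat L rank_center, OF U_stat_integrable iL L0 U_stat_approximation[folded L_def]]
  have "weakly_converges (\<lambda>n. distr M borel (\<lambda>\<omega>. U_stat n \<omega> - expectation (U_stat n))) \<nu>"
  proof (rule weakly_converges_Slutsky[OF prob_space_axioms Lm _ tight convL L1])
    show "(\<lambda>\<omega>. U_stat n \<omega> - expectation (U_stat n)) \<in> borel_measurable M" for n
      using U_stat_measurable[of n] by measurable
  qed
  then show ?thesis using \<nu> by blast
qed

end

section \<open>Identification of the limit covariance\<close>

context k_sample
begin

text \<open>The bilinear form of the operator \<open>C i j a\<close> of the theorem, by
  \<open>sign_cov_eq\<close>.\<close>

definition csm_cov :: "'k \<Rightarrow> 'k \<Rightarrow> 'k \<Rightarrow> 'h \<Rightarrow> 'h \<Rightarrow> real" where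
  "csm_cov i j a u v = (\<integral>x. (centered_sign_mean i a x \<bullet> u) * (centered_sign_mean j a x \<bullet> v) \<partial>P a)"

lemma csm_cov_integrable:
  "integrable (P a) (\<lambda>x. (centered_sign_mean i b x \<bullet> u) * (centered_sign_mean j b' x \<bullet> v))"
proof (rule integrable_P[where B="(2 * norm u) * (2 * norm v)"])
  show "norm ((centered_sign_mean i b x \<bullet> u) * (centered_sign_mean j b' x \<bullet> v)) \<le> (2 * norm u) * (2 * norm v)" for x
    unfolding real_norm_def abs_mult by (intro mult_mono norm_inner_le csm_bound) auto
qed simp

lemma csm_cov_bilinear:
  "csm_cov i j a (r *\<^sub>R u - s *\<^sub>R u') (t *\<^sub>R v - q *\<^sub>R v')
    = r * t * csm_cov i j a u v - r * q * csm_cov i j a u v' - s * t * csm_cov i j a u' v + s * q * csm_cov i j a u' v'"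
proof -
  have "csm_cov i j a (r *\<^sub>R u - s *\<^sub>R u') (t *\<^sub>R v - q *\<^sub>R v')
    = (\<integral>x. r * t * ((centered_sign_mean i a x \<bullet> u) * (centered_sign_mean j a x \<bullet> v))
        - r * q * ((centered_sign_mean i a x \<bullet> u) * (centered_sign_mean j a x \<bullet> v'))
        - s * t * ((centered_sign_mean i a x \<bullet> u') * (centered_sign_mean j a x \<bullet> v))
        + s * q * ((centered_sign_mean i a x \<bullet> u') * (centered_sign_mean j a x \<bullet> v')) \<partial>P a)"
    unfolding csm_cov_def
    by (intro Bochner_Integration.integral_cong) (auto simp: inner_diff_right algebra_simps)
  then show ?thesis
    unfolding csm_cov_def using csm_cov_integrable by simp
qed

text \<open>Regrouped by mean sign functions: \<open>centered_sign_mean l a\<close> acts on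
  component \<open>a\<close>, where the observation is ranked, and on component \<open>l\<close>,
  where it is compared with.\<close>

lemma score_inner:
  "score a x \<bullet> w = (\<Sum>l\<in>UNIV. centered_sign_mean l a x \<bullet> ((lam l / sqrt (lam a)) *\<^sub>R w $ a - sqrt (lam l) *\<^sub>R w $ l))"
proof -
  have "score a x \<bullet> w = (\<Sum>k\<in>UNIV. (if k = a then (\<Sum>l\<in>UNIV. (lam l / sqrt (lam a)) *\<^sub>R centered_sign_mean l a x) \<bullet> w $ a else 0)
     - sqrt (lam k) * (centered_sign_mean k a x \<bullet> w $ k))"
    unfolding inner_vec_def score_def by (intro sum.cong) (auto simp: inner_diff_left)
  also have "\<dots> = (\<Sum>l\<in>UNIV. (lam l / sqrt (lam a)) *\<^sub>R centered_sign_mean l a x) \<bullet> w $ a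
     - (\<Sum>k\<in>UNIV. sqrt (lam k) * (centered_sign_mean k a x \<bullet> w $ k))"
    unfolding sum_subtractf by simp
  finally show ?thesis
    by (simp add: inner_diff_right inner_sum_left sum_subtractf)
qed

text \<open>Multiplying out the two-term weights of \<open>score_inner\<close> gives four sums: own
  with own is the term for \<open>k1 = k2\<close>, the mixed ones are \<open>C l k2 k1\<close> and
  \<open>C k1 l k2\<close>, and pooled with pooled is \<open>C k1 k2 l\<close>. In each of them the
  third index is the group of the observation.\<close>

lemma score_covariance:
  assumes C: "\<And>i j k u v. C i j k u \<bullet> v = csm_cov i j k u v"
  shows "matrix_op (limit_cov_entry lam C) w \<bullet> v
    = (\<Sum>a\<in>UNIV. lam a * (\<integral>x. (score a x \<bullet> w) * (score a x \<bullet> v) \<partial>P a))"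
proof -
  define s where "s k = sqrt (lam k)" for k
  have s0: "s k \<noteq> 0" and ss: "s k * s k = lam k" for k
    using lam_pos[of k] by (auto simp: s_def)
  let ?c = csm_cov
  have E: "lam a * (\<integral>x. (score a x \<bullet> w) * (score a x \<bullet> v) \<partial>P a)
    = (\<Sum>l\<in>UNIV. \<Sum>m\<in>UNIV. lam l * lam m * ?c l m a (w $ a) (v $ a))
      - (\<Sum>l\<in>UNIV. \<Sum>m\<in>UNIV. s a * s m * lam l * ?c l m a (w $ a) (v $ m))
      - (\<Sum>l\<in>UNIV. \<Sum>m\<in>UNIV. s l * s a * lam m * ?c l m a (w $ l) (v $ a))
      + (\<Sum>l\<in>UNIV. \<Sum>m\<in>UNIV. s l * s m * lam a * ?c l m a (w $ l) (v $ m))" for a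
  proof -
    define y where "y u l = (lam l / s a) *\<^sub>R u $ a - s l *\<^sub>R u $ l" for u :: "'h ^ 'k" and l
    have "(\<integral>x. (score a x \<bullet> w) * (score a x \<bullet> v) \<partial>P a)
      = (\<integral>x. (\<Sum>l\<in>UNIV. \<Sum>m\<in>UNIV. (centered_sign_mean l a x \<bullet> y w l) * (centered_sign_mean m a x \<bullet> y v m)) \<partial>P a)"
      unfolding score_inner s_def[symmetric] y_def[symmetric] sum_product ..
    also have "\<dots> = (\<Sum>l\<in>UNIV. \<integral>x. (\<Sum>m\<in>UNIV. (centered_sign_mean l a x \<bullet> y w l) * (centered_sign_mean m a x \<bullet> y v m)) \<partial>P a)"
      by (intro Bochner_Integration.integral_sum Bochner_Integration.integrable_sum csm_cov_integrable)
    also have "\<dots> = (\<Sum>l\<in>UNIV. \<Sum>m\<in>UNIV. ?c l m a (y w l) (y v m))"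
      unfolding csm_cov_def by (intro sum.cong refl Bochner_Integration.integral_sum csm_cov_integrable)
    finally have "lam a * (\<integral>x. (score a x \<bullet> w) * (score a x \<bullet> v) \<partial>P a)
      = (\<Sum>l\<in>UNIV. \<Sum>m\<in>UNIV. lam a * ?c l m a (y w l) (y v m))"
      by (simp add: sum_distrib_left)
    also have "\<dots> = (\<Sum>l\<in>UNIV. \<Sum>m\<in>UNIV. lam l * lam m * ?c l m a (w $ a) (v $ a)
        - s a * s m * lam l * ?c l m a (w $ a) (v $ m) - s l * s a * lam m * ?c l m a (w $ l) (v $ a)
        + s l * s m * lam a * ?c l m a (w $ l) (v $ m))"
    \<comment> \<open>The factor \<open>lam a = s a * s a\<close> cancels the denominators
      \<open>s a\<close> of the weights.\<close>
    proof (intro sum.cong refl)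
      fix l m
      show "lam a * ?c l m a (y w l) (y v m) = lam l * lam m * ?c l m a (w $ a) (v $ a)
        - s a * s m * lam l * ?c l m a (w $ a) (v $ m) - s l * s a * lam m * ?c l m a (w $ l) (v $ a)
        + s l * s m * lam a * ?c l m a (w $ l) (v $ m)"
        unfolding y_def csm_cov_bilinear ss[of a, symmetric] using s0[of a] by (simp add: field_simps)
    qed
    finally show ?thesis by (simp only: sum.distrib sum_subtractf)
  qed
  have F: "limit_cov_entry lam C k1 k2 u \<bullet> z
     = (\<Sum>l\<in>UNIV. s k1 * s k2 * lam l * ?c k1 k2 l u z) - (\<Sum>l\<in>UNIV. s k1 * s k2 * lam l * ?c l k2 k1 u z)
       - (\<Sum>l\<in>UNIV. s k1 * s k2 * lam l * ?c k1 l k2 u z)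
       + (if k1 = k2 then \<Sum>l\<in>UNIV. \<Sum>m\<in>UNIV. lam l * lam m * ?c l m k1 u z else 0)" for k1 k2 u z
    unfolding limit_cov_entry_def real_sqrt_mult s_def
    by (auto simp: inner_add_left inner_diff_left inner_sum_left C sum_distrib_left sum_subtractf right_diff_distrib mult.assoc)
  have "matrix_op (limit_cov_entry lam C) w \<bullet> v
     = (\<Sum>k1\<in>UNIV. \<Sum>k2\<in>UNIV. \<Sum>l\<in>UNIV. s k1 * s k2 * lam l * ?c k1 k2 l (w $ k1) (v $ k2))
       - (\<Sum>k1\<in>UNIV. \<Sum>k2\<in>UNIV. \<Sum>l\<in>UNIV. s k1 * s k2 * lam l * ?c l k2 k1 (w $ k1) (v $ k2))
       - (\<Sum>k1\<in>UNIV. \<Sum>k2\<in>UNIV. \<Sum>l\<in>UNIV. s k1 * s k2 * lam l * ?c k1 l k2 (w $ k1) (v $ k2))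
       + (\<Sum>k1\<in>UNIV. \<Sum>l\<in>UNIV. \<Sum>m\<in>UNIV. lam l * lam m * ?c l m k1 (w $ k1) (v $ k1))"
    (is "_ = ?T4 - ?T2 - ?T3 + ?T1")
    unfolding matrix_op_bilinear_form F by (simp add: sum.distrib sum_subtractf)
  \<comment> \<open>The group of the observation is the innermost index here but the outermost one
    in \<open>E\<close>, hence two exchanges of sums.\<close>
  also have "?T4 = (\<Sum>a\<in>UNIV. \<Sum>l\<in>UNIV. \<Sum>m\<in>UNIV. s l * s m * lam a * ?c l m a (w $ l) (v $ m))"
  proof -
    have "?T4 = (\<Sum>k1\<in>UNIV. \<Sum>l\<in>UNIV. \<Sum>k2\<in>UNIV. s k1 * s k2 * lam l * ?c k1 k2 l (w $ k1) (v $ k2))"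
      by (intro sum.cong refl sum.swap)
    also have "\<dots> = (\<Sum>l\<in>UNIV. \<Sum>k1\<in>UNIV. \<Sum>k2\<in>UNIV. s k1 * s k2 * lam l * ?c k1 k2 l (w $ k1) (v $ k2))"
      by (rule sum.swap)
    finally show ?thesis .
  qed
  also have "?T2 = (\<Sum>a\<in>UNIV. \<Sum>l\<in>UNIV. \<Sum>m\<in>UNIV. s a * s m * lam l * ?c l m a (w $ a) (v $ m))"
    by (intro sum.cong refl sum.swap)
  also have "?T3 = (\<Sum>a\<in>UNIV. \<Sum>l\<in>UNIV. \<Sum>m\<in>UNIV. s l * s a * lam m * ?c l m a (w $ l) (v $ a))"
    by (rule sum.swap)
  finally show ?thesis
    unfolding E sum.distrib sum_subtractf by simp
qed

end

theorem theorem2p1: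
  fixes P :: "'k::finite \<Rightarrow> 'h::{real_inner, banach, second_countable_topology} measure"
    and M :: "'w measure" and X :: "'k \<Rightarrow> nat \<Rightarrow> 'w \<Rightarrow> 'h"
    and N :: "nat \<Rightarrow> 'k \<Rightarrow> nat" and lam :: "'k \<Rightarrow> real"
    and T :: "'t measure" and X' Y' Z' :: "'k \<Rightarrow> 't \<Rightarrow> 'h"
    and C :: "'k \<Rightarrow> 'k \<Rightarrow> 'k \<Rightarrow> 'h \<Rightarrow> 'h" and \<Sigma> :: "'h ^ 'k \<Rightarrow> 'h ^ 'k"
    and U :: "nat \<Rightarrow> 'w \<Rightarrow> 'h ^ 'k"
  assumes "CARD('k) \<ge> 2"
    and "\<And>k. prob_space (P k)" and "\<And>k. sets (P k) = sets borel"
    and "\<And>k x. measure (P k) {x} = 0"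
    and "prob_space M"
    and "\<And>n. prob_space.indep_vars M (\<lambda>_. borel) (\<lambda>(k, i). X k i) (SIGMA k:UNIV. {1..N n k})"
    and "\<And>n k i. i \<in> {1..N n k} \<Longrightarrow> distr M borel (X k i) = P k"
    and "\<And>n. (\<Sum>k\<in>UNIV. N n k) = n"
    and "\<And>k. lam k \<in> {0<..<1}"
    and "\<And>k. (\<lambda>n. real (N n k) / real n) \<longlonglongrightarrow> lam k"
    and "prob_space T"
    and "\<And>i j k. prob_space.indep_vars T (\<lambda>_. borel) ((!) [X' i, Y' j, Z' k]) {0, 1, 2}"
    and "\<And>k. distr T borel (X' k) = P k" and "\<And>k. distr T borel (Y' k) = P k"
    and "\<And>k. distr T borel (Z' k) = P k"
  defines "C \<equiv> \<lambda>i j k. sign_cov T (X' i) (Y' j) (Z' k)"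
    and "\<Sigma> \<equiv> matrix_op (limit_cov_entry lam C)"
    and "U \<equiv> \<lambda>n \<omega>. rank_vector (\<lambda>k i. X k i \<omega>) (N n)"
  shows "\<exists>\<nu>. gaussian_measure 0 \<Sigma> \<nu> \<and>
           weakly_converges (\<lambda>n. distr M borel (\<lambda>\<omega>. U n \<omega> - (\<integral>\<omega>'. U n \<omega>' \<partial>M))) \<nu>"
proof -
  interpret k_sample M P X N lam
  proof (intro k_sample.intro k_sample_axioms.intro)
    show "prob_space M" by (rule assms(5))
    show "prob_space (P k)" "sets (P k) = sets borel" for k by (rule assms)+
    show "prob_space.indep_vars M (\<lambda>_. borel) (\<lambda>(k, i). X k i) (SIGMA k:UNIV. {1..N n k})" for n
      by (rule assms(6))
    show "distr M borel (X k i) = P k" if "i \<in> {1..N n k}" for n k i by (rule assms(7)[OF that])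
    show "(\<Sum>k\<in>UNIV. N n k) = n" for n by (rule assms(8))
    show "0 < lam k" for k using assms(9)[of k] by simp
    show "(\<lambda>n. real (N n k) / real n) \<longlonglongrightarrow> lam k" for k by (rule assms(10))
  qed
  \<comment> \<open>Turns the conditional covariances of the statement into integrals over the laws
    of the groups.\<close>
  have C: "C i j k u \<bullet> v = csm_cov i j k u v" for i j k u v
    unfolding C_def csm_cov_def centered_sign_mean_def sign_mean_mean_def
    by (rule sign_cov_eq[OF assms(11) assms(12) assms(13) assms(14) assms(15)])
  show ?thesis
    unfolding U_def \<Sigma>_def by (rule U_stat_weak_convergence) (rule score_covariance[OF C])
qed

end
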